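(* Let $\lambda>0$ and fix $0<\lambda_1<\lambda_0<\lambda$ (the case $k=0$). Assume the following. (F) There are $q>2$, $\epsilon>0$ with $q-1-\epsilon>0$, and sequences $\alpha_1=(\alpha_{1i})_{i\in\mathbb Z},\alpha_2=(\alpha_{2i})_{i\in\mathbb Z}\in\ell^1$ such that $f:\ell^2\to\ell^2$, $(f(u))_i=f_i(u_i)$, is locally Lipschitz with $|f_i(a)-f_i(b)|\le\gamma(R)|a-b|$ whenever $|a|,|b|\le R$, where $\gamma:\mathbb R^+\to\mathbb R^+$ is bounded on bounded intervals, and $|f_i(a)|\le\alpha_{1i}|a|^{q-1-\epsilon}+\alpha_{2i}$. (G1) $g(t,u)=(g_i(t,u_i))_{i\in\mathbb Z}$, each $(t,a)\mapsto g_i(t,a)$ is continuous and differentiable in $a$, and there is $\beta>0$ with $g_i(t,a)a\le-\beta|a|^q+\psi_{1i}(t)$, $\frac{\partial g_i}{\partial a}(t,a)\le\psi_{2i}(t)$, $|g_i(t,a)|\le\psi_{3i}(t)|a|^{q-1}+\psi_{4i}(t)$, where $\psi_1\in L^1_{\rm loc}(\mathbb R;\ell^1)$, $\psi_2,\psi_3\in L^\infty_{\rm loc}(\mathbb R;\ell^\infty)$, $\psi_4\in L^2_{\rm loc}(\mathbb R;\ell^2)$. (G2) $\int_{-\infty}^0 e^{\lambda_1 s}(\|\psi_1(s)\|_1+\|\psi_4(s)\|^2)\,ds<\infty$ and $\psi_3\in L^\infty((-\infty,0];\ell^\infty)$. (H1) $h:\mathbb R\to\ell^2\cap\ell^q$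 is differentiable as an $\ell^2$-valued map, $h\in L^2_{\rm loc}(\mathbb R;\ell^2)\cap L^q_{\rm loc}(\mathbb R;\ell^q)$ and $h'\in L^2_{\rm loc}(\mathbb R;\ell^2)$. (H2) $\int_{-\infty}^0 e^{\lambda_1 s}(\|h(s)\|^2+\|h(s)\|_q^q+\|h'(s)\|^2)\,ds<\infty$. Let $\overline{\mathcal A}$ be the unique pullback random $\overline{\mathcal D}$-attractor of the nonautonomous random dynamical system $\varphi$ on $\ell^2$ (see context). Then for a given generalized Banach limit $\mathrm{LIM}_{t\to-\infty}$ and a mapping $\xi:\mathbb R\times\Omega\to\ell^2$ with $\{\xi(\tau,\omega)\}_{(\tau,\omega)\in\mathbb R\times\Omega}\in\overline{\mathcal D}$ such that $\xi(\tau,\theta_\tau\omega)$ is continuous in $\tau$, there exists a family of Borel probability measures $\{\overline\mu_{\tau,\omega}\}_{(\tau,\omega)\in\mathbb R\times\Omega}$ on $\ell^2$ such that the support of $\overline\mu_{\tau,\omega}$ is contained in $\overline{\mathcal A}(\tau,\omega)$ and for all $\Upsilon\in C(\ell^2)$, all $t\in\mathbb R$ and $\mathbb P$-a.s. $\omega\in\Omega$, $$\mathop{\mathrm{LIM}}_{\tau\to-\infty}\frac1{t-\tau}\int_\tau^t\Upsilon(\varphi(t-s,s,\theta_s\omega,\xi(s,\theta_s\omega)))\,ds=\int_{\overline{\mathcal A}(t,\theta_t\omega)}\Upsilon(u)\,\overline\mu_{t,\theta_t\omega}(du)=\int_{\ell^2}\Upsilon(u)\,\overline\mu_{t,\theta_t\omega}(du)$$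 $$=\mathop{\mathrm{LIM}}_{\tau\to-\infty}\frac1{t-\tau}\int_\tau^t\int_{\ell^2}\Upsilon(\varphi(t-s,s,\theta_s\omega,u))\,\overline\mu_{s,\theta_s\omega}(du)\,ds.$$ Additionally, $\overline\mu_{\tau,\omega}$ is invariant in the sense that for all $\tau\in\mathbb R$ and $\mathbb P$-a.s. $\omega\in\Omega$, $$\int_{\overline{\mathcal A}(\tau+t,\theta_t\omega)}\Upsilon(u)\,\overline\mu_{\tau+t,\theta_t\omega}(du)=\int_{\overline{\mathcal A}(\tau,\omega)}\Upsilon(\varphi(t,\tau,\omega,u))\,\overline\mu_{\tau,\omega}(du)\quad\text{for all }t\ge0.$$
   Context: Spaces. For $p\in[1,\infty)$, $\ell^p$ is the Banach space of real bi-infinite sequences with $\|u\|_p^p=\sum_{i\in\mathbb Z}|u_i|^p<\infty$; $\ell^\infty$ is the space of bounded bi-infinite sequences with the sup norm $\|\cdot\|_\infty$; $\ell^2$ has inner product $(u,v)=\sum_i u_iv_i$ and norm $\|\cdot\|$. $C(\ell^2)$ is the set of continuous real functions on $\ell^2$. $(Au)_i=2u_i-u_{i-1}-u_{i+1}$. Probability space. On $\{\omega\in C(\mathbb R):\omega(0)=0\}$ with the compact-open topology take the Borel $\sigma$-algebra $\mathcal F$ and Wiener measure $\mathbb P$; $\theta_t\omega(\cdot)=\omega(\cdot+t)-\omega(t)$. Put $z(\theta_t\omega)=-\int_{-\infty}^0 e^{s}\,\theta_t\omega(s)\,ds$. $\Omega$ is a $\theta_t$-invariant set of full measure such that for all $\omega\in\Omega$,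 $t\mapsto z(\theta_t\omega)$ is continuous and $\lim_{t\to\pm\infty}z(\theta_t\omega)/t=\lim_{t\to\pm\infty}\frac1t\int_0^t z(\theta_s\omega)ds=0$; we work on $\Omega$. $W(\omega)(t)=\omega(t)$. Equation ($k=0$). $du=-[A(Au+f(u))+\lambda u-g(t,u)]dt+h(t)dW(t)$, $t>\tau$, $u(\tau)=u_\tau\in\ell^2$. It is solved through the random equation $\frac{dv}{dt}=\overline F(t,\omega,v)$, $v(\tau)=v_\tau$, with $\overline F(t,\omega,v)=-A^2v-\lambda v-Af(v+z(\theta_t\omega)h(t))+g(t,v+z(\theta_t\omega)h(t))+z(\theta_t\omega)(-A^2h(t)+(1-\lambda)h(t)-h'(t))$, whose unique global solution is denoted $v(t,\tau,\omega,v_\tau)$. The solution of the stochastic equation is $u(t,\tau,\omega,u_\tau)=v(t,\tau,\omega,u_\tau-z(\theta_\tau\omega)h(\tau))+z(\theta_t\omega)h(t)$, and $\varphi(t,\tau,\omega,u_\tau)=u(t+\tau,\tau,\theta_{-\tau}\omega,u_\tau)$ for $t\ge0$. Random sets and attractors. A nonautonomous random set in $X$ is a family of nonempty subsets $D(\tau,\omega)\subset X$, $(\tau,\omega)\in\mathbb R\times\Omega$, such that $\omega\mapsto d_X(x,D(\tau,\omega))$ is measurable for every $(x,\tau)$. $\overline{\mathcal D}$ is the collection of all nonautonomous random sets $D$ in $\ell^2$ with $\lim_{s\to-\infty}e^{\lambda_0 s}\|D(\tau+s,\theta_s\omega)\|^2=0$ for every $\tau,\omega$, where $\|D\|=\sup_{u\in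 D}\|u\|$. A pullback random $\overline{\mathcal D}$-attractor in $X=\ell^2$ for $\varphi$ is a nonautonomous random set $\mathcal A$ such that: (1) $\mathcal A(\tau,\omega)$ is compact for all $\tau$ and $\mathbb P$-a.s. $\omega$; (2) $\varphi(t,\tau,\omega,\mathcal A(\tau,\omega))=\mathcal A(\tau+t,\theta_t\omega)$ for all $t\ge0$; (3) for every $D\in\overline{\mathcal D}$, $\lim_{t\to+\infty}\mathrm{dist}_X(\varphi(t,\tau-t,\theta_{-t}\omega,D(\tau-t,\theta_{-t}\omega)),\mathcal A(\tau,\omega))=0$, with $\mathrm{dist}_X(B,C)=\sup_{b\in B}\inf_{c\in C}\|b-c\|_X$; (4) there is a closed set $K\in\overline{\mathcal D}$ with $\mathcal A\subset K$. Under the hypotheses of the claim it exists and is unique. A generalized Banach limit $\mathrm{LIM}_{t\to-\infty}$ is any linear functional defined for arbitrary bounded real functions on $(-\infty,a]$ (some $a\in\mathbb R$) such that $\mathrm{LIM}_{t\to-\infty}\zeta(t)\ge0$ for nonnegative $\zeta$, and $\mathrm{LIM}_{t\to-\infty}\zeta(t)=\lim_{t\to-\infty}\zeta(t)$ if the latter limit exists. *)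

theory Defs
  imports "HOL-Probability.Probability"
begin

section \<open>Sequence spaces over the integers\<close>

definition lp_seq :: "real \<Rightarrow> (int \<Rightarrow> real) set" where
  "lp_seq p = {u. (\<lambda>i. \<bar>u i\<bar> powr p) summable_on UNIV}"

definition lp_norm :: "real \<Rightarrow> (int \<Rightarrow> real) \<Rightarrow> real" where
  "lp_norm p u = (\<Sum>\<^sub>\<infinity>i. \<bar>u i\<bar> powr p) powr (1 / p)"

definition linf_seq :: "(int \<Rightarrow> real) set" where
  "linf_seq = {u. bounded (range u)}"

definition linf_norm :: "(int \<Rightarrow> real) \<Rightarrow> real" where
  "linf_norm u = (SUP i. \<bar>u i\<bar>)"

lemma mem_lp_seq_2: "u \<in> lp_seq 2 \<longleftrightarrow> (\<lambda>i. (u i)\<^sup>2) summable_on UNIV"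
proof -
  have "(\<lambda>i. \<bar>u i\<bar> powr 2) = (\<lambda>i. (u i)\<^sup>2)"
    by (simp add: fun_eq_iff)
  thus ?thesis by (simp add: lp_seq_def)
qed

lemma lp_seq_2_mult_summable:
  assumes "u \<in> lp_seq 2" "v \<in> lp_seq 2"
  shows "(\<lambda>i. u i * v i) summable_on UNIV"
proof -
  have s: "(\<lambda>i. (u i)\<^sup>2 + (v i)\<^sup>2) summable_on UNIV"
    using assms by (intro summable_on_add) (auto simp: mem_lp_seq_2)
  have "norm (u i * v i) \<le> (u i)\<^sup>2 + (v i)\<^sup>2" for i
  proof -
    have "2 * (\<bar>u i\<bar> * \<bar>v i\<bar>) \<le> (u i)\<^sup>2 + (v i)\<^sup>2"
      using sum_squares_bound[of "\<bar>u i\<bar>" "\<bar>v i\<bar>"] by simp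
    moreover have "0 \<le> \<bar>u i\<bar> * \<bar>v i\<bar>" by simp
    ultimately show ?thesis unfolding real_norm_def abs_mult by linarith
  qed
  hence "(\<lambda>i. norm (u i * v i)) summable_on UNIV"
    by (intro summable_on_comparison_test[OF s]) auto
  thus ?thesis by (rule abs_summable_summable)
qed

lemma lp_seq_2_zero: "(\<lambda>_. 0) \<in> lp_seq 2"
  by (simp add: mem_lp_seq_2)

lemma lp_seq_2_add:
  assumes "u \<in> lp_seq 2" "v \<in> lp_seq 2"
  shows "(\<lambda>i. u i + v i) \<in> lp_seq 2"
proof -
  have "(\<lambda>i. (u i)\<^sup>2 + (v i)\<^sup>2 + 2 * (u i * v i)) summable_on UNIV"
    using assms lp_seq_2_mult_summable[OF assms]
    by (intro summable_on_add summable_on_cmult_right) (auto simp: mem_lp_seq_2)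
  thus ?thesis by (simp add: mem_lp_seq_2 power2_sum algebra_simps)
qed

lemma lp_seq_2_scale:
  assumes "u \<in> lp_seq 2"
  shows "(\<lambda>i. c * u i) \<in> lp_seq 2"
  using assms by (auto simp: mem_lp_seq_2 power_mult_distrib intro!: summable_on_cmult_right)

lemma lp_seq_2_uminus: "u \<in> lp_seq 2 \<Longrightarrow> (\<lambda>i. - u i) \<in> lp_seq 2"
  by (simp add: mem_lp_seq_2)

lemma lp_seq_2_diff:
  assumes "u \<in> lp_seq 2" "v \<in> lp_seq 2"
  shows "(\<lambda>i. u i - v i) \<in> lp_seq 2"
  using lp_seq_2_add[OF assms(1) lp_seq_2_uminus[OF assms(2)]] by simp

lemma lp_seq_2_shift:
  assumes "u \<in> lp_seq 2"
  shows "(\<lambda>i. u (i + k)) \<in> lp_seq 2"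
proof -
  have "bij_betw (\<lambda>i::int. i + k) UNIV UNIV"
    by (rule bij_betwI[where g = "\<lambda>i. i - k"]) auto
  from summable_on_reindex_bij_betw[OF this, of "\<lambda>i. (u i)\<^sup>2"] assms
  show ?thesis by (simp add: mem_lp_seq_2)
qed

section \<open>The Hilbert space of square summable bi-infinite sequences\<close>

typedef ell2 = "lp_seq 2" morphisms seq Abs_ell2
  using lp_seq_2_zero by blast

setup_lifting type_definition_ell2

lemma seq_mem: "seq u \<in> lp_seq 2"
  by (rule seq)

lemma ell2_eqI: "(\<And>i. seq u i = seq v i) \<Longrightarrow> u = v"
  by (metis ext seq_inject)

instantiation ell2 :: real_inner
begin

lift_definition zero_ell2 :: ell2 is "\<lambda>_. 0" by (rule lp_seq_2_zero)

lift_definition plus_ell2 :: "ell2 \<Rightarrow> ell2 \<Rightarrow> ell2" is "\<lambda>u v i. u i + v i"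
  by (rule lp_seq_2_add)

lift_definition uminus_ell2 :: "ell2 \<Rightarrow> ell2" is "\<lambda>u i. - u i"
  by (rule lp_seq_2_uminus)

lift_definition minus_ell2 :: "ell2 \<Rightarrow> ell2 \<Rightarrow> ell2" is "\<lambda>u v i. u i - v i"
  by (rule lp_seq_2_diff)

lift_definition scaleR_ell2 :: "real \<Rightarrow> ell2 \<Rightarrow> ell2" is "\<lambda>c u i. c * u i"
  by (rule lp_seq_2_scale)

definition inner_ell2 :: "ell2 \<Rightarrow> ell2 \<Rightarrow> real" where
  "inner_ell2 u v = (\<Sum>\<^sub>\<infinity>i. seq u i * seq v i)"

definition norm_ell2 :: "ell2 \<Rightarrow> real" where
  "norm_ell2 u = sqrt (u \<bullet> u)"

definition dist_ell2 :: "ell2 \<Rightarrow> ell2 \<Rightarrow> real" where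
  "dist_ell2 u v = norm (u - v)"

definition sgn_ell2 :: "ell2 \<Rightarrow> ell2" where
  "sgn_ell2 u = inverse (norm u) *\<^sub>R u"

definition uniformity_ell2 :: "(ell2 \<times> ell2) filter" where
  "uniformity_ell2 = (INF e\<in>{0<..}. principal {(x, y). dist x y < e})"

definition open_ell2 :: "ell2 set \<Rightarrow> bool" where
  "open_ell2 U = (\<forall>x\<in>U. \<forall>\<^sub>F (x', y) in uniformity. x' = x \<longrightarrow> y \<in> U)"

instance
proof
  fix u v w :: ell2 and a b :: real
  show "u + v + w = u + (v + w)" "u + v = v + u" "0 + u = u" "- u + u = 0" "u - v = u + - v"
    by (transfer; simp add: fun_eq_iff)+
  show "a *\<^sub>R (u + v) = a *\<^sub>R u + a *\<^sub>R v" "(a + b) *\<^sub>R u = a *\<^sub>R u + b *\<^sub>R u"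
    "a *\<^sub>R b *\<^sub>R u = (a * b) *\<^sub>R u" "1 *\<^sub>R u = u"
    by (transfer; simp add: fun_eq_iff algebra_simps)+
  show "dist u v = norm (u - v)" by (rule dist_ell2_def)
  show "sgn u = inverse (norm u) *\<^sub>R u" by (rule sgn_ell2_def)
  show "(uniformity :: (ell2 \<times> ell2) filter) = (INF e\<in>{0<..}. principal {(x, y). dist x y < e})"
    by (rule uniformity_ell2_def)
  show "open U = (\<forall>x\<in>U. \<forall>\<^sub>F (x', y) in uniformity. x' = x \<longrightarrow> y \<in> U)" for U :: "ell2 set"
    by (rule open_ell2_def)
  show "u \<bullet> v = v \<bullet> u" by (simp add: inner_ell2_def mult.commute)
  have s: "(\<lambda>i. seq x i * seq y i) summable_on UNIV" for x y
    by (rule lp_seq_2_mult_summable[OF seq_mem seq_mem])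
  show "(u + v) \<bullet> w = u \<bullet> w + v \<bullet> w"
    unfolding inner_ell2_def plus_ell2.rep_eq distrib_right
    by (rule infsum_add[OF s s])
  show "(a *\<^sub>R u) \<bullet> v = a * (u \<bullet> v)"
    unfolding inner_ell2_def scaleR_ell2.rep_eq mult.assoc
    by (rule infsum_cmult_right) (rule s)
  show pos: "0 \<le> u \<bullet> u"
    unfolding inner_ell2_def by (rule infsum_nonneg) simp
  show "(u \<bullet> u = 0) = (u = 0)"
  proof
    assume z: "u \<bullet> u = 0"
    show "u = 0"
    proof (rule ell2_eqI)
      fix i
      have "sum (\<lambda>i. seq u i * seq u i) {i} \<le> u \<bullet> u"
        unfolding inner_ell2_def by (rule finite_sum_le_infsum[OF s]) auto
      with z show "seq u i = seq 0 i"
        by (auto simp: zero_ell2.rep_eq mult_le_0_iff)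
    qed
  qed (simp add: inner_ell2_def zero_ell2.rep_eq)
  show "norm u = sqrt (u \<bullet> u)" by (rule norm_ell2_def)
qed

end

lemma norm_ell2_sq: "(norm u)\<^sup>2 = (\<Sum>\<^sub>\<infinity>i. (seq u i)\<^sup>2)" for u :: ell2
  unfolding power2_norm_eq_inner inner_ell2_def by (simp add: power2_eq_square)

lemma norm_ell2_eq_lp_norm: "norm u = lp_norm 2 (seq u)" for u :: ell2
proof -
  have "(\<lambda>i. \<bar>seq u i\<bar> powr 2) = (\<lambda>i. (seq u i)\<^sup>2)"
    by (simp add: fun_eq_iff)
  hence "lp_norm 2 (seq u) = sqrt ((norm u)\<^sup>2)"
    by (simp add: lp_norm_def norm_ell2_sq powr_half_sqrt infsum_nonneg)
  thus ?thesis by simp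
qed

lemma sum_seq_le_norm:
  fixes u :: ell2
  assumes "finite F"
  shows "(\<Sum>i\<in>F. (seq u i)\<^sup>2) \<le> (norm u)\<^sup>2"
  unfolding norm_ell2_sq using assms seq_mem[of u]
  by (intro finite_sum_le_infsum) (auto simp: mem_lp_seq_2)

lemma abs_seq_le_norm: "\<bar>seq u i\<bar> \<le> norm u" for u :: ell2
  using sum_seq_le_norm[of "{i}" u] by (simp add: abs_le_square_iff[symmetric])

lemma ell2_norm_le:
  fixes u :: ell2
  assumes "0 \<le> b" "\<And>F. finite F \<Longrightarrow> (\<Sum>i\<in>F. (seq u i)\<^sup>2) \<le> b\<^sup>2"
  shows "norm u \<le> b"
proof -
  have "(\<Sum>\<^sub>\<infinity>i. (seq u i)\<^sup>2) \<le> b\<^sup>2"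
    using assms(2) seq_mem[of u] by (intro infsum_le_finite_sums) (auto simp: mem_lp_seq_2)
  thus ?thesis using assms(1) by (simp add: norm_ell2_sq[symmetric] power2_le_iff_abs_le)
qed

instance ell2 :: complete_space
proof
  fix X :: "nat \<Rightarrow> ell2"
  assume C: "Cauchy X"
  have "Cauchy (\<lambda>n. seq (X n) i)" for i
  proof (rule metric_CauchyI)
    fix e :: real assume "e > 0"
    then obtain N where N: "\<And>m n. m \<ge> N \<Longrightarrow> n \<ge> N \<Longrightarrow> dist (X m) (X n) < e"
      using C by (metis metric_CauchyD)
    show "\<exists>M. \<forall>m\<ge>M. \<forall>n\<ge>M. dist (seq (X m) i) (seq (X n) i) < e"
    proof (intro exI allI impI)
      fix m n assume "N \<le> m" "N \<le> n"
      from N[OF this] abs_seq_le_norm[of "X m - X n" i]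
      show "dist (seq (X m) i) (seq (X n) i) < e"
        by (simp add: dist_norm minus_ell2.rep_eq)
    qed
  qed
  hence "\<exists>l. (\<lambda>n. seq (X n) i) \<longlonglongrightarrow> l" for i
    by (simp add: Cauchy_convergent_iff convergent_def)
  then obtain x where x: "\<And>i. (\<lambda>n. seq (X n) i) \<longlonglongrightarrow> x i" by metis
  have lim_le: "(\<Sum>i\<in>F. (seq (X m) i - x i)\<^sup>2) \<le> e\<^sup>2"
    if F: "finite F" and N: "\<And>n. n \<ge> N \<Longrightarrow> dist (X m) (X n) < e" for F m N e
  proof (rule Lim_bounded)
    show "(\<lambda>n. \<Sum>i\<in>F. (seq (X m) i - seq (X n) i)\<^sup>2) \<longlonglongrightarrow> (\<Sum>i\<in>F. (seq (X m) i - x i)\<^sup>2)"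
      by (intro tendsto_intros x)
    show "\<forall>n\<ge>N. (\<Sum>i\<in>F. (seq (X m) i - seq (X n) i)\<^sup>2) \<le> e\<^sup>2"
    proof (intro allI impI)
      fix n assume "N \<le> n"
      have "(norm (X m - X n))\<^sup>2 \<le> e\<^sup>2"
        using N[OF \<open>N \<le> n\<close>] by (intro power_mono) (auto simp: dist_norm)
      with sum_seq_le_norm[OF F, of "X m - X n"]
      show "(\<Sum>i\<in>F. (seq (X m) i - seq (X n) i)\<^sup>2) \<le> e\<^sup>2"
        by (simp add: minus_ell2.rep_eq)
    qed
  qed
  have "x \<in> lp_seq 2"
  proof -
    obtain N where N: "\<And>m n. m \<ge> N \<Longrightarrow> n \<ge> N \<Longrightarrow> dist (X m) (X n) < 1"
      using C by (metis metric_CauchyD zero_less_one)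
    have "(\<lambda>i. (seq (X N) i - x i)\<^sup>2) summable_on UNIV"
    proof (rule nonneg_bdd_above_summable_on)
      show "bdd_above (sum (\<lambda>i. (seq (X N) i - x i)\<^sup>2) ` {F. F \<subseteq> UNIV \<and> finite F})"
        using lim_le[of _ N N 1] N by (auto intro!: bdd_aboveI[of _ "1\<^sup>2"])
    qed simp
    hence "(\<lambda>i. seq (X N) i - x i) \<in> lp_seq 2" by (simp add: mem_lp_seq_2)
    from lp_seq_2_diff[OF seq_mem[of "X N"] this] show ?thesis by simp
  qed
  then obtain u where u: "seq u = x" by (metis Abs_ell2_inverse)
  have "X \<longlonglongrightarrow> u"
  proof (rule metric_LIMSEQ_I)
    fix r :: real assume r: "0 < r"
    then obtain N where N: "\<And>m n. m \<ge> N \<Longrightarrow> n \<ge> N \<Longrightarrow> dist (X m) (X n) < r / 2"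
      using C by (metis metric_CauchyD half_gt_zero)
    show "\<exists>no. \<forall>n\<ge>no. dist (X n) u < r"
    proof (intro exI allI impI)
      fix n assume "N \<le> n"
      have "norm (X n - u) \<le> r / 2"
        using r lim_le[of _ N n "r / 2"] N[OF \<open>N \<le> n\<close>]
        by (intro ell2_norm_le) (auto simp: minus_ell2.rep_eq u)
      with r show "dist (X n) u < r" by (simp add: dist_norm)
    qed
  qed
  thus "convergent X" by (auto simp: convergent_def)
qed

instance ell2 :: banach ..

lemma countable_dense_ell2:
  "\<exists>D :: ell2 set. countable D \<and> (\<forall>u e. e > 0 \<longrightarrow> (\<exists>d\<in>D. norm (u - d) < e))"
proof -
  define S :: "nat \<Rightarrow> (int \<Rightarrow> real) set" where
    "S n = (\<lambda>p i. if i \<in> {- int n..int n} then p i else 0) ` (Pi\<^sub>E {- int n..int n} (\<lambda>_. \<rat>))" for n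
  define D where "D = Abs_ell2 ` (\<Union>n. S n)"
  have "countable (S n)" for n
    unfolding S_def by (intro countable_image countable_PiE) (auto simp: countable_rat)
  hence "countable D" unfolding D_def by auto
  moreover have "\<exists>d\<in>D. norm (u - d) < e" if e: "e > 0" for u e
  proof -
    have sm: "(\<lambda>i. (seq u i)\<^sup>2) summable_on UNIV"
      using seq_mem[of u] by (simp add: mem_lp_seq_2)
    have e2: "(e / 2)\<^sup>2 > 0" using e by simp
    have "((\<lambda>i. (seq u i)\<^sup>2) has_sum (norm u)\<^sup>2) UNIV"
      using sm by (simp add: norm_ell2_sq)
    hence "((\<lambda>G. \<Sum>i\<in>G. (seq u i)\<^sup>2) \<longlongrightarrow> (norm u)\<^sup>2) (finite_subsets_at_top UNIV)"
      by (simp add: has_sum_def)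
    from tendstoD[OF this e2]
    obtain F where F: "finite F" "\<And>G. finite G \<Longrightarrow> F \<subseteq> G \<Longrightarrow>
        dist (\<Sum>i\<in>G. (seq u i)\<^sup>2) ((norm u)\<^sup>2) < (e / 2)\<^sup>2"
      unfolding eventually_finite_subsets_at_top by auto
    define n where "n = nat (Max (insert 0 (abs ` F)))"
    define I where "I = {- int n..int n}"
    have FI: "F \<subseteq> I"
    proof
      fix i assume "i \<in> F"
      hence "\<bar>i\<bar> \<le> Max (insert 0 (abs ` F))" using F(1) by (intro Max_ge) auto
      hence "\<bar>i\<bar> \<le> int n" unfolding n_def by linarith
      thus "i \<in> I" by (auto simp: I_def)
    qed
    have finI: "finite I" by (simp add: I_def)
    define k where "k = real (card I)"
    have k: "k > 0" by (simp add: k_def I_def)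
    have "\<exists>r\<in>\<rat>. \<bar>seq u i - r\<bar> < e / (2 * sqrt k)" for i
    proof -
      have "e / (2 * sqrt k) > 0" using e k by simp
      hence "seq u i < seq u i + e / (2 * sqrt k)" by simp
      from Rats_dense_in_real[OF this] show ?thesis by force
    qed
    then obtain r where r: "\<And>i. r i \<in> \<rat>" "\<And>i. \<bar>seq u i - r i\<bar> < e / (2 * sqrt k)" by metis
    define s where "s = (\<lambda>i. if i \<in> I then r i else 0)"
    have sS: "s \<in> S n"
      unfolding S_def s_def I_def[symmetric]
      by (rule image_eqI[where x = "restrict r I"]) (auto simp: r)
    have "(\<lambda>i. (s i)\<^sup>2) summable_on UNIV"
    proof (subst summable_on_cong_neutral)
      show "(\<lambda>i. (s i)\<^sup>2) summable_on I" using finI by simp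
    qed (auto simp: s_def)
    hence s2: "s \<in> lp_seq 2" by (simp add: mem_lp_seq_2)
    define d where "d = Abs_ell2 s"
    have ds: "seq d = s" using s2 by (simp add: d_def Abs_ell2_inverse)
    have "d \<in> D" unfolding D_def d_def using sS by blast
    have "norm (u - d) \<le> sqrt (2 * (e / 2)\<^sup>2)"
    proof (rule ell2_norm_le)
      fix G :: "int set" assume G: "finite G"
      have "(\<Sum>i\<in>G. (seq (u - d) i)\<^sup>2) \<le> (\<Sum>i\<in>G \<union> I. (seq (u - d) i)\<^sup>2)"
        using G finI by (intro sum_mono2) auto
      also have "\<dots> = (\<Sum>i\<in>(G - I) \<union> I. (seq (u - d) i)\<^sup>2)" by simp
      also have "\<dots> = (\<Sum>i\<in>G - I. (seq (u - d) i)\<^sup>2) + (\<Sum>i\<in>I. (seq (u - d) i)\<^sup>2)"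
        using G finI by (intro sum.union_disjoint) auto
      also have "(\<Sum>i\<in>G - I. (seq (u - d) i)\<^sup>2) = (\<Sum>i\<in>G - I. (seq u i)\<^sup>2)"
        by (intro sum.cong) (auto simp: minus_ell2.rep_eq ds s_def)
      also have "\<dots> \<le> (e / 2)\<^sup>2"
      proof -
        have "(\<Sum>i\<in>G \<union> I. (seq u i)\<^sup>2) = (\<Sum>i\<in>(G - I) \<union> I. (seq u i)\<^sup>2)" by simp
        also have "\<dots> = (\<Sum>i\<in>G - I. (seq u i)\<^sup>2) + (\<Sum>i\<in>I. (seq u i)\<^sup>2)"
          using G finI by (intro sum.union_disjoint) auto
        finally have "(\<Sum>i\<in>G \<union> I. (seq u i)\<^sup>2) = \<dots>" .
        moreover have "(\<Sum>i\<in>G \<union> I. (seq u i)\<^sup>2) \<le> (norm u)\<^sup>2"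
          using G finI by (intro sum_seq_le_norm) auto
        moreover have "dist (\<Sum>i\<in>I. (seq u i)\<^sup>2) ((norm u)\<^sup>2) < (e / 2)\<^sup>2"
          by (rule F(2)[OF finI FI])
        ultimately show ?thesis by (auto simp: dist_real_def)
      qed
      also have "(\<Sum>i\<in>I. (seq (u - d) i)\<^sup>2) \<le> (\<Sum>i\<in>I. (e / 2)\<^sup>2 / k)"
      proof (rule sum_mono)
        fix i assume "i \<in> I"
        have "(seq (u - d) i)\<^sup>2 = \<bar>seq u i - r i\<bar>\<^sup>2"
          using \<open>i \<in> I\<close> by (simp add: minus_ell2.rep_eq ds s_def)
        also have "\<dots> \<le> (e / (2 * sqrt k))\<^sup>2"
          using r(2)[of i] by (intro power_mono) auto
        also have "\<dots> = (e / 2)\<^sup>2 / k" using k by (simp add: power_divide power_mult_distrib)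
        finally show "(seq (u - d) i)\<^sup>2 \<le> (e / 2)\<^sup>2 / k" .
      qed
      also have "(\<Sum>i\<in>I. (e / 2)\<^sup>2 / k) = (e / 2)\<^sup>2" using k by (simp add: k_def)
      finally show "(\<Sum>i\<in>G. (seq (u - d) i)\<^sup>2) \<le> (sqrt (2 * (e / 2)\<^sup>2))\<^sup>2" by simp
    qed simp
    also have "\<dots> < sqrt (e\<^sup>2)"
      using e by (intro real_sqrt_less_mono) (simp add: power_divide)
    also have "\<dots> = e" using e by simp
    finally show ?thesis using \<open>d \<in> D\<close> by blast
  qed
  ultimately show ?thesis by blast
qed

instance ell2 :: second_countable_topology
proof
  obtain D :: "ell2 set" where D: "countable D" "\<And>u e. e > 0 \<Longrightarrow> \<exists>d\<in>D. norm (u - d) < e"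
    using countable_dense_ell2 by blast
  define B where "B = (\<lambda>(d, r). ball d r) ` (D \<times> \<rat>)"
  have "countable B" unfolding B_def using D(1) by (intro countable_image) (simp add: countable_rat)
  moreover have "topological_basis B"
  proof (rule topological_basisI)
    fix U and x :: ell2 assume "open U" "x \<in> U"
    then obtain e where e: "e > 0" "ball x e \<subseteq> U" by (metis open_contains_ball)
    from Rats_dense_in_real[of "e / 4" "e / 2"] e
    obtain r where r: "r \<in> \<rat>" "e / 4 < r" "r < e / 2" by auto
    obtain d where d: "d \<in> D" "norm (x - d) < e / 4" using D(2)[of "e / 4"] e by auto
    have "ball d r \<subseteq> ball x e"
    proof
      fix y assume "y \<in> ball d r"
      moreover have "dist x y \<le> dist x d + dist d y" by (rule dist_triangle)
      ultimately show "y \<in> ball x e" using d r by (simp add: dist_norm)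
    qed
    moreover have "x \<in> ball d r" using d r by (simp add: dist_norm norm_minus_commute)
    moreover have "ball d r \<in> B" unfolding B_def using d r by auto
    ultimately show "\<exists>B'\<in>B. x \<in> B' \<and> B' \<subseteq> U" using e by blast
  qed (auto simp: B_def)
  ultimately show "\<exists>B :: ell2 set set. countable B \<and> open = generate_topology B"
    using topological_basis_imp_subbasis by blast
qed

instance ell2 :: polish_space ..

text \<open>
  Total conversion from sequences.  It is only meant for square summable arguments; other
  sequences go to \<open>0\<close>.
\<close>

definition to_ell2 :: "(int \<Rightarrow> real) \<Rightarrow> ell2" where
  "to_ell2 x = (if x \<in> lp_seq 2 then Abs_ell2 x else 0)"

lift_definition opA :: "ell2 \<Rightarrow> ell2" is "\<lambda>u i. 2 * u i - u (i - 1) - u (i + 1)"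
proof -
  fix u :: "int \<Rightarrow> real" assume u: "u \<in> lp_seq 2"
  show "(\<lambda>i. 2 * u i - u (i - 1) - u (i + 1)) \<in> lp_seq 2"
    using lp_seq_2_diff[OF lp_seq_2_diff[OF lp_seq_2_scale[OF u] lp_seq_2_shift[OF u]]
        lp_seq_2_shift[OF u], of 2 "-1" 1] by simp
qed

definition nemytskii :: "(int \<Rightarrow> real \<Rightarrow> real) \<Rightarrow> ell2 \<Rightarrow> ell2" where
  "nemytskii f u = to_ell2 (\<lambda>i. f i (seq u i))"


section \<open>Bochner-Lebesgue spaces with values in sequence spaces\<close>

text \<open>
  \<open>X\<close> is a space of sequences with norm \<open>N\<close>.  Strong (Bochner) measurability on \<open>T\<close> is
  almost everywhere approximation by simple functions; this also makes sense for the
  nonseparable space of bounded sequences.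
\<close>

definition strongly_measurable_on ::
  "real set \<Rightarrow> (int \<Rightarrow> real) set \<Rightarrow> ((int \<Rightarrow> real) \<Rightarrow> real) \<Rightarrow> (real \<Rightarrow> int \<Rightarrow> real) \<Rightarrow> bool" where
  "strongly_measurable_on T X N \<psi> \<longleftrightarrow>
     (\<exists>s :: nat \<Rightarrow> real \<Rightarrow> int \<Rightarrow> real.
        (\<forall>n. simple_function lebesgue (s n) \<and> range (s n) \<subseteq> X) \<and>
        (AE t in lebesgue. t \<in> T \<longrightarrow>
           \<psi> t \<in> X \<and> (\<lambda>n. N (\<lambda>i. \<psi> t i - s n t i)) \<longlonglongrightarrow> 0))"

definition Lp_loc ::
  "real \<Rightarrow> (int \<Rightarrow> real) set \<Rightarrow> ((int \<Rightarrow> real) \<Rightarrow> real) \<Rightarrow> (real \<Rightarrow> int \<Rightarrow> real) \<Rightarrow> bool" where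
  "Lp_loc r X N \<psi> \<longleftrightarrow>
     strongly_measurable_on UNIV X N \<psi> \<and>
     (\<forall>a b. (\<integral>\<^sup>+t\<in>{a..b}. ennreal (N (\<psi> t) powr r) \<partial>lebesgue) < \<infinity>)"

definition Linf_on ::
  "real set \<Rightarrow> (int \<Rightarrow> real) set \<Rightarrow> ((int \<Rightarrow> real) \<Rightarrow> real) \<Rightarrow> (real \<Rightarrow> int \<Rightarrow> real) \<Rightarrow> bool" where
  "Linf_on T X N \<psi> \<longleftrightarrow>
     strongly_measurable_on T X N \<psi> \<and>
     (\<exists>M. AE t in lebesgue. t \<in> T \<longrightarrow> N (\<psi> t) \<le> M)"

definition Linf_loc ::
  "(int \<Rightarrow> real) set \<Rightarrow> ((int \<Rightarrow> real) \<Rightarrow> real) \<Rightarrow> (real \<Rightarrow> int \<Rightarrow> real) \<Rightarrow> bool" where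
  "Linf_loc X N \<psi> \<longleftrightarrow> (\<forall>a b. Linf_on {a..b} X N \<psi>)"


section \<open>The hypotheses on the coefficients\<close>

definition cond_F ::
  "real \<Rightarrow> real \<Rightarrow> (int \<Rightarrow> real) \<Rightarrow> (int \<Rightarrow> real) \<Rightarrow> (real \<Rightarrow> real) \<Rightarrow> (int \<Rightarrow> real \<Rightarrow> real) \<Rightarrow> bool" where
  "cond_F q \<epsilon> \<alpha>1 \<alpha>2 \<gamma> f \<longleftrightarrow>
     q > 2 \<and> \<epsilon> > 0 \<and> q - 1 - \<epsilon> > 0 \<and>
     \<alpha>1 \<in> lp_seq 1 \<and> \<alpha>2 \<in> lp_seq 1 \<and>
     (\<forall>u :: ell2. (\<lambda>i. f i (seq u i)) \<in> lp_seq 2) \<and>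
     (\<forall>u. \<exists>r>0. \<exists>L. L-lipschitz_on (cball u r) (nemytskii f)) \<and>
     (\<forall>R\<ge>0. \<gamma> R \<ge> 0) \<and> (\<forall>R. bounded (\<gamma> ` {0..R})) \<and>
     (\<forall>i R a b. \<bar>a\<bar> \<le> R \<longrightarrow> \<bar>b\<bar> \<le> R \<longrightarrow> \<bar>f i a - f i b\<bar> \<le> \<gamma> R * \<bar>a - b\<bar>) \<and>
     (\<forall>i a. \<bar>f i a\<bar> \<le> \<alpha>1 i * \<bar>a\<bar> powr (q - 1 - \<epsilon>) + \<alpha>2 i)"

definition cond_G1 ::
  "real \<Rightarrow> real \<Rightarrow> (real \<Rightarrow> int \<Rightarrow> real) \<Rightarrow> (real \<Rightarrow> int \<Rightarrow> real) \<Rightarrow> (real \<Rightarrow> int \<Rightarrow> real) \<Rightarrow>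
   (real \<Rightarrow> int \<Rightarrow> real) \<Rightarrow> (int \<Rightarrow> real \<Rightarrow> real \<Rightarrow> real) \<Rightarrow> bool" where
  "cond_G1 q \<beta> \<psi>1 \<psi>2 \<psi>3 \<psi>4 g \<longleftrightarrow>
     \<beta> > 0 \<and>
     (\<forall>i. continuous_on UNIV (\<lambda>(t, a). g i t a)) \<and>
     (\<forall>i t a. (\<lambda>b. g i t b) differentiable (at a)) \<and>
     (\<forall>i t a. g i t a * a \<le> - \<beta> * \<bar>a\<bar> powr q + \<psi>1 t i) \<and>
     (\<forall>i t a. deriv (\<lambda>b. g i t b) a \<le> \<psi>2 t i) \<and>
     (\<forall>i t a. \<bar>g i t a\<bar> \<le> \<psi>3 t i * \<bar>a\<bar> powr (q - 1) + \<psi>4 t i) \<and>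
     Lp_loc 1 (lp_seq 1) (lp_norm 1) \<psi>1 \<and>
     Linf_loc linf_seq linf_norm \<psi>2 \<and>
     Linf_loc linf_seq linf_norm \<psi>3 \<and>
     Lp_loc 2 (lp_seq 2) (lp_norm 2) \<psi>4"

definition cond_G2 ::
  "real \<Rightarrow> (real \<Rightarrow> int \<Rightarrow> real) \<Rightarrow> (real \<Rightarrow> int \<Rightarrow> real) \<Rightarrow> (real \<Rightarrow> int \<Rightarrow> real) \<Rightarrow> bool" where
  "cond_G2 lam1 \<psi>1 \<psi>3 \<psi>4 \<longleftrightarrow>
     (\<integral>\<^sup>+s\<in>{..0}. ennreal (exp (lam1 * s) * (lp_norm 1 (\<psi>1 s) + (lp_norm 2 (\<psi>4 s))\<^sup>2)) \<partial>lebesgue) < \<infinity> \<and>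
     Linf_on {..0} linf_seq linf_norm \<psi>3"

definition cond_H1 :: "real \<Rightarrow> (real \<Rightarrow> ell2) \<Rightarrow> (real \<Rightarrow> ell2) \<Rightarrow> bool" where
  "cond_H1 q h h' \<longleftrightarrow>
     (\<forall>t. seq (h t) \<in> lp_seq q) \<and>
     (\<forall>t. (h has_vector_derivative h' t) (at t)) \<and>
     Lp_loc 2 (lp_seq 2) (lp_norm 2) (\<lambda>t. seq (h t)) \<and>
     Lp_loc q (lp_seq q) (lp_norm q) (\<lambda>t. seq (h t)) \<and>
     Lp_loc 2 (lp_seq 2) (lp_norm 2) (\<lambda>t. seq (h' t))"

definition cond_H2 :: "real \<Rightarrow> real \<Rightarrow> (real \<Rightarrow> ell2) \<Rightarrow> (real \<Rightarrow> ell2) \<Rightarrow> bool" where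
  "cond_H2 lam1 q h h' \<longleftrightarrow>
     (\<integral>\<^sup>+s\<in>{..0}. ennreal (exp (lam1 * s) *
        ((norm (h s))\<^sup>2 + lp_norm q (seq (h s)) powr q + (norm (h' s))\<^sup>2)) \<partial>lebesgue) < \<infinity>"


section \<open>Wiener space and the Ornstein-Uhlenbeck process\<close>

definition path_space :: "(real \<Rightarrow> real) set" where
  "path_space = {\<omega>. continuous_on UNIV \<omega> \<and> \<omega> 0 = 0}"

definition compact_open_topology :: "(real \<Rightarrow> real) topology" where
  "compact_open_topology =
     topology_generated_by {{\<omega> \<in> path_space. \<omega> ` K \<subseteq> U} | K U. compact K \<and> open U}"

text \<open>Two-sided Wiener measure, characterised by its increments.\<close>

definition wiener_measure :: "(real \<Rightarrow> real) measure \<Rightarrow> bool" where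
  "wiener_measure P \<longleftrightarrow>
     prob_space P \<and>
     space P = path_space \<and>
     sets P = sigma_sets path_space {S. openin compact_open_topology S} \<and>
     (\<forall>s t. s < t \<longrightarrow>
        distr P borel (\<lambda>\<omega>. \<omega> t - \<omega> s) = density lborel (normal_density 0 (sqrt (t - s)))) \<and>
     (\<forall>(n::nat) (t :: nat \<Rightarrow> real). strict_mono_on {..n} t \<longrightarrow>
        prob_space.indep_vars P (\<lambda>_. borel) (\<lambda>i \<omega>. \<omega> (t (Suc i)) - \<omega> (t i)) {..<n})"

definition \<theta> :: "real \<Rightarrow> (real \<Rightarrow> real) \<Rightarrow> real \<Rightarrow> real" where
  "\<theta> t \<omega> = (\<lambda>s. \<omega> (s + t) - \<omega> t)"

definition ou_z :: "(real \<Rightarrow> real) \<Rightarrow> real" where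
  "ou_z \<omega> = - (LINT s:{..0}|lborel. exp s * \<omega> s)"

text \<open>
  \<open>LBINT s=0..t\<close> is the oriented integral, so the second average is meaningful for \<open>t < 0\<close> too.
  The integrability clause says that the integral in \<^const>\<open>ou_z\<close> exists.
\<close>

definition admissible_paths :: "(real \<Rightarrow> real) measure \<Rightarrow> (real \<Rightarrow> real) set \<Rightarrow> bool" where
  "admissible_paths P \<Omega> \<longleftrightarrow>
     \<Omega> \<in> sets P \<and> measure P \<Omega> = 1 \<and>
     (\<forall>t. \<theta> t ` \<Omega> = \<Omega>) \<and>
     (\<forall>\<omega>\<in>\<Omega>.
        (\<forall>t. set_integrable lborel {..0} (\<lambda>s. exp s * \<theta> t \<omega> s)) \<and>
        continuous_on UNIV (\<lambda>t. ou_z (\<theta> t \<omega>)) \<and>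
        (\<forall>F\<in>{at_top, at_bot}.
           ((\<lambda>t. ou_z (\<theta> t \<omega>) / t) \<longlongrightarrow> 0) F \<and>
           ((\<lambda>t. (1 / t) * (LBINT s=0..t. ou_z (\<theta> s \<omega>))) \<longlongrightarrow> 0) F))"


section \<open>The random equation and the cocycle\<close>

definition rhs ::
  "real \<Rightarrow> (int \<Rightarrow> real \<Rightarrow> real) \<Rightarrow> (int \<Rightarrow> real \<Rightarrow> real \<Rightarrow> real) \<Rightarrow> (real \<Rightarrow> ell2) \<Rightarrow> (real \<Rightarrow> ell2) \<Rightarrow>
   real \<Rightarrow> (real \<Rightarrow> real) \<Rightarrow> ell2 \<Rightarrow> ell2" where
  "rhs lam f g h h' t \<omega> v =
     - opA (opA v) - lam *\<^sub>R v
     - opA (nemytskii f (v + ou_z (\<theta> t \<omega>) *\<^sub>R h t))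
     + nemytskii (\<lambda>i. g i t) (v + ou_z (\<theta> t \<omega>) *\<^sub>R h t)
     + ou_z (\<theta> t \<omega>) *\<^sub>R (- opA (opA (h t)) + (1 - lam) *\<^sub>R h t - h' t)"

text \<open>
  Only local integrability in time of the data is assumed, so a solution is understood in the
  sense of Caratheodory: it is continuous and satisfies the integrated equation.
\<close>

definition global_solution ::
  "(real \<Rightarrow> ell2 \<Rightarrow> ell2) \<Rightarrow> real \<Rightarrow> ell2 \<Rightarrow> (real \<Rightarrow> ell2) \<Rightarrow> bool" where
  "global_solution F \<tau> x v \<longleftrightarrow>
     continuous_on {\<tau>..} v \<and>
     (\<forall>t\<ge>\<tau>. set_integrable lebesgue {\<tau>..t} (\<lambda>s. F s (v s)) \<and>
             v t = x + (LINT s:{\<tau>..t}|lebesgue. F s (v s)))"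

text \<open>
  In the following, \<open>v t \<tau> \<omega> x\<close> is the value at time \<open>t\<close> of the solution of the random equation
  that starts from \<open>x\<close> at time \<open>\<tau>\<close>.
\<close>

definition u_sol ::
  "(real \<Rightarrow> real \<Rightarrow> (real \<Rightarrow> real) \<Rightarrow> ell2 \<Rightarrow> ell2) \<Rightarrow> (real \<Rightarrow> ell2) \<Rightarrow>
   real \<Rightarrow> real \<Rightarrow> (real \<Rightarrow> real) \<Rightarrow> ell2 \<Rightarrow> ell2" where
  "u_sol v h t \<tau> \<omega> x =
     v t \<tau> \<omega> (x - ou_z (\<theta> \<tau> \<omega>) *\<^sub>R h \<tau>) + ou_z (\<theta> t \<omega>) *\<^sub>R h t"

definition cocycle ::
  "(real \<Rightarrow> real \<Rightarrow> (real \<Rightarrow> real) \<Rightarrow> ell2 \<Rightarrow> ell2) \<Rightarrow> (real \<Rightarrow> ell2) \<Rightarrow>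
   real \<Rightarrow> real \<Rightarrow> (real \<Rightarrow> real) \<Rightarrow> ell2 \<Rightarrow> ell2" where
  "cocycle v h t \<tau> \<omega> x = u_sol v h (t + \<tau>) \<tau> (\<theta> (- \<tau>) \<omega>) x"


section \<open>Random sets and pullback attractors\<close>

definition nonaut_random_set ::
  "(real \<Rightarrow> real) measure \<Rightarrow> (real \<Rightarrow> real) set \<Rightarrow>
   (real \<Rightarrow> (real \<Rightarrow> real) \<Rightarrow> 'x::metric_space set) \<Rightarrow> bool" where
  "nonaut_random_set P \<Omega> D \<longleftrightarrow>
     (\<forall>\<tau>. \<forall>\<omega>\<in>\<Omega>. D \<tau> \<omega> \<noteq> {}) \<and>
     (\<forall>x \<tau>. (\<lambda>\<omega>. infdist x (D \<tau> \<omega>)) \<in> borel_measurable (restrict_space P \<Omega>))"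

definition tempered_sets ::
  "(real \<Rightarrow> real) measure \<Rightarrow> (real \<Rightarrow> real) set \<Rightarrow> real \<Rightarrow>
   (real \<Rightarrow> (real \<Rightarrow> real) \<Rightarrow> ell2 set) set" where
  "tempered_sets P \<Omega> lam0 =
     {D. nonaut_random_set P \<Omega> D \<and>
         (\<forall>\<tau>. \<forall>\<omega>\<in>\<Omega>.
            ((\<lambda>s. ennreal (exp (lam0 * s)) * (SUP u\<in>D (\<tau> + s) (\<theta> s \<omega>). ennreal (norm u))\<^sup>2)
               \<longlongrightarrow> 0) at_bot)}"

definition hausdorff_semidist :: "'x::metric_space set \<Rightarrow> 'x set \<Rightarrow> ennreal" where
  "hausdorff_semidist B C = (SUP b\<in>B. INF c\<in>C. ennreal (dist b c))"

definition pullback_attractor ::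
  "(real \<Rightarrow> real) measure \<Rightarrow> (real \<Rightarrow> real) set \<Rightarrow> real \<Rightarrow>
   (real \<Rightarrow> real \<Rightarrow> (real \<Rightarrow> real) \<Rightarrow> ell2 \<Rightarrow> ell2) \<Rightarrow>
   (real \<Rightarrow> (real \<Rightarrow> real) \<Rightarrow> ell2 set) \<Rightarrow> bool" where
  "pullback_attractor P \<Omega> lam0 \<phi> A \<longleftrightarrow>
     nonaut_random_set P \<Omega> A \<and>
     (\<forall>\<tau>. AE \<omega> in restrict_space P \<Omega>. compact (A \<tau> \<omega>)) \<and>
     (\<forall>\<tau>. \<forall>\<omega>\<in>\<Omega>. \<forall>t\<ge>0. \<phi> t \<tau> \<omega> ` A \<tau> \<omega> = A (\<tau> + t) (\<theta> t \<omega>)) \<and>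
     (\<forall>D\<in>tempered_sets P \<Omega> lam0. \<forall>\<tau>. \<forall>\<omega>\<in>\<Omega>.
        ((\<lambda>t. hausdorff_semidist (\<phi> t (\<tau> - t) (\<theta> (- t) \<omega>) ` D (\<tau> - t) (\<theta> (- t) \<omega>)) (A \<tau> \<omega>))
           \<longlongrightarrow> 0) at_top) \<and>
     (\<exists>K\<in>tempered_sets P \<Omega> lam0. \<forall>\<tau>. \<forall>\<omega>\<in>\<Omega>. closed (K \<tau> \<omega>) \<and> A \<tau> \<omega> \<subseteq> K \<tau> \<omega>)"


section \<open>Generalized Banach limits and supports of measures\<close>

text \<open>
  A functional on the functions that are bounded on some half-line \<open>(-\<infinity>, a]\<close>, where \<open>a\<close> may
  depend on the function.  By the limit property its value depends only on the germ of the
  function at \<open>-\<infinity>\<close>.  A functional given for one fixed \<open>a\<close> has a unique such extension.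
\<close>

definition bounded_at_bot :: "(real \<Rightarrow> real) \<Rightarrow> bool" where
  "bounded_at_bot \<zeta> \<longleftrightarrow> (\<exists>a. bounded (\<zeta> ` {..a}))"

definition generalized_Banach_limit :: "((real \<Rightarrow> real) \<Rightarrow> real) \<Rightarrow> bool" where
  "generalized_Banach_limit L \<longleftrightarrow>
     (\<forall>\<zeta> \<eta>. bounded_at_bot \<zeta> \<longrightarrow> bounded_at_bot \<eta> \<longrightarrow>
        L (\<lambda>\<tau>. \<zeta> \<tau> + \<eta> \<tau>) = L \<zeta> + L \<eta>) \<and>
     (\<forall>\<zeta> c. bounded_at_bot \<zeta> \<longrightarrow> L (\<lambda>\<tau>. c * \<zeta> \<tau>) = c * L \<zeta>) \<and>
     (\<forall>\<zeta> a. bounded (\<zeta> ` {..a}) \<longrightarrow> (\<forall>\<tau>\<le>a. \<zeta> \<tau> \<ge> 0) \<longrightarrow> L \<zeta> \<ge> 0) \<and>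
     (\<forall>\<zeta> l. (\<zeta> \<longlongrightarrow> l) at_bot \<longrightarrow> L \<zeta> = l)"

definition measure_support :: "'x::topological_space measure \<Rightarrow> 'x set" where
  "measure_support M = {x. \<forall>U. open U \<longrightarrow> x \<in> U \<longrightarrow> emeasure M U > 0}"

definition time_average :: "real \<Rightarrow> (real \<Rightarrow> real) \<Rightarrow> real \<Rightarrow> real" where
  "time_average t F \<tau> = (1 / (t - \<tau>)) * (LINT s:{\<tau>..t}|lebesgue. F s)"

text \<open>The integrals defining the average exist, and the average has a generalized Banach limit.\<close>

definition averageable :: "real \<Rightarrow> (real \<Rightarrow> real) \<Rightarrow> bool" where
  "averageable t F \<longleftrightarrow>
     (\<forall>\<tau>\<le>t. set_integrable lebesgue {\<tau>..t} F) \<and> bounded_at_bot (time_average t F)"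

end

theory Submission
  imports Defs
begin

text \<open>
  For fixed \<open>\<omega>\<close> the random equation has a one-sided Lipschitz right-hand side, so its solutions form
  an evolution process \<open>U t s\<close> that is continuous in the state and in the initial time. The pullback
  orbit \<open>s \<mapsto> U t s (\<xi> s)\<close> is attracted by the compact fibre of the attractor at time \<open>t\<close>; hence the
  generalized Banach limit of time averages along it is a normalized positive functional that only
  sees the fibre, and the Riesz representation theorem turns it into a probability measure carried
  by the fibre. Changing the end point of the averages does not affect the limit, which gives
  invariance. Fibres are compact only almost surely for each single time; since Wiener measure is
  invariant under the shifts, almost every \<open>\<omega>\<close> has compact fibres at all times \<open>-n\<close>, and then at
  all times because the evolution maps fibres onto fibres.
\<close>

section \<open>The Riesz representation theorem for functionals carried by a compact set\<close>

text \<open>The obstacle is that observables and state space are not tame: \<open>\<Upsilon>\<close>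
  may be unbounded, and square summable sequences do not form a locally compact space. So the
  functional lives on all continuous functions, and its positivity is tested on \<open>K\<close>
  only. This one condition says that points off \<open>K\<close> are invisible, and it lets
  compactness of \<open>K\<close> alone drive the representation. For the equation, the derivative
  of \<open>g\<close> is bounded only from above, so uniqueness and continuous dependence must come
  from inner product estimates. The data are merely integrable in time, so these estimates are run
  on integrated equations instead of derivatives. For the measures, the pair (\<tau>, \<omega>) lies
  on the orbit of the path \<open>\<theta> (- \<tau>) \<omega>\<close>. Choosing one whole family of
  measures per base path, rather than one measure per pair, makes the members compatible along each
  orbit.\<close>

locale normalized_positive_functional =
  fixes \<Lambda> :: "('a::metric_space \<Rightarrow> real) \<Rightarrow> real" and K :: "'a set"
  assumes compact_K: "compact K"
    and add: "\<And>f g. continuous_on UNIV f \<Longrightarrow> continuous_on UNIV g \<Longrightarrow> \<Lambda> (\<lambda>x. f x + g x) = \<Lambda> f + \<Lambda> g"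
    and scale: "\<And>c f. continuous_on UNIV f \<Longrightarrow> \<Lambda> (\<lambda>x. c * f x) = c * \<Lambda> f"
    and nonneg: "\<And>f. continuous_on UNIV f \<Longrightarrow> (\<And>x. x \<in> K \<Longrightarrow> 0 \<le> f x) \<Longrightarrow> 0 \<le> \<Lambda> f"
    and normalized: "\<Lambda> (\<lambda>_. 1) = 1"
begin

lemma const: "\<Lambda> (\<lambda>_. c) = c"
  using scale[of "\<lambda>_. 1" c] normalized by simp

lemma diff:
  assumes "continuous_on UNIV f" "continuous_on UNIV g"
  shows "\<Lambda> (\<lambda>x. f x - g x) = \<Lambda> f - \<Lambda> g"
  using add[of "\<lambda>x. f x - g x" g] assms by (simp add: continuous_on_diff)

lemma mono:
  assumes "continuous_on UNIV f" "continuous_on UNIV g" "\<And>x. x \<in> K \<Longrightarrow> f x \<le> g x"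
  shows "\<Lambda> f \<le> \<Lambda> g"
  using nonneg[of "\<lambda>x. g x - f x"] diff[OF assms(2,1)] assms by (simp add: continuous_on_diff)

lemma sum:
  assumes "finite I" "\<And>i. i \<in> I \<Longrightarrow> continuous_on UNIV (f i)"
  shows "\<Lambda> (\<lambda>x. \<Sum>i\<in>I. f i x) = (\<Sum>i\<in>I. \<Lambda> (f i))"
  using assms by (induction I) (auto simp: const add continuous_on_sum)

text \<open>Nonnegativity holds everywhere, so that products and \<open>ennreal\<close> series are
  harmless, but the bound 1 is asked on \<open>K\<close> only, since \<open>\<Lambda>\<close> cannot
  see other points. The pointwise sum may be discontinuous or infinite.\<close>

definition covers :: "'a set \<Rightarrow> (nat \<Rightarrow> 'a \<Rightarrow> real) set" where
  "covers E = {f. (\<forall>n. continuous_on UNIV (f n) \<and> (\<forall>x. 0 \<le> f n x)) \<and>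
                  (\<forall>x\<in>E \<inter> K. 1 \<le> (\<Sum>n. ennreal (f n x)))}"

text \<open>
  Daniell's upper integral: unlike an infimum over open sets, it is countably subadditive
  without partitions of unity.
\<close>

definition outer :: "'a set \<Rightarrow> ennreal" where
  "outer E = (INF f\<in>covers E. \<Sum>n. ennreal (\<Lambda> (f n)))"

text \<open>A single function padded by zeros is a cover. It is used with 0 for sets that miss
  \<open>K\<close>, with 1 for the whole space, and with difference quotients of truncations for
  superlevel sets.\<close>

lemma outer_le_functional:
  assumes f: "continuous_on UNIV f" and pos: "\<And>x. 0 \<le> f x" and one: "\<And>x. x \<in> E \<inter> K \<Longrightarrow> 1 \<le> f x"
  shows "outer E \<le> ennreal (\<Lambda> f)"
proof -
  let ?F = "\<lambda>n::nat. if n = 0 then f else (\<lambda>_. 0)"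
  have s: "(\<Sum>n. ennreal (?F n x)) = ennreal (f x)" for x
    using suminf_finite[of "{0}" "\<lambda>n. ennreal (?F n x)"] by simp
  have "?F \<in> covers E"
    unfolding covers_def mem_Collect_eq s using f pos one by auto
  hence "outer E \<le> (\<Sum>n. ennreal (\<Lambda> (?F n)))"
    unfolding outer_def by (rule INF_lower)
  also have "\<dots> = ennreal (\<Lambda> f)"
    using suminf_finite[of "{0}" "\<lambda>n. ennreal (\<Lambda> (?F n))"] by (simp add: const)
  finally show ?thesis .
qed

lemma outer_disjoint: "E \<inter> K = {} \<Longrightarrow> outer E = 0"
  using outer_le_functional[of "\<lambda>_. 0" E] by (simp add: const)

lemma outer_mono: "E \<subseteq> F \<Longrightarrow> outer E \<le> outer F"
  unfolding outer_def by (rule INF_superset_mono) (auto simp: covers_def)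

text \<open>Near-optimal covers, the n-th one with slack \<open>e * (1/2) ^ Suc n\<close>, are
  merged into one sequence through \<open>prod_decode\<close>; double series of
  \<open>ennreal\<close> can be reordered freely.\<close>

lemma outer_countably_subadditive:
  fixes E :: "nat \<Rightarrow> 'a set"
  shows "outer (\<Union>i. E i) \<le> (\<Sum>i. outer (E i))"
proof (rule ennreal_le_epsilon)
  fix e :: real assume e: "0 < e" and fin: "(\<Sum>i. outer (E i)) < top"
  have "\<exists>f\<in>covers (E n). (\<Sum>k. ennreal (\<Lambda> (f k))) < outer (E n) + e * (1/2) ^ Suc n" for n
  proof -
    have "outer (E n) < outer (E n) + e * (1/2) ^ Suc n"
      using e fin by (auto simp add: less_top dest!: ennreal_suminf_lessD)
    thus ?thesis unfolding outer_def INF_less_iff .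
  qed
  then obtain f where f: "\<And>n. f n \<in> covers (E n)"
    "\<And>n. (\<Sum>k. ennreal (\<Lambda> (f n k))) < outer (E n) + e * (1/2) ^ Suc n" by metis
  define F where "F m = (case prod_decode m of (n, k) \<Rightarrow> f n k)" for m
  have sumF: "(\<Sum>m. ennreal (F m x)) = (\<Sum>n k. ennreal (f n k x))" for x
    using suminf_ennreal_2dimen[of _ "\<lambda>(n, k). ennreal (f n k x)"]
    by (simp add: F_def case_prod_beta)
  have "F \<in> covers (\<Union>i. E i)"
    unfolding covers_def
  proof (safe; (unfold sumF)?)
    show "continuous_on UNIV (F n)" for n
      using f(1) by (auto simp: F_def covers_def split: prod.split)
    show "0 \<le> F n x" for n x
      using f(1) by (auto simp: F_def covers_def split: prod.split)
    fix x i assume "x \<in> E i" "x \<in> K"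
    hence "1 \<le> (\<Sum>k. ennreal (f i k x))" using f(1)[of i] by (auto simp: covers_def)
    also have "\<dots> \<le> (\<Sum>n k. ennreal (f n k x))"
      using sum_le_suminf[of "\<lambda>n. \<Sum>k. ennreal (f n k x)" "{i}"] by auto
    finally show "1 \<le> (\<Sum>n k. ennreal (f n k x))" .
  qed
  hence "outer (\<Union>i. E i) \<le> (\<Sum>m. ennreal (\<Lambda> (F m)))"
    unfolding outer_def by (rule INF_lower)
  also have "\<dots> = (\<Sum>n k. ennreal (\<Lambda> (f n k)))"
    using suminf_ennreal_2dimen[of _ "\<lambda>(n, k). ennreal (\<Lambda> (f n k))"]
    by (simp add: F_def case_prod_beta)
  also have "\<dots> \<le> (\<Sum>n. outer (E n) + ennreal (e * (1/2) ^ Suc n))"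
    using f(2) by (intro suminf_le) (auto intro: less_imp_le)
  also have "\<dots> = (\<Sum>n. outer (E n)) + (\<Sum>n. ennreal (e * (1/2) ^ Suc n))"
    by (intro suminf_add[symmetric]) auto
  also have "(\<Sum>n. ennreal (e * (1/2) ^ Suc n)) = ennreal e"
    using e sums_mult[OF power_half_series, of e] by (intro suminf_ennreal_eq) auto
  finally show "outer (\<Union>i. E i) \<le> (\<Sum>i. outer (E i)) + ennreal e" .
qed

text \<open>
  With functions \<open>h k\<close> increasing to the indicator of \<open>U\<close>, every cover of \<open>E\<close> splits into
  the family \<open>f n * (h (k + 1) - h k)\<close>, which covers \<open>E \<inter> U\<close>, and \<open>f n * (1 - h m)\<close>, which covers \<open>E - U\<close>.
\<close>

lemma outer_open_split:
  assumes U: "open U"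
  shows "outer (E \<inter> U) + outer (E - U) \<le> outer E"
\<comment> \<open>By convention \<open>infdist x {} = 0\<close>, so for \<open>U = UNIV\<close> the
  functions \<open>h k\<close> below would vanish instead of increasing to 1.\<close>
proof (cases "U = UNIV")
  case True
  thus ?thesis by (simp add: outer_disjoint)
next
  case False
  hence ne: "- U \<noteq> {}" by auto
  define h where "h k x = min 1 (real k * infdist x (- U))" for k x
  have hc: "continuous_on UNIV (h k)" for k
    unfolding h_def by (intro continuous_intros)
  have h0: "h 0 = (\<lambda>_. 0)" by (simp add: h_def fun_eq_iff)
  have h01: "0 \<le> h k x" "h k x \<le> 1" for k x by (auto simp: h_def infdist_nonneg)
  have hmono: "h k x \<le> h m x" if "k \<le> m" for k m x
    using that unfolding h_def by (intro min.mono mult_right_mono) (auto simp: infdist_nonneg)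
  have h_out: "h k x = 0" if "x \<notin> U" for k x
    using that by (simp add: h_def)
  have h_in: "(\<lambda>k. h k x) \<longlonglongrightarrow> 1" if "x \<in> U" for x
  proof -
    have "closed (- U)" using U by (simp add: closed_Compl)
    hence d: "infdist x (- U) > 0"
      using in_closed_iff_infdist_zero[of "- U" x] ne that infdist_nonneg[of x "- U"] by fastforce
    then obtain N where N: "1 < real N * infdist x (- U)"
      using reals_Archimedean3 by blast
    have "h k x = 1" if "k \<ge> N" for k
    proof -
      have "real N * infdist x (- U) \<le> real k * infdist x (- U)"
        using that d by (intro mult_right_mono) auto
      thus ?thesis using N by (simp add: h_def)
    qed
    hence "eventually (\<lambda>k. h k x = 1) sequentially" by (auto simp: eventually_sequentially)
    thus ?thesis by (rule tendsto_eventually)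
  qed
  show ?thesis
    unfolding outer_def[of E]
  proof (rule INF_greatest)
    fix f assume f: "f \<in> covers E"
    have fc: "continuous_on UNIV (f n)" and fp: "0 \<le> f n x" for n x
      using f by (auto simp: covers_def)
    define G where "G m = (case prod_decode m of (n, k) \<Rightarrow> (\<lambda>x. f n x * (h (Suc k) x - h k x)))" for m
    have sumG: "(\<Sum>m. ennreal (G m x)) = (\<Sum>n k. ennreal (f n x * (h (Suc k) x - h k x)))" for x
      using suminf_ennreal_2dimen[of _ "\<lambda>(n, k). ennreal (f n x * (h (Suc k) x - h k x))"]
      by (simp add: G_def case_prod_beta)
    have tele: "(\<Sum>k. ennreal (f n x * (h (Suc k) x - h k x))) = ennreal (f n x)" if "x \<in> U" for n x
    proof (rule suminf_ennreal_eq)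
      show "0 \<le> f n x * (h (Suc k) x - h k x)" for k
        using fp hmono[of k "Suc k"] by simp
      show "(\<lambda>k. f n x * (h (Suc k) x - h k x)) sums f n x"
        using sums_mult[OF telescope_sums[OF h_in[OF that]], of "f n x"] by (simp add: h0)
    qed
    have "G \<in> covers (E \<inter> U)"
      unfolding covers_def
    proof (safe; (unfold sumG)?)
      show "continuous_on UNIV (G n)" for n
        by (auto simp: G_def split: prod.split intro!: continuous_intros fc hc)
      show "0 \<le> G n x" for n x
        using fp hmono[of k "Suc k" for k] by (auto simp: G_def split: prod.split)
      fix x assume "x \<in> E" "x \<in> U" "x \<in> K"
      thus "1 \<le> (\<Sum>n k. ennreal (f n x * (h (Suc k) x - h k x)))"
        using f by (simp add: tele covers_def)
    qed
    hence "outer (E \<inter> U) \<le> (\<Sum>m. ennreal (\<Lambda> (G m)))"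
      unfolding outer_def by (rule INF_lower)
    also have "\<dots> = (\<Sum>n k. ennreal (\<Lambda> (\<lambda>x. f n x * (h (Suc k) x - h k x))))"
      using suminf_ennreal_2dimen[of _ "\<lambda>(n, k). ennreal (\<Lambda> (\<lambda>x. f n x * (h (Suc k) x - h k x)))"]
      by (simp add: G_def case_prod_beta)
    \<comment> \<open>Only finite additivity of \<open>\<Lambda>\<close> enters: the partial sums
      over \<open>k\<close> telescope inside \<open>\<Lambda>\<close>. The supremum over
      \<open>m\<close> stays outside and passes through the series over \<open>n\<close> by
      monotonicity.\<close>
    also have "\<dots> = (\<Sum>n. SUP m. ennreal (\<Lambda> (\<lambda>x. f n x * h m x)))"
    proof (intro suminf_cong)
      fix n
      have "(\<Sum>k<m. ennreal (\<Lambda> (\<lambda>x. f n x * (h (Suc k) x - h k x)))) = ennreal (\<Lambda> (\<lambda>x. f n x * h m x))" for m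
      proof -
        have "(\<Sum>k<m. ennreal (\<Lambda> (\<lambda>x. f n x * (h (Suc k) x - h k x)))) =
              ennreal (\<Sum>k<m. \<Lambda> (\<lambda>x. f n x * (h (Suc k) x - h k x)))"
          using fp hmono[of k "Suc k" for k]
          by (intro sum_ennreal nonneg continuous_intros fc hc mult_nonneg_nonneg) auto
        also have "(\<Sum>k<m. \<Lambda> (\<lambda>x. f n x * (h (Suc k) x - h k x))) =
                   \<Lambda> (\<lambda>x. \<Sum>k<m. f n x * (h (Suc k) x - h k x))"
          by (intro sum[symmetric] continuous_intros fc hc) auto
        also have "(\<lambda>x. \<Sum>k<m. f n x * (h (Suc k) x - h k x)) = (\<lambda>x. f n x * h m x)"
          using sum_lessThan_telescope[of "\<lambda>k. h k x" m for x]
            by (simp add: fun_eq_iff h0 sum_distrib_left[symmetric])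
        finally show ?thesis .
      qed
      thus "(\<Sum>k. ennreal (\<Lambda> (\<lambda>x. f n x * (h (Suc k) x - h k x)))) = (SUP m. ennreal (\<Lambda> (\<lambda>x. f n x * h m x)))"
        by (simp add: suminf_eq_SUP)
    qed
    also have "\<dots> = (SUP m. \<Sum>n. ennreal (\<Lambda> (\<lambda>x. f n x * h m x)))"
      by (intro ennreal_suminf_SUP_eq incseq_SucI ennreal_leI mono continuous_intros fc hc
          mult_left_mono hmono fp) auto
    finally have 1: "outer (E \<inter> U) \<le> (SUP m. \<Sum>n. ennreal (\<Lambda> (\<lambda>x. f n x * h m x)))" .
    \<comment> \<open>The cover of \<open>E - U\<close> depends on \<open>m\<close>, so
      \<open>m\<close> is fixed here: both parts then add up exactly to the cost of
      \<open>f\<close>, and the supremum is taken afterwards.\<close>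
    have "(\<Sum>n. ennreal (\<Lambda> (\<lambda>x. f n x * h m x))) + outer (E - U) \<le> (\<Sum>n. ennreal (\<Lambda> (f n)))" for m
    proof -
      have "(\<lambda>n x. f n x * (1 - h m x)) \<in> covers (E - U)"
        using f unfolding covers_def
        by (auto simp: h_out intro!: continuous_intros fc hc mult_nonneg_nonneg h01)
      hence "outer (E - U) \<le> (\<Sum>n. ennreal (\<Lambda> (\<lambda>x. f n x * (1 - h m x))))"
        unfolding outer_def by (rule INF_lower)
      hence "(\<Sum>n. ennreal (\<Lambda> (\<lambda>x. f n x * h m x))) + outer (E - U) \<le>
        (\<Sum>n. ennreal (\<Lambda> (\<lambda>x. f n x * h m x))) + (\<Sum>n. ennreal (\<Lambda> (\<lambda>x. f n x * (1 - h m x))))"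
        by (intro add_left_mono)
      also have "\<dots> = (\<Sum>n. ennreal (\<Lambda> (\<lambda>x. f n x * h m x)) + ennreal (\<Lambda> (\<lambda>x. f n x * (1 - h m x))))"
        by (intro suminf_add) auto
      also have "\<dots> = (\<Sum>n. ennreal (\<Lambda> (f n)))"
      proof (intro suminf_cong)
        fix n
        have "ennreal (\<Lambda> (\<lambda>x. f n x * h m x)) + ennreal (\<Lambda> (\<lambda>x. f n x * (1 - h m x))) =
          ennreal (\<Lambda> (\<lambda>x. f n x * h m x) + \<Lambda> (\<lambda>x. f n x * (1 - h m x)))"
          by (intro ennreal_plus[symmetric] nonneg continuous_intros fc hc mult_nonneg_nonneg fp)
             (auto simp: h01)
        also have "\<Lambda> (\<lambda>x. f n x * h m x) + \<Lambda> (\<lambda>x. f n x * (1 - h m x)) =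
            \<Lambda> (\<lambda>x. f n x * h m x + f n x * (1 - h m x))"
          by (intro add[symmetric] continuous_intros fc hc)
        also have "(\<lambda>x. f n x * h m x + f n x * (1 - h m x)) = f n"
          by (simp add: fun_eq_iff algebra_simps)
        finally show "ennreal (\<Lambda> (\<lambda>x. f n x * h m x)) + ennreal (\<Lambda> (\<lambda>x. f n x * (1 - h m x))) = ennreal (\<Lambda> (f n))" .
      qed
      finally show ?thesis .
    qed
    hence "(SUP m. (\<Sum>n. ennreal (\<Lambda> (\<lambda>x. f n x * h m x))) + outer (E - U)) \<le> (\<Sum>n. ennreal (\<Lambda> (f n)))"
      by (intro SUP_least)
    hence "(SUP m. (\<Sum>n. ennreal (\<Lambda> (\<lambda>x. f n x * h m x)))) + outer (E - U) \<le> (\<Sum>n. ennreal (\<Lambda> (f n)))"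
      by (subst (asm) ennreal_SUP_add_left) auto
    thus "outer (E \<inter> U) + outer (E - U) \<le> (\<Sum>n. ennreal (\<Lambda> (f n)))"
      using 1 add_right_mono order_trans by blast
  qed
qed

text \<open>The lower bound is a Dini argument, and this is where compactness of \<open>K\<close> is
  spent: the open sets on which a partial sum exceeds \<open>1 - e\<close> increase and cover
  \<open>K\<close>, so one partial sum works on all of \<open>K\<close>, and positivity on
  \<open>K\<close> compares its functional value with \<open>1 - e\<close>.\<close>

lemma outer_UNIV: "outer UNIV = 1"
proof (rule antisym)
  show "outer UNIV \<le> 1"
    using outer_le_functional[of "\<lambda>_. 1" UNIV] by (simp add: const)
  show "1 \<le> outer UNIV"
    unfolding outer_def
  proof (rule INF_greatest)
    fix f assume f: "f \<in> covers UNIV"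
    have fc: "continuous_on UNIV (f n)" and fp: "0 \<le> f n x" for n x
      using f by (auto simp: covers_def)
    define T where "T = (\<Sum>n. ennreal (\<Lambda> (f n)))"
    have "ennreal 1 \<le> T + ennreal e" if e: "e > 0" for e
    proof -
      define V where "V N = {x. 1 - e < (\<Sum>n<N. f n x)}" for N
      have oV: "open (V N)" for N
        unfolding V_def by (intro open_Collect_less continuous_intros fc)
      have cov: "K \<subseteq> (\<Union>N. V N)"
      proof
        fix x assume "x \<in> K"
        hence "ennreal 1 \<le> (SUP N. \<Sum>n<N. ennreal (f n x))"
          using f by (auto simp: covers_def suminf_eq_SUP)
        \<comment> \<open>For \<open>e > 1\<close> the left side is truncated to 0 and the strict
          inequality still holds.\<close>
        moreover have "ennreal (1 - e) < ennreal 1" using e by (simp add: ennreal_less_iff ennreal_lessI)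
        ultimately have "ennreal (1 - e) < (SUP N. \<Sum>n<N. ennreal (f n x))" by (rule less_le_trans[rotated])
        then obtain N where "ennreal (1 - e) < (\<Sum>n<N. ennreal (f n x))"
          by (auto simp: less_SUP_iff)
        hence "ennreal (1 - e) < ennreal (\<Sum>n<N. f n x)" using fp by simp
        hence "1 - e < (\<Sum>n<N. f n x)"
          by (metis ennreal_leI linorder_not_le)
        thus "x \<in> (\<Union>N. V N)" by (auto simp: V_def)
      qed
      obtain C where C: "finite C" "K \<subseteq> (\<Union>N\<in>C. V N)"
        using compactE_image[OF compact_K, of UNIV V] oV cov by auto
      define N where "N = Max (insert 0 C)"
      have "1 - e \<le> (\<Sum>n<N. f n x)" if "x \<in> K" for x
      proof -
        obtain M where M: "M \<in> C" "x \<in> V M" using C(2) \<open>x \<in> K\<close> by blast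
        have "M \<le> N" unfolding N_def using C M by (intro Max_ge) auto
        hence "(\<Sum>n<M. f n x) \<le> (\<Sum>n<N. f n x)" using fp by (intro sum_mono2) auto
        thus ?thesis using M by (simp add: V_def)
      qed
      hence "\<Lambda> (\<lambda>_. 1 - e) \<le> \<Lambda> (\<lambda>x. \<Sum>n<N. f n x)"
        by (intro mono continuous_intros fc) auto
      hence "1 \<le> (\<Sum>n<N. \<Lambda> (f n)) + e"
        by (simp add: const sum fc)
      hence "ennreal 1 \<le> ennreal ((\<Sum>n<N. \<Lambda> (f n)) + e)" by (rule ennreal_leI)
      also have "\<dots> = ennreal (\<Sum>n<N. \<Lambda> (f n)) + ennreal e"
        using e by (intro ennreal_plus sum_nonneg nonneg fc fp) auto
      also have "ennreal (\<Sum>n<N. \<Lambda> (f n)) = (\<Sum>n<N. ennreal (\<Lambda> (f n)))"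
        by (intro sum_ennreal[symmetric] nonneg fc fp)
      also have "\<dots> \<le> T"
        unfolding T_def by (intro sum_le_suminf) auto
      finally show ?thesis by (simp add: add_right_mono)
    qed
    hence "ennreal 1 \<le> T" by (rule ennreal_le_epsilon)
    thus "1 \<le> (\<Sum>n. ennreal (\<Lambda> (f n)))" by (simp add: T_def)
  qed
qed

text \<open>Caratheodory's construction for \<open>outer\<close>; \<open>outer_open_split\<close>
  puts the open sets into the lambda system. Since \<open>outer\<close> is an infimum of values of
  \<open>\<Lambda>\<close>, measures of superlevel sets are bounded above by such values, so the
  integral of a function nonnegative on \<open>K\<close> is at most its functional value; reflecting
  the function gives the converse.\<close>

theorem Riesz_representation:
  obtains M :: "'a measure" where "sets M = sets borel" "prob_space M" "emeasure M (- K) = 0"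
    "\<And>f :: 'a \<Rightarrow> real. continuous_on UNIV f \<Longrightarrow> integrable M f" "\<And>f. continuous_on UNIV f \<Longrightarrow> (LINT x|M. f x) = \<Lambda> f"
proof -
  have oms: "outer_measure_space (Pow UNIV) outer"
    unfolding outer_measure_space_def positive_def increasing_def countably_subadditive_def
    using outer_disjoint[of "{}"] outer_mono outer_countably_subadditive by auto
  define L where "L = lambda_system UNIV (Pow UNIV) outer"
  have ms: "measure_space UNIV L outer"
    unfolding L_def using sigma_algebra.caratheodory_lemma[OF sigma_algebra_Pow oms] .
  have sub: "outer (E \<union> F) \<le> outer E + outer F" for E F
    using outer_countably_subadditive[of "binaryset E F"]
    by (simp add: UN_binaryset_eq suminf_binaryset_eq outer_disjoint)
  have "U \<in> L" if "open U" for U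
  proof -
    have "outer (E \<inter> U) + outer (E - U) = outer E" for E
      using outer_open_split[OF that, of E] sub[of "E \<inter> U" "E - U"] by (simp add: Int_Diff_Un antisym)
    thus ?thesis
      unfolding L_def lambda_system_def by (simp add: Int_commute Diff_eq)
  qed
  moreover have "sigma_algebra UNIV L" using ms by (simp add: measure_space_def)
  ultimately have LB: "sets borel \<subseteq> L"
    unfolding borel_def using sigma_algebra.sigma_sets_subset[of UNIV L "Collect open"] by auto
  \<comment> \<open>The Caratheodory system may be larger than the Borel sets; restricting
    \<open>outer\<close> makes \<open>sets M\<close> equal to \<open>borel\<close>.\<close>
  have ms': "measure_space UNIV (sets borel) outer"
    using ms LB unfolding measure_space_def countably_additive_def positive_def
    by (auto intro!: sets.sigma_algebra_axioms[of borel, simplified])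
  define M where "M = measure_of UNIV (sets (borel :: 'a measure)) outer"
  have setsM: "sets M = sets borel"
    unfolding M_def using sets.sigma_sets_eq[of "borel :: 'a measure"] by (simp)
  have em: "emeasure M E = outer E" if "E \<in> sets borel" for E
    unfolding M_def using ms' that
    by (subst emeasure_measure_of_sigma) (auto simp: measure_space_def)
  have spM: "space M = UNIV" using sets_eq_imp_space_eq[OF setsM] by simp
  interpret prob_space M
    by standard (simp add: spM em outer_UNIV)
  have Kc: "closed K" using compact_K compact_imp_closed by blast
  have null: "emeasure M (- K) = 0"
    using Kc by (subst em) (auto simp: outer_disjoint)
  have aeK: "AE x in M. x \<in> K"
    using null Kc setsM by (intro AE_I[of _ _ "- K"]) auto
  have meas: "f \<in> borel_measurable M" if "continuous_on UNIV f" for f :: "'a \<Rightarrow> real"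
    using that setsM measurable_cong_sets by (metis borel_measurable_continuous_onI)
  have bd: "\<exists>B\<ge>0. \<forall>x\<in>K. \<bar>f x\<bar> \<le> B" if "continuous_on UNIV f" for f :: "'a \<Rightarrow> real"
  proof -
    have "compact (f ` K)" using that compact_K compact_continuous_image continuous_on_subset by blast
    then obtain B where "\<forall>x\<in>f ` K. norm x \<le> B" using compact_imp_bounded bounded_iff by blast
    thus ?thesis by (intro exI[of _ "max B 0"]) auto
  qed
  have int: "integrable M f" if fc: "continuous_on UNIV f" for f :: "'a \<Rightarrow> real"
  proof -
    obtain B where "\<forall>x\<in>K. \<bar>f x\<bar> \<le> B" using bd[OF fc] by auto
    hence "AE x in M. norm (f x) \<le> B" using aeK by auto
    thus ?thesis using meas[OF fc] by (intro integrable_const_bound)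
  qed
  \<comment> \<open>Layer cake from above: the truncations \<open>s j\<close> cut \<open>f\<close>
    into slices of height \<open>e\<close>. On \<open>K\<close>, a slice divided by \<open>e\<close>
    dominates the indicator of the set \<open>E j\<close> where \<open>f\<close> reaches the top of
    the slice, so \<open>outer_le_functional\<close> applies.\<close>
  have upper: "(LINT x|M. f x) \<le> \<Lambda> f" if fc: "continuous_on UNIV f" and fp: "\<And>x. x \<in> K \<Longrightarrow> 0 \<le> f x" for f
  proof (rule field_le_epsilon)
    fix e :: real assume e: "e > 0"
    obtain B where B: "B \<ge> 0" "\<forall>x\<in>K. \<bar>f x\<bar> \<le> B" using bd[OF fc] by auto
    obtain n where n: "B < real n * e" using reals_Archimedean3[OF e] by blast
    define s where "s j x = min (max (f x) 0) (real j * e)" for j x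
    have sc: "continuous_on UNIV (s j)" for j
      unfolding s_def by (intro continuous_intros fc)
    have s0: "s 0 = (\<lambda>_. 0)" using e by (auto simp: s_def fun_eq_iff)
    have smono: "s j x \<le> s (Suc j) x" for j x
      using e unfolding s_def by (intro min.mono order_refl mult_right_mono) auto
    have sn: "s n x = f x" if "x \<in> K" for x
      using fp[OF that] B n that by (force simp: s_def)
    define E where "E j = {x. f x \<ge> real (Suc j) * e}" for j
    have Eb: "E j \<in> sets borel" for j
      unfolding E_def by (intro borel_closed closed_Collect_le continuous_intros fc)
    have mE: "e * measure M (E j) \<le> \<Lambda> (s (Suc j)) - \<Lambda> (s j)" for j
    proof -
      have "outer (E j) \<le> ennreal (\<Lambda> (\<lambda>x. (1 / e) * (s (Suc j) x - s j x)))"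
      proof (rule outer_le_functional)
        show "continuous_on UNIV (\<lambda>x. (1 / e) * (s (Suc j) x - s j x))"
          by (intro continuous_intros sc)
        show "0 \<le> (1 / e) * (s (Suc j) x - s j x)" for x
          using e smono by simp
        fix x assume "x \<in> E j \<inter> K"
        hence "f x \<ge> real (Suc j) * e" "f x \<ge> 0" using fp by (auto simp: E_def)
        moreover have "real j * e \<le> real (Suc j) * e" using e by (intro mult_right_mono) auto
        ultimately have "s (Suc j) x = real (Suc j) * e" "s j x = real j * e" by (auto simp: s_def)
        thus "1 \<le> (1 / e) * (s (Suc j) x - s j x)" using e by (simp add: field_simps)
      qed
      moreover have "0 \<le> \<Lambda> (\<lambda>x. (1 / e) * (s (Suc j) x - s j x))"
        using e smono by (intro nonneg continuous_intros sc) auto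
      ultimately have "measure M (E j) \<le> \<Lambda> (\<lambda>x. (1 / e) * (s (Suc j) x - s j x))"
        using em[OF Eb[of j]] by (metis emeasure_eq_measure ennreal_le_iff)
      also have "\<dots> = (1 / e) * (\<Lambda> (s (Suc j)) - \<Lambda> (s j))"
        by (simp only: scale[OF continuous_on_diff[OF sc sc]] diff[OF sc sc])
      finally show ?thesis using e by (simp add: field_simps)
    qed
    have "(LINT x|M. f x) \<le> (LINT x|M. e + (\<Sum>j<n. e * indicator (E j) x))"
    proof (rule integral_mono_AE)
      show "integrable M f" by (rule int[OF fc])
      show "integrable M (\<lambda>x. e + (\<Sum>j<n. e * indicator (E j) x))"
        using Eb setsM by (intro Bochner_Integration.integrable_add Bochner_Integration.integrable_sum integrable_mult_right
            integrable_real_indicator) (auto simp: emeasure_eq_measure)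
      show "AE x in M. f x \<le> e + (\<Sum>j<n. e * indicator (E j) x)"
        using aeK
      proof eventually_elim
        case (elim x)
        \<comment> \<open>Index shift: slice \<open>j\<close> is nonzero only where \<open>f\<close>
          exceeds \<open>j * e\<close>, that is inside \<open>E (j - 1)\<close>. The bottom slice
          has no such set; its height \<open>e\<close> is the whole error.\<close>
        have 1: "s (Suc j) x - s j x \<le> (if j = 0 then e else 0) + (if j = 0 then 0 else e * indicator (E (j - 1)) x)" for j
        proof (cases "j = 0")
          case True thus ?thesis using e by (simp add: s_def)
        next
          case False
          show ?thesis
          proof (cases "x \<in> E (j - 1)")
            case True
            have "s (Suc j) x - s j x \<le> e" using e by (auto simp: s_def algebra_simps min_def)
            thus ?thesis using True False by simp
          next
            case nE: False
            hence "f x \<le> real j * e" using False by (simp add: E_def)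
            moreover have "real j * e \<le> real (Suc j) * e" using e by (intro mult_right_mono) auto
            ultimately have "s (Suc j) x = s j x" using fp[OF elim] by (simp add: s_def)
            thus ?thesis using False nE by simp
          qed
        qed
        have "f x = (\<Sum>j<n. s (Suc j) x - s j x)"
          using sn[OF elim] sum_lessThan_telescope[of "\<lambda>j. s j x" n] by (simp add: s0)
        also have "\<dots> \<le> (\<Sum>j<n. (if j = 0 then e else 0) + (if j = 0 then 0 else e * indicator (E (j - 1)) x))"
          by (intro sum_mono 1)
        also have "\<dots> \<le> e + (\<Sum>j<n. if j = 0 then 0 else e * indicator (E (j - 1)) x)"
          using e by (simp add: sum.distrib sum.delta)
        also have "(\<Sum>j<n. if j = 0 then 0 else e * indicator (E (j - 1)) x) \<le> (\<Sum>j<n. e * indicator (E j) x)"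
        proof (cases n)
          case (Suc m)
          have "(\<Sum>j<n. if j = 0 then 0 else e * indicator (E (j - 1)) x) = (\<Sum>j<m. e * indicator (E j) x)"
            unfolding Suc by (subst sum.lessThan_Suc_shift) simp
          also have "\<dots> \<le> (\<Sum>j<n. e * indicator (E j) x)"
            unfolding Suc using e by simp
          finally show ?thesis .
        qed simp
        finally show ?case by simp
      qed
    qed
    also have "\<dots> = e + (\<Sum>j<n. e * measure M (E j))"
    proof -
      have E: "E j \<in> sets M" for j using Eb setsM by simp
      have "integrable M (\<lambda>x. e * indicator (E j) x)" for j
        using E by (intro integrable_mult_right integrable_real_indicator) (auto simp: emeasure_eq_measure)
      thus ?thesis
        using E by (simp add: prob_space del: sum_mult_indicator)
    qed
    also have "(\<Sum>j<n. e * measure M (E j)) \<le> (\<Sum>j<n. \<Lambda> (s (Suc j)) - \<Lambda> (s j))"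
      by (intro sum_mono mE)
    also have "\<dots> = \<Lambda> (s n)" using sum_lessThan_telescope[of "\<lambda>j. \<Lambda> (s j)" n] by (simp add: s0 const)
    also have "\<dots> \<le> \<Lambda> f" by (intro mono sc fc) (simp add: sn)
    finally show "(LINT x|M. f x) \<le> \<Lambda> f + e" by simp
  qed
  have eq: "(LINT x|M. f x) = \<Lambda> f" if fc: "continuous_on UNIV f" for f
  proof -
    obtain B where B: "\<forall>x\<in>K. \<bar>f x\<bar> \<le> B" using bd[OF fc] by auto
    have B': "- B \<le> f x" "f x \<le> B" if "x \<in> K" for x
      using B[rule_format, OF that] by auto
    \<comment> \<open>Both \<open>B - f\<close> and \<open>f + B\<close> are nonnegative on
      \<open>K\<close> and constants are integrated exactly, so the one-sided bound gives both
      inequalities for \<open>f\<close>.\<close>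
    have "(LINT x|M. B - f x) \<le> \<Lambda> (\<lambda>x. B - f x)"
      using B' by (intro upper continuous_intros fc) auto
    moreover have "(LINT x|M. f x + B) \<le> \<Lambda> (\<lambda>x. f x + B)"
      using B'(1) by (intro upper continuous_intros fc) fastforce
    ultimately show ?thesis
      using int[OF fc] by (simp add: diff add const fc prob_space)
  qed
  show thesis
    using that[OF setsM prob_space_axioms null int eq] .
qed

end

section \<open>Shift invariance of Wiener measure\<close>

text \<open>The trace on paths of the product sigma-algebra. Finite-dimensional laws determine a
  measure there, whereas \<open>wiener_measure\<close> prescribes the Borel sets of the compact-open
  topology; the two have to be identified before uniqueness can be proved.\<close>

definition coordinate_algebra :: "(real \<Rightarrow> real) measure" where
  "coordinate_algebra = vimage_algebra path_space (\<lambda>\<omega>. \<omega>) (PiM UNIV (\<lambda>_. borel))"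

lemma space_coordinate_algebra [simp]: "space coordinate_algebra = path_space"
  by (simp add: coordinate_algebra_def)

lemma coordinate_measurable: "(\<lambda>\<omega>. \<omega> t) \<in> borel_measurable coordinate_algebra"
  unfolding coordinate_algebra_def
  using measurable_vimage_algebra1[of "\<lambda>\<omega>. \<omega>" path_space "PiM UNIV (\<lambda>_. borel)"]
  by (rule measurable_compose) (auto simp: space_PiM)

lemma coordinate_measurable_sets:
  assumes "S \<in> sets borel"
  shows "{\<omega> \<in> path_space. \<omega> t \<in> S} \<in> sets coordinate_algebra"
  using measurable_sets[OF coordinate_measurable assms, of t] by (simp add: vimage_def Int_def conj_commute)

text \<open>
  These sets are not open, but they are measurable by definition and countably many of them
  suffice to write every open set as a union of finite intersections.
\<close>

definition rational_box :: "real \<times> real \<times> real \<times> real \<Rightarrow> (real \<Rightarrow> real) set" where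
  "rational_box = (\<lambda>(a, b, c, d). {\<omega> \<in> path_space. \<forall>x\<in>\<rat> \<inter> {a<..<b}. \<omega> x \<in> {c..d}})"

lemma rational_box_measurable: "rational_box p \<in> sets coordinate_algebra"
proof (cases p)
  case (fields a b c d)
  \<comment> \<open>Indexing by all rationals, with a void condition outside the interval, keeps the
    index set nonempty even if \<open>a \<ge> b\<close>.\<close>
  have eq: "rational_box p = path_space \<inter> (\<Inter>x\<in>\<rat>. {\<omega> \<in> path_space. \<omega> x \<in> (if x \<in> {a<..<b} then {c..d} else UNIV)})"
    using Rats_0 unfolding fields rational_box_def by (auto split: if_splits)
  have p: "path_space \<in> sets coordinate_algebra"
    using sets.top[of coordinate_algebra] by simp
  show ?thesis
    unfolding eq using countable_rat Rats_0
    by (intro sets.Int p sets.countable_INT') (auto intro!: coordinate_measurable_sets simp del: atLeastAtMost_iff)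
qed

text \<open>\<open>{c..d}\<close> is closed, so a violation at \<open>x\<close> is an open condition
  and would persist at a nearby rational.\<close>

lemma rational_box_continuous:
  assumes w: "\<omega> \<in> rational_box (a, b, c, d)" and x: "x \<in> {a<..<b}"
  shows "\<omega> x \<in> {c..d}"
proof (rule ccontr)
  assume n: "\<omega> x \<notin> {c..d}"
  have cont: "continuous_on UNIV \<omega>" using w by (auto simp: rational_box_def path_space_def)
  have "open (\<omega> -` (- {c..d}) \<inter> {a<..<b})"
    using cont by (intro open_Int open_vimage) auto
  moreover have "x \<in> \<omega> -` (- {c..d}) \<inter> {a<..<b}" using n x by auto
  ultimately obtain e where e: "e > 0" "ball x e \<subseteq> \<omega> -` (- {c..d}) \<inter> {a<..<b}"
    by (metis open_contains_ball)
  obtain r where "r \<in> \<rat>" "x < r" "r < x + e" using Rats_dense_in_real[of x "x + e"] e by auto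
  hence "r \<in> \<rat> \<inter> {a<..<b}" "\<omega> r \<notin> {c..d}" using e(2) by (auto simp: subset_iff dist_real_def)
  thus False using w by (auto simp: rational_box_def)
qed

lemma rational_box_neighbourhood:
  assumes w: "\<omega> \<in> path_space" and U: "open U" "\<omega> x \<in> U"
  obtains a b c d where "a \<in> \<rat>" "b \<in> \<rat>" "c \<in> \<rat>" "d \<in> \<rat>" "x \<in> {a<..<b}" "\<omega> \<in> rational_box (a, b, c, d)" "{c..d} \<subseteq> U"
proof -
  obtain e where e: "e > 0" "ball (\<omega> x) e \<subseteq> U" using U by (auto simp: open_contains_ball)
  obtain c where c: "c \<in> \<rat>" "\<omega> x - e < c" "c < \<omega> x" using Rats_dense_in_real[of "\<omega> x - e" "\<omega> x"] e by auto
  obtain d where d: "d \<in> \<rat>" "\<omega> x < d" "d < \<omega> x + e" using Rats_dense_in_real[of "\<omega> x" "\<omega> x + e"] e by auto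
  have cont: "continuous_on UNIV \<omega>" using w by (auto simp: path_space_def)
  hence "open (\<omega> -` {c<..<d})" by (intro open_vimage) auto
  moreover have "x \<in> \<omega> -` {c<..<d}" using c d by auto
  ultimately obtain r where r: "r > 0" "ball x r \<subseteq> \<omega> -` {c<..<d}" by (metis open_contains_ball)
  obtain a where a: "a \<in> \<rat>" "x - r < a" "a < x" using Rats_dense_in_real[of "x - r" x] r by auto
  obtain b where b: "b \<in> \<rat>" "x < b" "b < x + r" using Rats_dense_in_real[of x "x + r"] r by auto
  have "\<omega> y \<in> {c..d}" if "y \<in> {a<..<b}" for y
  proof -
    have "y \<in> ball x r" using that a b by (auto simp: dist_real_def)
    thus ?thesis using r(2) by auto
  qed
  hence "\<omega> \<in> rational_box (a, b, c, d)" using w by (simp add: rational_box_def)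
  moreover have "{c..d} \<subseteq> U" using e(2) c d by (auto simp: subset_iff dist_real_def)
  ultimately show thesis using that a b c d by auto
qed

text \<open>Induction over the generation of the topology; only a subbasic set needs work. There
  \<open>K\<close> is covered by finitely many rational intervals on each of which \<omega> stays in
  a closed rational interval inside \<open>U\<close>, and any path in these boxes maps
  \<open>K\<close> into \<open>U\<close>. The factor \<open>path_space\<close> matters for
  \<open>F = {}\<close>, whose intersection is everything.\<close>

lemma compact_open_rational_box_cover:
  assumes S: "openin compact_open_topology S" and w: "\<omega> \<in> S"
  shows "\<exists>F. finite F \<and> F \<subseteq> \<rat> \<times> \<rat> \<times> \<rat> \<times> \<rat> \<and> \<omega> \<in> path_space \<inter> \<Inter> (rational_box ` F) \<and>
             path_space \<inter> \<Inter> (rational_box ` F) \<subseteq> S"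
proof -
  have "generate_topology_on {{\<omega> \<in> path_space. \<omega> ` K \<subseteq> U} | K U. compact K \<and> open U} S"
    using S by (simp add: compact_open_topology_def openin_topology_generated_by_iff)
  thus ?thesis using w
  proof (induction arbitrary: \<omega>)
    case Empty thus ?case by simp
  next
    case (Int a b)
    from Int.IH(1)[of \<omega>] Int.prems obtain F where F: "finite F" "F \<subseteq> \<rat> \<times> \<rat> \<times> \<rat> \<times> \<rat>"
      "\<omega> \<in> path_space \<inter> \<Inter> (rational_box ` F)" "path_space \<inter> \<Inter> (rational_box ` F) \<subseteq> a" by blast
    from Int.IH(2)[of \<omega>] Int.prems obtain G where G: "finite G" "G \<subseteq> \<rat> \<times> \<rat> \<times> \<rat> \<times> \<rat>"
      "\<omega> \<in> path_space \<inter> \<Inter> (rational_box ` G)" "path_space \<inter> \<Inter> (rational_box ` G) \<subseteq> b" by blast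
    have eq: "path_space \<inter> \<Inter> (rational_box ` (F \<union> G)) =
        (path_space \<inter> \<Inter> (rational_box ` F)) \<inter> (path_space \<inter> \<Inter> (rational_box ` G))" by auto
    show ?case
    proof (intro exI[of _ "F \<union> G"] conjI; (unfold eq)?)
      show "finite (F \<union> G)" "F \<union> G \<subseteq> \<rat> \<times> \<rat> \<times> \<rat> \<times> \<rat>" using F G by simp_all
      show "\<omega> \<in> (path_space \<inter> \<Inter> (rational_box ` F)) \<inter> (path_space \<inter> \<Inter> (rational_box ` G))"
        using F(3) G(3) by (rule IntI)
      show "(path_space \<inter> \<Inter> (rational_box ` F)) \<inter> (path_space \<inter> \<Inter> (rational_box ` G)) \<subseteq> a \<inter> b"
        using F(4) G(4) by (rule Int_mono)
    qed
  next
    case (UN K)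
    then obtain k where k: "k \<in> K" "\<omega> \<in> k" by blast
    hence "k \<subseteq> \<Union>K" by (simp add: Union_upper)
    with UN.IH[OF k] show ?case by (elim ex_forward conj_forward) (assumption | erule order_trans)+
  next
    case (Basis s)
    then obtain K U where s: "s = {\<omega> \<in> path_space. \<omega> ` K \<subseteq> U}" "compact K" "open U" by blast
    have wp: "\<omega> \<in> path_space" and wK: "\<omega> ` K \<subseteq> U" using Basis s by auto
    define Q where "Q x p \<longleftrightarrow> p \<in> \<rat> \<times> \<rat> \<times> \<rat> \<times> \<rat> \<and> x \<in> {fst p<..<fst (snd p)} \<and> \<omega> \<in> rational_box p \<and>
            {fst (snd (snd p))..snd (snd (snd p))} \<subseteq> U" for x p
    have "\<exists>p. Q x p" if x: "x \<in> K" for x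
    proof -
      have "\<omega> x \<in> U" using x wK by auto
      from rational_box_neighbourhood[OF wp \<open>open U\<close> this]
      obtain a b c d where "a \<in> \<rat>" "b \<in> \<rat>" "c \<in> \<rat>" "d \<in> \<rat>" "x \<in> {a<..<b}"
        "\<omega> \<in> rational_box (a, b, c, d)" "{c..d} \<subseteq> U" .
      thus ?thesis by (intro exI[of _ "(a, b, c, d)"]) (simp add: Q_def)
    qed
    hence "\<forall>x\<in>K. \<exists>p. Q x p" by blast
    then obtain p where p: "\<And>x. x \<in> K \<Longrightarrow> Q x (p x)" by (elim bchoice[THEN exE]) blast
    have pQ: "p x \<in> \<rat> \<times> \<rat> \<times> \<rat> \<times> \<rat>" "x \<in> {fst (p x)<..<fst (snd (p x))}" "\<omega> \<in> rational_box (p x)"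
      "{fst (snd (snd (p x)))..snd (snd (snd (p x)))} \<subseteq> U" if "x \<in> K" for x
      using p[OF that] unfolding Q_def by blast+
    have "K \<subseteq> (\<Union>x\<in>K. {fst (p x)<..<fst (snd (p x))})"
      using pQ(2) by (intro subsetI UN_I)
    then obtain C where C: "C \<subseteq> K" "finite C" "K \<subseteq> (\<Union>x\<in>C. {fst (p x)<..<fst (snd (p x))})"
      by (rule compactE_image[OF \<open>compact K\<close> open_greaterThanLessThan])
    show ?case
    proof (intro exI[of _ "p ` C"] conjI)
      show "finite (p ` C)" using C by simp
      show "p ` C \<subseteq> \<rat> \<times> \<rat> \<times> \<rat> \<times> \<rat>"
        by (intro image_subsetI) (rule pQ(1)[OF subsetD[OF C(1)]])
      show "\<omega> \<in> path_space \<inter> \<Inter> (rational_box ` p ` C)"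
        using wp pQ(3)[OF subsetD[OF C(1)]] by simp
      show "path_space \<inter> \<Inter> (rational_box ` p ` C) \<subseteq> s"
      proof
        fix \<eta> assume e: "\<eta> \<in> path_space \<inter> \<Inter> (rational_box ` p ` C)"
        have "\<eta> y \<in> U" if y: "y \<in> K" for y
        proof -
          obtain x where x: "x \<in> C" "y \<in> {fst (p x)<..<fst (snd (p x))}"
            using subsetD[OF C(3) y] by (rule UN_E)
          have "\<eta> \<in> rational_box (fst (p x), fst (snd (p x)), fst (snd (snd (p x))), snd (snd (snd (p x))))"
            using e x(1) by auto
          from rational_box_continuous[OF this x(2)]
          show ?thesis by (rule subsetD[OF pQ(4)[OF subsetD[OF C(1) x(1)]]])
        qed
        thus "\<eta> \<in> s" using e s by auto
      qed
    qed
  qed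
qed

text \<open>There are only countably many finite sets of rational boxes, so the cover above exhibits
  each open set as a countable union of measurable sets. Conversely evaluation at \<open>t\<close>
  is continuous because \<open>{t}\<close> is compact.\<close>

lemma sets_compact_open_eq_coordinate:
  "sigma_sets path_space {S. openin compact_open_topology S} = sets coordinate_algebra"
proof
  show "sigma_sets path_space {S. openin compact_open_topology S} \<subseteq> sets coordinate_algebra"
  proof -
    have "S \<in> sets coordinate_algebra" if S: "openin compact_open_topology S" for S
    proof -
      let ?B = "\<lambda>F. path_space \<inter> \<Inter> (rational_box ` F)"
      let ?I = "{F. finite F \<and> F \<subseteq> \<rat> \<times> \<rat> \<times> \<rat> \<times> \<rat> \<and> ?B F \<subseteq> S}"
      have eq: "S = (\<Union>F\<in>?I. ?B F)"
      proof
        show "S \<subseteq> (\<Union>F\<in>?I. ?B F)"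
        proof
          fix \<omega> assume "\<omega> \<in> S"
          from compact_open_rational_box_cover[OF S this] show "\<omega> \<in> (\<Union>F\<in>?I. ?B F)" by blast
        qed
      qed auto
      have "countable ?I"
      proof (rule countable_subset)
        show "countable {F. finite F \<and> F \<subseteq> (\<rat> :: real set) \<times> (\<rat> :: real set) \<times> (\<rat> :: real set) \<times> (\<rat> :: real set)}"
          by (intro countable_Collect_finite_subset countable_SIGMA countable_rat)
      qed auto
      moreover have "?B F \<in> sets coordinate_algebra" if "finite F" for F
      proof (cases "F = {}")
        case True
        thus ?thesis using sets.top[of coordinate_algebra] by simp
      next
        case False
        thus ?thesis using that sets.top[of coordinate_algebra] rational_box_measurable
          by (intro sets.Int sets.finite_INT) auto
      qed
      ultimately have "(\<Union>F\<in>?I. ?B F) \<in> sets coordinate_algebra"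
        by (intro sets.countable_UN') auto
      thus ?thesis unfolding eq[symmetric] .
    qed
    thus ?thesis
      using sets.sigma_sets_subset[of "{S. openin compact_open_topology S}" coordinate_algebra] by auto
  qed
next
  let ?N = "sigma path_space {S. openin compact_open_topology S}"
  have top: "{S. openin compact_open_topology S} \<subseteq> Pow path_space"
    using openin_subset[of compact_open_topology]
    by (auto simp: compact_open_topology_def)
  have sp: "space ?N = path_space" and st: "sets ?N = sigma_sets path_space {S. openin compact_open_topology S}"
    using top by (auto simp: sets_measure_of)
  have "(\<lambda>\<omega>. \<omega> t) \<in> borel_measurable ?N" for t
  proof (rule borel_measurableI)
    fix U :: "real set" assume "open U"
    hence "openin compact_open_topology {\<omega> \<in> path_space. \<omega> ` {t} \<subseteq> U}"
      unfolding compact_open_topology_def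
      by (intro topology_generated_by_Basis CollectI) (use compact_insert[OF compact_empty, of t] in blast)
    hence "{\<omega> \<in> path_space. \<omega> ` {t} \<subseteq> U} \<in> sets ?N" unfolding st by (intro sigma_sets.Basic) simp
    moreover have "{\<omega> \<in> path_space. \<omega> ` {t} \<subseteq> U} = (\<lambda>\<omega>. \<omega> t) -` U \<inter> space ?N" unfolding sp by auto
    ultimately show "(\<lambda>\<omega>. \<omega> t) -` U \<inter> space ?N \<in> sets ?N" by simp
  qed
  hence "(\<lambda>\<omega>. \<omega>) \<in> measurable ?N (PiM UNIV (\<lambda>_. borel))"
    by (intro measurable_PiM_single') (auto simp: space_PiM)
  thus "sets coordinate_algebra \<subseteq> sigma_sets path_space {S. openin compact_open_topology S}"
    unfolding coordinate_algebra_def st[symmetric] by (intro sets_image_in_sets sp)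
qed

lemma wiener_measure_sets: "wiener_measure P \<Longrightarrow> sets P = sets coordinate_algebra"
  using sets_compact_open_eq_coordinate by (simp add: wiener_measure_def)

lemma wiener_coordinate_measurable: "wiener_measure P \<Longrightarrow> (\<lambda>\<omega>. \<omega> t) \<in> borel_measurable P"
  using coordinate_measurable measurable_cong_sets[OF wiener_measure_sets refl] by blast

text \<open>The right-hand side does not mention \<open>P\<close>: this is what makes two Wiener
  measures comparable.\<close>

lemma wiener_increments_distr:
  assumes P: "wiener_measure P" and t: "strict_mono_on {..n} t" and n: "n > 0"
  shows "distr P (\<Pi>\<^sub>M i\<in>{..<n}. borel) (\<lambda>\<omega>. \<lambda>i\<in>{..<n}. \<omega> (t (Suc i)) - \<omega> (t i)) =
         (\<Pi>\<^sub>M i\<in>{..<n}. density lborel (normal_density 0 (sqrt (t (Suc i) - t i))))"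
proof -
  interpret prob_space P using P by (simp add: wiener_measure_def)
  have "indep_vars (\<lambda>_. borel) (\<lambda>i \<omega>. \<omega> (t (Suc i)) - \<omega> (t i)) {..<n}"
    using P t by (simp add: wiener_measure_def)
  hence "distr P (\<Pi>\<^sub>M i\<in>{..<n}. borel) (\<lambda>\<omega>. \<lambda>i\<in>{..<n}. \<omega> (t (Suc i)) - \<omega> (t i)) =
    (\<Pi>\<^sub>M i\<in>{..<n}. distr P borel (\<lambda>\<omega>. \<omega> (t (Suc i)) - \<omega> (t i)))"
    using n wiener_coordinate_measurable[OF P]
    by (subst (asm) indep_vars_iff_distr_eq_PiM') auto
  also have "\<dots> = (\<Pi>\<^sub>M i\<in>{..<n}. density lborel (normal_density 0 (sqrt (t (Suc i) - t i))))"
  proof (intro PiM_cong refl)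
    fix i assume "i \<in> {..<n}"
    hence "t i < t (Suc i)" using t by (intro strict_mono_onD[OF t]) auto
    thus "distr P borel (\<lambda>\<omega>. \<omega> (t (Suc i)) - \<omega> (t i)) =
      density lborel (normal_density 0 (sqrt (t (Suc i) - t i)))"
      using P by (simp add: wiener_measure_def)
  qed
  finally show ?thesis .
qed

text \<open>A cylinder event is rewritten as an event about increments between consecutive times,
  whose joint law is the same for every Wiener measure.\<close>

lemma wiener_cylinder_eq:
  assumes P: "wiener_measure P" and Q: "wiener_measure Q" and J: "finite J"
    and A: "\<And>j. j \<in> J \<Longrightarrow> A j \<in> sets borel"
  shows "emeasure P {\<omega> \<in> path_space. \<forall>j\<in>J. \<omega> j \<in> A j} = emeasure Q {\<omega> \<in> path_space. \<forall>j\<in>J. \<omega> j \<in> A j}"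
proof -
  \<comment> \<open>The time 0 is added because \<open>\<omega> 0 = 0\<close> anchors the path; the
    time 1 guarantees two distinct points, hence at least one increment.\<close>
  define l where "l = sorted_list_of_set (insert 0 (insert 1 J))"
  define n where "n = length l - 1"
  define t where "t i = l ! i" for i
  have fin: "finite (insert 0 (insert 1 J))" using J by simp
  have setl: "set l = insert 0 (insert 1 J)" unfolding l_def by (rule set_sorted_list_of_set[OF fin])
  have "card {0, 1 :: real} \<le> card (set l)" unfolding setl using fin by (intro card_mono) auto
  moreover have "card (set l) = length l"
    by (intro distinct_card) (simp add: l_def)
  ultimately have len: "length l = Suc n" and n: "n > 0" by (auto simp: n_def)
  have t: "strict_mono_on {..n} t"
  proof (rule strict_mono_onI)
    fix r s assume "r \<in> {..n}" "s \<in> {..n}" "r < s"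
    moreover have "sorted_wrt (<) l" by (simp add: l_def strict_sorted_list_of_set)
    ultimately show "t r < t s" using len by (auto simp: t_def sorted_wrt_nth_less)
  qed
  have range_t: "x \<in> t ` {..n}" if "x \<in> set l" for x
  proof -
    obtain i where "i < length l" "l ! i = x" using \<open>x \<in> set l\<close> by (auto simp: in_set_conv_nth)
    thus ?thesis using len by (intro image_eqI[of _ _ i]) (auto simp: t_def)
  qed
  obtain i0 where i0: "i0 \<le> n" "t i0 = 0" using range_t[of 0] setl by auto
  let ?M = "\<Pi>\<^sub>M i\<in>{..<n}. (borel :: real measure)"
  let ?X = "\<lambda>\<omega>. \<lambda>i\<in>{..<n}. \<omega> (t (Suc i)) - \<omega> (t i)"
  \<comment> \<open>Times may be negative, so the anchor 0 sits at some position \<open>i0\<close>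
    in the list. The value at \<open>t k\<close> is the difference of the increment sums up to
    \<open>k\<close> and up to \<open>i0\<close>.\<close>
  define C where "C = {x \<in> space ?M. \<forall>k\<in>{k\<in>{..n}. t k \<in> J}. (\<Sum>i<k. x i) - (\<Sum>i<i0. x i) \<in> A (t k)}"
  have C: "C \<in> sets ?M"
    unfolding C_def
  proof (intro sets.sets_Collect_finite_All)
    fix k assume k: "k \<in> {k\<in>{..n}. t k \<in> J}"
    have "(\<lambda>x. (\<Sum>i<k. x i) - (\<Sum>i<i0. x i)) \<in> borel_measurable ?M"
      using k i0 by (intro borel_measurable_diff borel_measurable_sum measurable_component_singleton) auto
    from measurable_sets[OF this A[of "t k"]] k
    show "{x \<in> space ?M. (\<Sum>i<k. x i) - (\<Sum>i<i0. x i) \<in> A (t k)} \<in> sets ?M"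
      by (simp add: vimage_def Int_def conj_commute)
  qed simp
  have "emeasure R {\<omega> \<in> path_space. \<forall>j\<in>J. \<omega> j \<in> A j} =
    emeasure (\<Pi>\<^sub>M i\<in>{..<n}. density lborel (normal_density 0 (sqrt (t (Suc i) - t i)))) C"
    if R: "wiener_measure R" for R
  proof -
    have sp: "space R = path_space" using R by (simp add: wiener_measure_def)
    have tele: "(\<Sum>i<k. ?X \<omega> i) - (\<Sum>i<i0. ?X \<omega> i) = \<omega> (t k)" if w: "\<omega> \<in> path_space" and k: "k \<le> n" for \<omega> k
    proof -
      have "(\<Sum>i<m. ?X \<omega> i) = \<omega> (t m) - \<omega> (t 0)" if "m \<le> n" for m
      proof -
        have "(\<Sum>i<m. ?X \<omega> i) = (\<Sum>i<m. \<omega> (t (Suc i)) - \<omega> (t i))"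
          using that by (intro sum.cong) auto
        also have "\<dots> = \<omega> (t m) - \<omega> (t 0)" using sum_lessThan_telescope[of "\<lambda>i. \<omega> (t i)" m] by simp
        finally show ?thesis .
      qed
      thus ?thesis using k i0 w by (simp add: path_space_def)
    qed
    have "{\<omega> \<in> path_space. \<forall>j\<in>J. \<omega> j \<in> A j} = ?X -` C \<inter> space R"
    proof (intro set_eqI iffI)
      fix \<omega> assume w: "\<omega> \<in> {\<omega> \<in> path_space. \<forall>j\<in>J. \<omega> j \<in> A j}"
      have "(\<Sum>i<k. ?X \<omega> i) - (\<Sum>i<i0. ?X \<omega> i) \<in> A (t k)" if "k \<le> n" "t k \<in> J" for k
        using tele[of \<omega> k] that w by simp
      hence "?X \<omega> \<in> C" unfolding C_def by (auto simp: space_PiM simp del: restrict_apply)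
      thus "\<omega> \<in> ?X -` C \<inter> space R" using w sp by (intro IntI vimageI2) auto
    next
      fix \<omega> assume w: "\<omega> \<in> ?X -` C \<inter> space R"
      have "\<omega> j \<in> A j" if j: "j \<in> J" for j
      proof -
        obtain k where k: "k \<le> n" "t k = j" using range_t[of j] j setl by auto
        have "?X \<omega> \<in> C" using w by (rule vimageD[OF IntD1])
        hence "(\<Sum>i<k. ?X \<omega> i) - (\<Sum>i<i0. ?X \<omega> i) \<in> A (t k)"
          using k j unfolding C_def by blast
        moreover have "\<omega> \<in> path_space" using w sp by auto
        ultimately show ?thesis using tele[of \<omega> k] k by metis
      qed
      thus "\<omega> \<in> {\<omega> \<in> path_space. \<forall>j\<in>J. \<omega> j \<in> A j}" using w by (simp add: sp)
    qed
    also have "emeasure R (?X -` C \<inter> space R) = emeasure (distr R ?M ?X) C"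
      using C wiener_coordinate_measurable[OF R]
      by (intro emeasure_distr[symmetric] measurable_restrict borel_measurable_diff) auto
    finally show ?thesis unfolding wiener_increments_distr[OF R t n] .
  qed
  thus ?thesis using P Q by simp
qed

text \<open>Both laws are pushed to the full product, where cylinders form a generator stable under
  intersections. Every event is the trace on paths of a product-measurable set, so equality there
  suffices, and \<open>path_space\<close> is never treated as an element of the product
  sigma-algebra.\<close>

lemma wiener_measure_unique:
  assumes P: "wiener_measure P" and Q: "wiener_measure Q"
  shows "P = Q"
proof -
  let ?M = "PiM UNIV (\<lambda>_. borel) :: (real \<Rightarrow> real) measure"
  have sp: "space P = path_space" "space Q = path_space" using P Q by (auto simp: wiener_measure_def)
  have id: "(\<lambda>\<omega>. \<omega>) \<in> measurable R ?M" if "wiener_measure R" for R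
    using wiener_coordinate_measurable[OF that] by (intro measurable_PiM_single') (auto simp: space_PiM)
  have "distr P ?M (\<lambda>\<omega>. \<omega>) = distr Q ?M (\<lambda>\<omega>. \<omega>)"
  proof (rule measure_eqI_PiM_infinite)
    interpret P: prob_space P using P by (simp add: wiener_measure_def)
    interpret D: prob_space "distr P ?M (\<lambda>\<omega>. \<omega>)" using id[OF P] by (rule P.prob_space_distr)
    show "finite_measure (distr P ?M (\<lambda>\<omega>. \<omega>))" by unfold_locales
    fix A :: "real \<Rightarrow> real set" and J assume J: "finite J" "J \<subseteq> UNIV" and A: "\<And>i. i \<in> J \<Longrightarrow> A i \<in> sets (borel :: real measure)"
    have "prod_emb UNIV (\<lambda>_. borel) J (Pi\<^sub>E J A) \<in> sets ?M"
      using J A by (intro sets_PiM_I) auto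
    moreover have "(\<lambda>\<omega>. \<omega>) -` prod_emb UNIV (\<lambda>_. borel) J (Pi\<^sub>E J A) \<inter> path_space = {\<omega> \<in> path_space. \<forall>j\<in>J. \<omega> j \<in> A j}"
      by (auto simp: prod_emb_def space_PiM)
    ultimately show "emeasure (distr P ?M (\<lambda>\<omega>. \<omega>)) (prod_emb UNIV (\<lambda>_. borel) J (Pi\<^sub>E J A)) =
      emeasure (distr Q ?M (\<lambda>\<omega>. \<omega>)) (prod_emb UNIV (\<lambda>_. borel) J (Pi\<^sub>E J A))"
      using id[OF P] id[OF Q] wiener_cylinder_eq[OF P Q J(1) A] by (simp add: emeasure_distr sp)
  qed simp_all
  hence eq: "emeasure P (B \<inter> path_space) = emeasure Q (B \<inter> path_space)" if "B \<in> sets ?M" for B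
    using that emeasure_distr[OF id[OF P] that] emeasure_distr[OF id[OF Q] that] by (simp add: sp)
  show ?thesis
  proof (rule measure_eqI)
    show "sets P = sets Q" using P Q by (simp add: wiener_measure_def)
    fix A assume "A \<in> sets P"
    hence "A \<in> sets (vimage_algebra path_space (\<lambda>\<omega>. \<omega>) ?M)"
      using wiener_measure_sets[OF P] by (simp add: coordinate_algebra_def)
    then obtain B where "B \<in> sets ?M" "A = B \<inter> path_space"
      by (subst (asm) sets_vimage_algebra2) (auto simp: space_PiM)
    thus "emeasure P A = emeasure Q A" using eq by simp
  qed
qed

lemma \<theta>_in_path_space: "\<omega> \<in> path_space \<Longrightarrow> \<theta> s \<omega> \<in> path_space"
  by (auto simp: path_space_def \<theta>_def intro!: continuous_intros continuous_on_compose2[of UNIV \<omega>])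

lemma \<theta>_add: "\<theta> s (\<theta> t \<omega>) = \<theta> (s + t) \<omega>"
  by (simp add: \<theta>_def fun_eq_iff algebra_simps)

lemma \<theta>_zero: "\<omega> \<in> path_space \<Longrightarrow> \<theta> 0 \<omega> = \<omega>"
  by (simp add: \<theta>_def path_space_def fun_eq_iff)

lemma \<theta>_measurable:
  assumes P: "wiener_measure P"
  shows "\<theta> s \<in> measurable P P"
proof -
  have sp: "space P = path_space" using P by (auto simp: wiener_measure_def)
  have "\<theta> s \<in> measurable P (vimage_algebra path_space (\<lambda>\<omega>. \<omega>) (PiM UNIV (\<lambda>_. borel)))"
  proof (rule measurable_vimage_algebra2)
    show "\<theta> s \<in> space P \<rightarrow> path_space" using \<theta>_in_path_space sp by auto
    have "(\<lambda>\<omega>. \<theta> s \<omega> t) \<in> borel_measurable P" for t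
      unfolding \<theta>_def by (intro borel_measurable_diff wiener_coordinate_measurable[OF P])
    thus "(\<lambda>\<omega>. \<theta> s \<omega>) \<in> measurable P (PiM UNIV (\<lambda>_. borel))"
      by (intro measurable_PiM_single') (auto simp: space_PiM)
  qed
  thus ?thesis
    unfolding measurable_cong_sets[OF refl wiener_measure_sets[OF P]] coordinate_algebra_def .
qed

text \<open>By uniqueness it is enough that the law of the shifted path is again a Wiener measure.
  The subtracted constant \<open>\<omega> s\<close> cancels in every increment, so increments
  between \<open>a\<close> and \<open>b\<close> become increments between \<open>a + s\<close> and
  \<open>b + s\<close>.\<close>

lemma wiener_measure_shift:
  assumes P: "wiener_measure P"
  shows "distr P P (\<theta> s) = P"
proof (rule wiener_measure_unique[OF _ P])
  interpret P: prob_space P using P by (simp add: wiener_measure_def)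
  note m = \<theta>_measurable[OF P, of s]
  interpret D: prob_space "distr P P (\<theta> s)" using m by (rule P.prob_space_distr)
  note cm = wiener_coordinate_measurable[OF P]
  have inc: "distr (distr P P (\<theta> s)) borel (\<lambda>\<omega>. \<omega> b - \<omega> a) = distr P borel (\<lambda>\<omega>. \<omega> (b + s) - \<omega> (a + s))" for a b
    using m cm by (subst distr_distr) (auto simp: o_def \<theta>_def)
  have ind: "D.indep_vars (\<lambda>_. borel) (\<lambda>i \<omega>. \<omega> (t (Suc i)) - \<omega> (t i)) {..<n}"
    if t: "strict_mono_on {..n} t" for n and t :: "nat \<Rightarrow> real"
  \<comment> \<open>The description of independence by a product law is applied to nonempty index
    sets only; the empty family is trivially independent.\<close>
  proof (cases "n = 0")
    case True
    thus ?thesis by (simp add: D.indep_vars_def D.indep_sets_def)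
  next
    case False
    have "P.indep_vars (\<lambda>_. borel) (\<lambda>i \<omega>. \<omega> (t (Suc i) + s) - \<omega> (t i + s)) {..<n}"
    proof -
      have "strict_mono_on {..n} (\<lambda>i. t i + s)" using t by (auto simp: strict_mono_on_def)
      thus ?thesis using P unfolding wiener_measure_def by blast
    qed
    hence "distr P (\<Pi>\<^sub>M i\<in>{..<n}. borel) (\<lambda>\<omega>. \<lambda>i\<in>{..<n}. \<omega> (t (Suc i) + s) - \<omega> (t i + s)) =
      (\<Pi>\<^sub>M i\<in>{..<n}. distr P borel (\<lambda>\<omega>. \<omega> (t (Suc i) + s) - \<omega> (t i + s)))"
      using False cm by (subst (asm) P.indep_vars_iff_distr_eq_PiM') auto
    also have "distr P (\<Pi>\<^sub>M i\<in>{..<n}. borel) (\<lambda>\<omega>. \<lambda>i\<in>{..<n}. \<omega> (t (Suc i) + s) - \<omega> (t i + s)) =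
      distr (distr P P (\<theta> s)) (\<Pi>\<^sub>M i\<in>{..<n}. borel) (\<lambda>\<omega>. \<lambda>i\<in>{..<n}. \<omega> (t (Suc i)) - \<omega> (t i))"
      using m cm by (subst distr_distr) (auto simp: o_def \<theta>_def intro!: measurable_restrict)
    finally show ?thesis
      using False cm by (subst D.indep_vars_iff_distr_eq_PiM') (auto simp: inc)
  qed
  have "distr (distr P P (\<theta> s)) borel (\<lambda>\<omega>. \<omega> b - \<omega> a) = density lborel (normal_density 0 (sqrt (b - a)))"
    if "a < b" for a b
  proof -
    have "a + s < b + s" using that by simp
    hence "distr P borel (\<lambda>\<omega>. \<omega> (b + s) - \<omega> (a + s)) = density lborel (normal_density 0 (sqrt ((b + s) - (a + s))))"
      using P unfolding wiener_measure_def by blast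
    thus ?thesis by (simp add: inc)
  qed
  thus "wiener_measure (distr P P (\<theta> s))"
    using P ind D.prob_space_axioms by (auto simp: wiener_measure_def)
qed

lemma wiener_AE_shift:
  assumes P: "wiener_measure P" and Q: "AE \<omega> in P. Q \<omega>"
  shows "AE \<omega> in P. Q (\<theta> s \<omega>)"
proof (rule AE_distrD[OF \<theta>_measurable[OF P]])
  show "AE \<omega> in distr P P (\<theta> s). Q \<omega>" by (subst wiener_measure_shift[OF P]) (rule Q)
qed

section \<open>The evolution process\<close>

lemma opA_diff: "opA (u - v) = opA u - opA v"
  by transfer (simp add: fun_eq_iff algebra_simps)

lemma sum_shift_seq_le_norm:
  fixes u :: ell2
  assumes "finite F"
  shows "(\<Sum>i\<in>F. (seq u (i + k))\<^sup>2) \<le> (norm u)\<^sup>2"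
proof -
  have "(\<Sum>i\<in>F. (seq u (i + k))\<^sup>2) = (\<Sum>i\<in>(\<lambda>i. i + k) ` F. (seq u i)\<^sup>2)"
    by (simp add: sum.reindex)
  thus ?thesis using sum_seq_le_norm[of "(\<lambda>i. i + k) ` F" u] assms by simp
qed

text \<open>The Cauchy inequality for three terms gives \<open>12 + 3 + 3 = 18\<close>, rounded up
  to 25, the square of 5; the constant is not meant to be sharp.\<close>

lemma norm_opA_le: "norm (opA u) \<le> 5 * norm u"
proof (rule ell2_norm_le)
  fix F :: "int set" assume F: "finite F"
  have sq: "(2 * a - b - c)\<^sup>2 \<le> 12 * a\<^sup>2 + 3 * b\<^sup>2 + 3 * c\<^sup>2" for a b c :: real
  proof -
    have "0 \<le> (2 * a + b)\<^sup>2 + (2 * a + c)\<^sup>2 + (b - c)\<^sup>2" by simp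
    thus ?thesis by (simp add: power2_eq_square algebra_simps)
  qed
  have "(\<Sum>i\<in>F. (seq (opA u) i)\<^sup>2) \<le>
        (\<Sum>i\<in>F. 12 * (seq u (i + 0))\<^sup>2 + 3 * (seq u (i + -1))\<^sup>2 + 3 * (seq u (i + 1))\<^sup>2)"
    by (intro sum_mono) (simp add: opA.rep_eq sq)
  also have "\<dots> \<le> 12 * (norm u)\<^sup>2 + 3 * (norm u)\<^sup>2 + 3 * (norm u)\<^sup>2"
    unfolding sum.distrib sum_distrib_left[symmetric]
    by (intro add_mono mult_left_mono sum_shift_seq_le_norm F) auto
  also have "\<dots> \<le> (5 * norm u)\<^sup>2" by (simp add: power_mult_distrib)
  finally show "(\<Sum>i\<in>F. (seq (opA u) i)\<^sup>2) \<le> (5 * norm u)\<^sup>2" .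
qed simp

text \<open>Integrated form of \<open>w' = G\<close> for an integrable \<open>G\<close>, with no
  derivative involved. Half-open intervals make adjacent pieces disjoint, so integrals can be joined
  without discussing endpoints.\<close>

definition primitive_on ::
  "real \<Rightarrow> real \<Rightarrow> (real \<Rightarrow> 'a::{real_inner,banach,second_countable_topology}) \<Rightarrow> (real \<Rightarrow> 'a) \<Rightarrow> bool" where
  "primitive_on s t w G \<longleftrightarrow> set_integrable lebesgue {s..t} G \<and> continuous_on {s..t} w \<and>
     (\<forall>r r'. s \<le> r \<longrightarrow> r \<le> r' \<longrightarrow> r' \<le> t \<longrightarrow> w r' - w r = (LINT x:{r<..r'}|lebesgue. G x))"

lemma primitive_on_subinterval:
  "primitive_on s t w G \<Longrightarrow> s \<le> s' \<Longrightarrow> t' \<le> t \<Longrightarrow> primitive_on s' t' w G"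
  unfolding primitive_on_def
  by (auto intro: set_integrable_subset continuous_on_subset[of "{s..t}"])

lemma primitive_on_diff:
  assumes "primitive_on s t v G" "primitive_on s t y H"
  shows "primitive_on s t (\<lambda>r. v r - y r) (\<lambda>r. G r - H r)"
proof -
  have sub: "set_integrable lebesgue {r<..r'} G" "set_integrable lebesgue {r<..r'} H" if "s \<le> r" "r' \<le> t" for r r'
    using assms that unfolding primitive_on_def by (auto elim!: set_integrable_subset)
  have "v r' - y r' - (v r - y r) = (LINT x:{r<..r'}|lebesgue. G x - H x)"
    if "s \<le> r" "r \<le> r'" "r' \<le> t" for r r'
  proof -
    have "v r' - v r = (LINT x:{r<..r'}|lebesgue. G x)" "y r' - y r = (LINT x:{r<..r'}|lebesgue. H x)"
      using assms that unfolding primitive_on_def by blast+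
    thus ?thesis using sub[OF that(1,3)] by (simp add: set_integral_diff algebra_simps)
  qed
  thus ?thesis
    using assms unfolding primitive_on_def by (auto intro!: set_integral_diff continuous_on_diff)
qed

lemma primitive_on_const: "primitive_on s t (\<lambda>_. c) (\<lambda>_. 0)"
  unfolding primitive_on_def by (simp add: set_integrable_def set_lebesgue_integral_def)

lemma set_integral_join:
  fixes f :: "real \<Rightarrow> 'a::{banach,second_countable_topology}"
  assumes "set_integrable lebesgue {a<..c} f" "a \<le> b" "b \<le> c"
  shows "(LINT x:{a<..c}|lebesgue. f x) = (LINT x:{a<..b}|lebesgue. f x) + (LINT x:{b<..c}|lebesgue. f x)"
proof -
  have "{a<..c} = {a<..b} \<union> {b<..c}" using assms by auto
  moreover have "set_integrable lebesgue {a<..b} f" "set_integrable lebesgue {b<..c} f"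
    using assms by (auto elim!: set_integrable_subset)
  ultimately show ?thesis by (simp add: set_integral_Un)
qed

lemma set_integrable_continuous_inner:
  fixes G w :: "real \<Rightarrow> 'a::{real_inner,banach,second_countable_topology}"
  assumes G: "set_integrable lebesgue {s..t} G" and w: "continuous_on {s..t} w"
  shows "set_integrable lebesgue {s..t} (\<lambda>r. w r \<bullet> G r)"
proof -
  have "compact (w ` {s..t})" using w compact_Icc compact_continuous_image by blast
  then obtain M where M: "\<And>r. r \<in> {s..t} \<Longrightarrow> norm (w r) \<le> M"
    using compact_imp_bounded bounded_iff by (metis image_eqI)
  have G': "integrable lebesgue (\<lambda>r. indicator {s..t} r *\<^sub>R G r)" using G by (simp add: set_integrable_def)
  have w': "(\<lambda>r. indicator {s..t} r *\<^sub>R w r) \<in> borel_measurable lebesgue"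
    using w by (intro measurable_completion) (auto intro!: borel_measurable_continuous_on_indicator)
  have "integrable lebesgue (\<lambda>r. (indicator {s..t} r *\<^sub>R w r) \<bullet> (indicator {s..t} r *\<^sub>R G r))"
  proof (rule Bochner_Integration.integrable_bound[OF integrable_mult_right[OF integrable_norm[OF G'], of M]])
    show "(\<lambda>r. (indicator {s..t} r *\<^sub>R w r) \<bullet> (indicator {s..t} r *\<^sub>R G r)) \<in> borel_measurable lebesgue"
      using w' G' by (intro borel_measurable_inner) auto
    show "AE r in lebesgue. norm ((indicator {s..t} r *\<^sub>R w r) \<bullet> (indicator {s..t} r *\<^sub>R G r)) \<le>
            norm (M * norm (indicator {s..t} r *\<^sub>R G r))"
    proof (intro AE_I2)
      fix r
      show "norm ((indicator {s..t} r *\<^sub>R w r) \<bullet> (indicator {s..t} r *\<^sub>R G r)) \<le>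
            norm (M * norm (indicator {s..t} r *\<^sub>R G r))"
      proof (cases "r \<in> {s..t}")
        case True
        have "\<bar>w r \<bullet> G r\<bar> \<le> norm (w r) * norm (G r)" by (rule Cauchy_Schwarz_ineq2)
        also have "\<dots> \<le> \<bar>M\<bar> * norm (G r)" using M[OF True] by (intro mult_right_mono) auto
        finally show ?thesis using True by (simp add: abs_mult)
      qed simp
    qed
  qed
  moreover have "(\<lambda>r. (indicator {s..t} r *\<^sub>R w r) \<bullet> (indicator {s..t} r *\<^sub>R G r)) =
                 (\<lambda>r. indicator {s..t} r *\<^sub>R (w r \<bullet> G r))"
    by (auto simp: fun_eq_iff indicator_def)
  ultimately show ?thesis by (simp add: set_integrable_def)
qed

text \<open>
  The convexity bound \<open>\<parallel>w r'\<parallel>\<^sup>2 - \<parallel>w r\<parallel>\<^sup>2 \<le> 2 w r' \<bullet> (w r' - w r)\<close> on short intervals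
  replaces a product rule for absolutely continuous functions.
\<close>
lemma primitive_on_norm_square_le:
  assumes p: "primitive_on s t w G" and st: "s \<le> t"
  shows "(norm (w t))\<^sup>2 \<le> (norm (w s))\<^sup>2 + 2 * (LINT r:{s<..t}|lebesgue. w r \<bullet> G r)"
proof -
  have w: "continuous_on {s..t} w" and G: "set_integrable lebesgue {s..t} G"
    using p by (auto simp: primitive_on_def)
  have wG: "set_integrable lebesgue {s..t} (\<lambda>r. w r \<bullet> G r)"
    by (rule set_integrable_continuous_inner[OF G w])
  have nG: "set_integrable lebesgue {s..t} (\<lambda>r. norm (G r))"
    by (rule set_integrable_norm[OF G])
  have sub: "{r<..r'} \<subseteq> {s..t}" if "s \<le> r" "r' \<le> t" for r r' using that by auto
  have eps: "(norm (w t))\<^sup>2 \<le> (norm (w s))\<^sup>2 + 2 * (LINT r:{s<..t}|lebesgue. w r \<bullet> G r + e * norm (G r))"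
    if e: "e > 0" for e
  proof -
    define H where "H r = w r \<bullet> G r + e * norm (G r)" for r
    have H: "set_integrable lebesgue {r<..r'} H" if "s \<le> r" "r' \<le> t" for r r'
      unfolding H_def using set_integrable_subset[OF wG _ sub[OF that]] set_integrable_subset[OF nG _ sub[OF that]]
      by (intro set_integral_add) auto
    have "uniformly_continuous_on {s..t} w" using w compact_Icc compact_uniformly_continuous by blast
    then obtain d where d: "d > 0" "\<And>r r'. r \<in> {s..t} \<Longrightarrow> r' \<in> {s..t} \<Longrightarrow> dist r' r < d \<Longrightarrow> dist (w r') (w r) < e"
      using e by (metis uniformly_continuous_on_def)
    have short: "(norm (w r'))\<^sup>2 \<le> (norm (w r))\<^sup>2 + 2 * (LINT r:{r<..r'}|lebesgue. H r)"
      if r: "s \<le> r" "r \<le> r'" "r' \<le> t" "r' - r \<le> d / 2" for r r'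
    proof -
      have Gs: "set_integrable lebesgue {r<..r'} G"
        using set_integrable_subset[OF G _ sub[of r r']] r by auto
      have "(norm (w r'))\<^sup>2 \<le> (norm (w r))\<^sup>2 + 2 * (w r' \<bullet> (w r' - w r))"
      proof -
        have "0 \<le> (w r' - w r) \<bullet> (w r' - w r)" by simp
        thus ?thesis by (simp add: power2_norm_eq_inner inner_diff_left inner_diff_right inner_commute)
      qed
      also have "w r' - w r = (LINT x:{r<..r'}|lebesgue. G x)"
        using p r unfolding primitive_on_def by blast
      also have "w r' \<bullet> (LINT x:{r<..r'}|lebesgue. G x) = (LINT x:{r<..r'}|lebesgue. w r' \<bullet> G x)"
        using integral_inner_right[of "w r'" lebesgue "\<lambda>x. indicator {r<..r'} x *\<^sub>R G x"] Gs
        by (simp add: set_lebesgue_integral_def set_integrable_def)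
      also have "(LINT x:{r<..r'}|lebesgue. w r' \<bullet> G x) \<le> (LINT x:{r<..r'}|lebesgue. H x)"
      proof (rule set_integral_mono)
        show "set_integrable lebesgue {r<..r'} (\<lambda>x. w r' \<bullet> G x)"
          using Gs integrable_inner_right[of "w r'" lebesgue "\<lambda>x. indicator {r<..r'} x *\<^sub>R G x"]
          by (simp add: set_integrable_def)
        show "set_integrable lebesgue {r<..r'} H" using r by (intro H) auto
        fix x assume x: "x \<in> {r<..r'}"
        have "dist (w r') (w x) < e" using x r d(1) by (intro d(2)) (auto simp: dist_real_def)
        hence "(w r' - w x) \<bullet> G x \<le> e * norm (G x)"
          using norm_cauchy_schwarz[of "w r' - w x" "G x"] mult_right_mono[of "norm (w r' - w x)" e "norm (G x)"]
          by (simp add: dist_norm)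
        thus "w r' \<bullet> G x \<le> H x" by (simp add: H_def inner_diff_left)
      qed
      finally show ?thesis by simp
    qed
    \<comment> \<open>Induction on the number of steps of length \<open>d / 2\<close> needed to
      reach \<open>r'\<close> from \<open>s\<close>; the last step starts at \<open>m\<close> and
      may be shorter.\<close>
    have "(norm (w r'))\<^sup>2 \<le> (norm (w s))\<^sup>2 + 2 * (LINT r:{s<..r'}|lebesgue. H r)"
      if "s \<le> r'" "r' \<le> t" "r' - s \<le> real n * (d / 2)" for n r'
      using that
    proof (induction n arbitrary: r')
      case 0
      hence "r' = s" by simp
      thus ?case by (simp add: set_lebesgue_integral_def)
    next
      case (Suc n)
      define m where "m = max s (r' - d / 2)"
      have m: "s \<le> m" "m \<le> r'" "m \<le> t" "r' - m \<le> d / 2" "m - s \<le> real n * (d / 2)"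
        using Suc.prems d(1) by (auto simp: m_def max_def algebra_simps)
      have "(norm (w r'))\<^sup>2 \<le> (norm (w m))\<^sup>2 + 2 * (LINT r:{m<..r'}|lebesgue. H r)"
        using m Suc.prems by (intro short) auto
      also have "(norm (w m))\<^sup>2 \<le> (norm (w s))\<^sup>2 + 2 * (LINT r:{s<..m}|lebesgue. H r)"
        using m by (intro Suc.IH) auto
      finally show ?case
        using set_integral_join[OF H, of s r' m] m Suc.prems by simp
    qed
    from this[of t "nat \<lceil>(t - s) / (d / 2)\<rceil>"] st d(1) show ?thesis
      by (simp add: H_def[symmetric] pos_divide_le_eq[symmetric] del: pos_divide_le_eq)
  qed
  have wG': "set_integrable lebesgue {s<..t} (\<lambda>r. w r \<bullet> G r)" and nG': "set_integrable lebesgue {s<..t} (\<lambda>r. norm (G r))"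
    using set_integrable_subset[OF wG _ sub[of s t]] set_integrable_subset[OF nG _ sub[of s t]] by auto
  define N where "N = (LINT r:{s<..t}|lebesgue. norm (G r))"
  have N: "N \<ge> 0" unfolding N_def set_lebesgue_integral_def by (intro integral_nonneg_AE) simp
  show ?thesis
  proof (rule field_le_epsilon)
    fix e :: real assume e: "e > 0"
    \<comment> \<open>The \<open>+ 1\<close> in the denominator covers \<open>N = 0\<close>, and the
      2 there absorbs the factor in front of the integral.\<close>
    have "(norm (w t))\<^sup>2 \<le> (norm (w s))\<^sup>2 +
      2 * (LINT r:{s<..t}|lebesgue. w r \<bullet> G r + e / (2 * (N + 1)) * norm (G r))"
      using e N by (intro eps) simp
    also have "(LINT r:{s<..t}|lebesgue. w r \<bullet> G r + e / (2 * (N + 1)) * norm (G r)) =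
      (LINT r:{s<..t}|lebesgue. w r \<bullet> G r) + e / (2 * (N + 1)) * N"
      using wG' nG' by (subst set_integral_add(2)) (auto simp: N_def)
    also have "e / (2 * (N + 1)) * N \<le> e / 2" using e N by (simp add: field_simps)
    finally show "(norm (w t))\<^sup>2 \<le> (norm (w s))\<^sup>2 + 2 * (LINT r:{s<..t}|lebesgue. w r \<bullet> G r) + e" by simp
  qed
qed

text \<open>The right-hand side of the integral inequality is differentiable although
  \<open>u\<close> is only continuous; multiplied by the decaying exponential it is
  nonincreasing.\<close>

lemma gronwall:
  fixes u :: "real \<Rightarrow> real"
  assumes u: "continuous_on {s..t} u" and K: "0 \<le> K" and st: "s \<le> t"
    and le: "\<And>r. r \<in> {s..t} \<Longrightarrow> u r \<le> a + K * integral {s..r} u"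
  shows "u t \<le> a * exp (K * (t - s))"
proof (cases "s = t")
  case True
  thus ?thesis using le[of s] by simp
next
  case False
  define I where "I r = a + K * integral {s..r} u" for r
  have "I t * exp (- K * (t - s)) \<le> I s * exp (- K * (s - s))"
  proof (rule DERIV_nonpos_imp_decreasing_open[where f = "\<lambda>r. I r * exp (- K * (r - s))"])
    show "s \<le> t" by fact
    have "continuous_on {s..t} (\<lambda>r. integral {s..r} u)"
      using u by (intro indefinite_integral_continuous_1 integrable_continuous_real)
    thus "continuous_on {s..t} (\<lambda>r. I r * exp (- K * (r - s)))"
      unfolding I_def by (intro continuous_intros)
    fix r assume r: "s < r" "r < t"
    have "((\<lambda>r. integral {s..r} u) has_real_derivative u r) (at r within {s..t})"
      using u r by (intro integral_has_real_derivative) auto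
    hence "((\<lambda>r. integral {s..r} u) has_real_derivative u r) (at r)"
      using r by (simp add: at_within_Icc_at)
    hence "((\<lambda>r. I r * exp (- K * (r - s))) has_real_derivative
      (K * u r) * exp (- K * (r - s)) + I r * (exp (- K * (r - s)) * (- K))) (at r)"
      unfolding I_def by (auto intro!: derivative_eq_intros)
    moreover have "(K * u r) * exp (- K * (r - s)) + I r * (exp (- K * (r - s)) * (- K)) \<le> 0"
    proof -
      have "K * (u r - I r) * exp (- K * (r - s)) \<le> 0"
        using le[of r] r K by (intro mult_nonpos_nonneg mult_nonneg_nonpos) (auto simp: I_def)
      thus ?thesis by (simp add: algebra_simps)
    qed
    ultimately show "\<exists>y. ((\<lambda>r. I r * exp (- K * (r - s))) has_real_derivative y) (at r) \<and> y \<le> 0" by blast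
  qed
  hence "I t * exp (- K * (t - s)) * exp (K * (t - s)) \<le> a * exp (K * (t - s))"
    by (intro mult_right_mono) (auto simp: I_def)
  hence "I t \<le> a * exp (K * (t - s))"
    by (simp add: mult.assoc exp_add[symmetric])
  thus ?thesis using le[of t] st by (simp add: I_def)
qed

text \<open>A continuation argument: the one-sided estimate is available only while the difference
  is at most 1, and \<open>small\<close> makes the resulting Gronwall bound less than 1, so the
  difference can never reach 1. \<open>B\<close> is a defect that allows comparison with a function
  that is not a solution: it is 0 for two solutions and nonzero for a constant.\<close>

lemma primitive_on_stability:
  assumes v: "primitive_on s t v G" and y: "primitive_on s t y H" and st: "s \<le> t" and C: "0 \<le> C"
    and B: "set_integrable lebesgue {s..t} B" "\<And>r. 0 \<le> B r"
    and ae: "AE r in lebesgue. r \<in> {s..t} \<longrightarrow> norm (v r - y r) \<le> 1 \<longrightarrow>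
               (v r - y r) \<bullet> (G r - H r) \<le> C * (norm (v r - y r))\<^sup>2 + B r"
    and small: "((norm (v s - y s))\<^sup>2 + 2 * (LINT r:{s..t}|lebesgue. B r)) * exp (2 * C * (t - s)) < 1"
  shows "(norm (v t - y t))\<^sup>2 \<le> ((norm (v s - y s))\<^sup>2 + 2 * (LINT r:{s..t}|lebesgue. B r)) * exp (2 * C * (t - s))"
proof -
  define w where "w r = v r - y r" for r
  define D where "D r = G r - H r" for r
  define a where "a = (norm (w s))\<^sup>2 + 2 * (LINT r:{s..t}|lebesgue. B r)"
  have IB: "0 \<le> (LINT r:{s..t}|lebesgue. B r)"
    using B(2) by (simp add: set_lebesgue_integral_def)
  hence a0: "0 \<le> a" by (simp add: a_def)
  have w: "primitive_on s t w D"
    unfolding w_def[abs_def] D_def[abs_def] by (rule primitive_on_diff[OF v y])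
  have wc: "continuous_on {s..t} w" using w by (simp add: primitive_on_def)
  have nc: "continuous_on {s..t} (\<lambda>r. norm (w r))" using wc by (intro continuous_intros)
  have a1: "a * exp (2 * C * (t - s)) < 1" using small by (simp add: a_def w_def)
  \<comment> \<open>Gronwall under the a priori bound \<open>norm (w r) \<le> 1\<close>; the rest of
    the proof removes that bound.\<close>
  have key: "(norm (w t'))\<^sup>2 \<le> a * exp (2 * C * (t - s))"
    if t': "s \<le> t'" "t' \<le> t" and le1: "\<And>r. r \<in> {s..t'} \<Longrightarrow> norm (w r) \<le> 1" for t'
  proof -
    have "(norm (w t'))\<^sup>2 \<le> a * exp (2 * C * (t' - s))"
    proof (rule gronwall)
      show c2: "continuous_on {s..t'} (\<lambda>r. (norm (w r))\<^sup>2)"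
        using continuous_on_subset[OF wc, of "{s..t'}"] t' by (intro continuous_intros) auto
      show "0 \<le> 2 * C" "s \<le> t'" using C t' by auto
      fix r assume r: "r \<in> {s..t'}"
      have p: "primitive_on s r w D" using primitive_on_subinterval[OF w] r t' by auto
      have cr: "continuous_on {s..r} (\<lambda>r. (norm (w r))\<^sup>2)"
        using continuous_on_subset[OF c2, of "{s..r}"] r by auto
      have i1: "set_integrable lebesgue {s..r} (\<lambda>r. (norm (w r))\<^sup>2)"
        using cr by (rule absolutely_integrable_continuous_real)
      have i2: "set_integrable lebesgue {s..r} B"
        using set_integrable_subset[OF B(1), of "{s..r}"] r t' by auto
      have sub: "{s<..r} \<subseteq> {s..r}" by auto
      have "(norm (w r))\<^sup>2 \<le> (norm (w s))\<^sup>2 + 2 * (LINT x:{s<..r}|lebesgue. w x \<bullet> D x)"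
        using r by (intro primitive_on_norm_square_le[OF p]) auto
      moreover have "(LINT x:{s<..r}|lebesgue. w x \<bullet> D x) \<le> (LINT x:{s<..r}|lebesgue. C * (norm (w x))\<^sup>2 + B x)"
        unfolding set_lebesgue_integral_def
      proof (rule integral_mono_AE)
        show "integrable lebesgue (\<lambda>x. indicator {s<..r} x *\<^sub>R (w x \<bullet> D x))"
          using set_integrable_subset[OF set_integrable_continuous_inner _ sub, of D w] p
          by (auto simp: primitive_on_def set_integrable_def)
        show "integrable lebesgue (\<lambda>x. indicator {s<..r} x *\<^sub>R (C * (norm (w x))\<^sup>2 + B x))"
          using set_integrable_subset[OF i1 _ sub] set_integrable_subset[OF i2 _ sub]
          unfolding set_integrable_def[symmetric] by (intro set_integral_add(1)) auto
        show "AE x in lebesgue. indicator {s<..r} x *\<^sub>R (w x \<bullet> D x) \<le> indicator {s<..r} x *\<^sub>R (C * (norm (w x))\<^sup>2 + B x)"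
          using ae
        proof eventually_elim
          case (elim x)
          thus ?case using le1[of x] r t' by (auto simp: indicator_def w_def D_def)
        qed
      qed
      moreover have "(LINT x:{s<..r}|lebesgue. C * (norm (w x))\<^sup>2 + B x) = C * (LINT x:{s<..r}|lebesgue. (norm (w x))\<^sup>2) + (LINT x:{s<..r}|lebesgue. B x)"
        using set_integrable_subset[OF i1 _ sub] set_integrable_subset[OF i2 _ sub]
        by (subst set_integral_add(2)) auto
      moreover have "(LINT x:{s<..r}|lebesgue. B x) \<le> (LINT x:{s..t}|lebesgue. B x)"
        using r t' B set_integrable_subset[OF i2 _ sub] unfolding set_lebesgue_integral_def set_integrable_def
        by (intro integral_mono) (auto simp: indicator_def)
      moreover have "C * (LINT x:{s<..r}|lebesgue. (norm (w x))\<^sup>2) \<le> C * integral {s..r} (\<lambda>x. (norm (w x))\<^sup>2)"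
      proof (rule mult_left_mono[OF _ C])
        have "(LINT x:{s<..r}|lebesgue. (norm (w x))\<^sup>2) \<le> (LINT x:{s..r}|lebesgue. (norm (w x))\<^sup>2)"
        using i1 set_integrable_subset[OF i1 _ sub] unfolding set_lebesgue_integral_def set_integrable_def
        by (intro integral_mono) (auto simp: indicator_def)
        also have "\<dots> = integral {s..r} (\<lambda>x. (norm (w x))\<^sup>2)"
          using i1 by (rule set_lebesgue_integral_eq_integral(2))
        finally show "(LINT x:{s<..r}|lebesgue. (norm (w x))\<^sup>2) \<le> integral {s..r} (\<lambda>x. (norm (w x))\<^sup>2)" .
      qed
      ultimately show "(norm (w r))\<^sup>2 \<le> a + 2 * C * integral {s..r} (\<lambda>x. (norm (w x))\<^sup>2)"
        unfolding a_def by linarith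
    qed
    also have "\<dots> \<le> a * exp (2 * C * (t - s))"
      using a0 C t' by (intro mult_left_mono) (auto intro!: mult_left_mono)
    finally show ?thesis .
  qed
  have s1: "norm (w s) < 1"
  proof -
    have "1 \<le> exp (2 * C * (t - s))" using C st by simp
    hence "a * 1 \<le> a * exp (2 * C * (t - s))" using a0 by (intro mult_left_mono) auto
    hence "(norm (w s))\<^sup>2 < 1" using a1 IB a_def by linarith
    thus ?thesis by (simp add: abs_square_less_1)
  qed
  have ivt: "\<exists>x\<in>{s..r}. norm (w x) = 1" if r: "r \<in> {s..t}" "norm (w r) > 1" for r
  proof -
    have "continuous_on {s..r} (\<lambda>x. norm (w x))" using continuous_on_subset[OF nc, of "{s..r}"] r by auto
    from IVT'[of "\<lambda>x. norm (w x)" s 1 r, OF _ _ _ this] s1 r show ?thesis by auto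
  qed
  have no: "norm (w r) \<noteq> 1" if r: "r \<in> {s..t}" for r
  proof
    assume r1: "norm (w r) = 1"
    \<comment> \<open>The first time \<open>m\<close> at which the norm equals 1. A larger value
      before \<open>m\<close> would, by the intermediate value theorem, give an earlier such time;
      so \<open>key\<close> applies up to \<open>m\<close> and contradicts
      \<open>a1\<close>.\<close>
    define S where "S = {x\<in>{s..t}. norm (w x) = 1}"
    have "closed S" unfolding S_def using nc by (intro continuous_closed_preimage_constant) auto
    moreover have "S \<subseteq> {s..t}" by (auto simp: S_def)
    ultimately have "compact S" using compact_Icc compact_Int_closed[of "{s..t}" S] by (simp add: Int_absorb1)
    moreover have "S \<noteq> {}" using r r1 by (auto simp: S_def)
    ultimately obtain m where m: "m \<in> S" "\<And>x. x \<in> S \<Longrightarrow> m \<le> x" by (meson compact_attains_inf)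
    have "norm (w x) \<le> 1" if x: "x \<in> {s..m}" for x
    proof (rule ccontr)
      assume "\<not> norm (w x) \<le> 1"
      moreover have "x \<in> {s..t}" using x m(1) by (auto simp: S_def)
      ultimately obtain x' where "x' \<in> {s..x}" "norm (w x') = 1" using ivt[of x] by auto
      moreover from this have "x' \<in> S" using \<open>x \<in> {s..t}\<close> by (auto simp: S_def)
      ultimately have "x' = m" "x' \<le> x" using m(2)[of x'] x by auto
      hence "x = m" using x by auto
      thus False using m(1) \<open>\<not> norm (w x) \<le> 1\<close> by (simp add: S_def)
    qed
    hence "(norm (w m))\<^sup>2 \<le> a * exp (2 * C * (t - s))" using m(1) by (intro key) (auto simp: S_def)
    thus False using a1 m(1) by (simp add: S_def)
  qed
  have "norm (w r) \<le> 1" if r: "r \<in> {s..t}" for r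
  proof (rule ccontr)
    assume "\<not> norm (w r) \<le> 1"
    then obtain x where "x \<in> {s..r}" "norm (w x) = 1" using ivt[of r] r by auto
    thus False using no[of x] r by auto
  qed
  hence "(norm (w t))\<^sup>2 \<le> a * exp (2 * C * (t - s))" using st by (intro key) auto
  thus ?thesis by (simp add: a_def w_def)
qed

lemma global_solution_primitive_on:
  assumes sol: "global_solution F \<tau> x v" and s: "\<tau> \<le> s"
  shows "primitive_on s t v (\<lambda>r. F r (v r))"
proof -
  have int: "set_integrable lebesgue {\<tau>..r} (\<lambda>r. F r (v r))"
    and eq: "v r = x + (LINT s:{\<tau>..r}|lebesgue. F s (v s))" if "\<tau> \<le> r" for r
    using sol that by (auto simp: global_solution_def)
  have "v r' - v r = (LINT x:{r<..r'}|lebesgue. F x (v x))" if r: "s \<le> r" "r \<le> r'" for r r'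
  proof -
    have un: "{\<tau>..r'} = {\<tau>..r} \<union> {r<..r'}" using r s by auto
    have i: "set_integrable lebesgue {r<..r'} (\<lambda>r. F r (v r))"
    proof (rule set_integrable_subset)
      show "set_integrable lebesgue {\<tau>..r'} (\<lambda>r. F r (v r))" using r s by (intro int) auto
      show "{r<..r'} \<subseteq> {\<tau>..r'}" using r s by auto
    qed simp
    have "(LINT x:{\<tau>..r'}|lebesgue. F x (v x)) = (LINT x:{\<tau>..r}|lebesgue. F x (v x)) + (LINT x:{r<..r'}|lebesgue. F x (v x))"
      unfolding un using i int[of r] r s by (intro set_integral_Un) auto
    thus ?thesis using eq[of r] eq[of r'] r s by simp
  qed
  moreover have "set_integrable lebesgue {s..t} (\<lambda>r. F r (v r))"
    using set_integrable_subset[OF int[of "max s t"], of "{s..t}"] s by auto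
  moreover have "continuous_on {s..t} v"
    using sol s by (auto simp: global_solution_def intro: continuous_on_subset)
  ultimately show ?thesis by (simp add: primitive_on_def)
qed

lemma global_solution_init: "global_solution F \<tau> x v \<Longrightarrow> v \<tau> = x"
proof -
  assume "global_solution F \<tau> x v"
  hence "v \<tau> = x + (LINT s:{\<tau>..\<tau>}|lebesgue. F s (v s))" by (simp add: global_solution_def)
  also have "(LINT s:{\<tau>..\<tau>}|lebesgue. F s (v s)) = 0"
    unfolding set_lebesgue_integral_def
    by (intro integral_eq_zero_AE AE_I'[of "{\<tau>}"]) (auto simp: indicator_def)
  finally show ?thesis by simp
qed

section \<open>Coefficient estimates: integrable norms, growth and one-sided Lipschitz
  bounds\<close>

lemma seq_to_ell2: "x \<in> lp_seq 2 \<Longrightarrow> seq (to_ell2 x) = x"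
  by (simp add: to_ell2_def Abs_ell2_inverse)

lemma to_ell2_seq: "to_ell2 (seq u) = u"
  by (simp add: to_ell2_def seq_mem seq_inverse)

lemma norm_to_ell2: "x \<in> lp_seq 2 \<Longrightarrow> norm (to_ell2 x) = lp_norm 2 x"
  by (simp add: norm_ell2_eq_lp_norm seq_to_ell2)

text \<open>The approximation by simple functions is known only at almost every time, and elsewhere
  \<open>to_ell2\<close> may return the default 0. The norm therefore agrees almost everywhere with
  a limit of measurable functions, which is enough for the complete measure
  \<open>lebesgue\<close>.\<close>

lemma strongly_measurable_norm_measurable:
  assumes sm: "strongly_measurable_on UNIV (lp_seq 2) (lp_norm 2) \<psi>"
  shows "(\<lambda>t. norm (to_ell2 (\<psi> t))) \<in> borel_measurable lebesgue"
proof -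
  obtain s where s: "\<And>n. simple_function lebesgue (s n)" "\<And>n. range (s n) \<subseteq> lp_seq 2"
    "AE t in lebesgue. \<psi> t \<in> lp_seq 2 \<and> (\<lambda>n. lp_norm 2 (\<lambda>i. \<psi> t i - s n t i)) \<longlonglongrightarrow> 0"
    using sm unfolding strongly_measurable_on_def by auto
  have m: "(\<lambda>t. norm (to_ell2 (s n t))) \<in> borel_measurable lebesgue" for n
  proof -
    have "simple_function lebesgue ((\<lambda>x. norm (to_ell2 x)) \<circ> s n)"
      by (rule simple_function_compose[OF s(1)])
    thus ?thesis by (auto simp: o_def dest: borel_measurable_simple_function)
  qed
  show ?thesis
  proof (rule borel_measurable_AE)
    show "(\<lambda>t. lim (\<lambda>n. norm (to_ell2 (s n t)))) \<in> borel_measurable lebesgue"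
      by (rule borel_measurable_lim_metric[OF m])
    show "AE t in lebesgue. lim (\<lambda>n. norm (to_ell2 (s n t))) = norm (to_ell2 (\<psi> t))"
      using s(3)
    proof eventually_elim
      case (elim t)
      have d: "norm (to_ell2 (\<psi> t) - to_ell2 (s n t)) = lp_norm 2 (\<lambda>i. \<psi> t i - s n t i)" for n
      proof -
        have "s n t \<in> lp_seq 2" using s(2)[of n] by auto
        thus ?thesis using elim by (simp add: norm_ell2_eq_lp_norm minus_ell2.rep_eq seq_to_ell2)
      qed
      have "(\<lambda>n. to_ell2 (\<psi> t) - to_ell2 (s n t)) \<longlonglongrightarrow> 0"
        by (rule tendsto_norm_zero_cancel) (use elim d in simp)
      from tendsto_diff[OF tendsto_const[of "to_ell2 (\<psi> t)"] this]
      have "(\<lambda>n. to_ell2 (s n t)) \<longlonglongrightarrow> to_ell2 (\<psi> t)" by simp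
      thus ?case by (intro limI tendsto_norm)
    qed
  qed
qed

text \<open>Square integrability yields integrability on bounded intervals through
  \<open>N \<le> 1 + N^2\<close>. This supplies the integrable majorants for the terms with
  \<open>\<psi>4\<close> and \<open>h'\<close>.\<close>

lemma Lp_loc_2_norm_integrable:
  assumes L: "Lp_loc 2 (lp_seq 2) (lp_norm 2) \<psi>"
  shows "set_integrable lebesgue {a..b} (\<lambda>t. norm (to_ell2 (\<psi> t)))"
proof -
  have sm: "strongly_measurable_on UNIV (lp_seq 2) (lp_norm 2) \<psi>"
    and fin: "(\<integral>\<^sup>+t\<in>{a..b}. ennreal (lp_norm 2 (\<psi> t) powr 2) \<partial>lebesgue) < \<infinity>"
    using L by (auto simp: Lp_loc_def)
  have mem: "AE t in lebesgue. \<psi> t \<in> lp_seq 2"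
    using sm by (auto simp: strongly_measurable_on_def elim: AE_mp)
  let ?N = "\<lambda>t. norm (to_ell2 (\<psi> t))"
  note m = strongly_measurable_norm_measurable[OF sm]
  have "(\<integral>\<^sup>+t\<in>{a..b}. ennreal (?N t) \<partial>lebesgue) \<le> (\<integral>\<^sup>+t\<in>{a..b}. (1 + ennreal ((?N t)\<^sup>2)) \<partial>lebesgue)"
  proof (intro nn_integral_mono mult_right_mono)
    fix t
    have "?N t \<le> 1 + (?N t)\<^sup>2"
      using sum_squares_bound[of 1 "?N t"] norm_ge_zero[of "to_ell2 (\<psi> t)"]
      by (simp only: power_one mult_1_right)
    hence "ennreal (?N t) \<le> ennreal (1 + (?N t)\<^sup>2)" by (rule ennreal_leI)
    thus "ennreal (?N t) \<le> 1 + ennreal ((?N t)\<^sup>2)" by simp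
  qed simp
  also have "\<dots> = (\<integral>\<^sup>+t\<in>{a..b}. 1 \<partial>lebesgue) + (\<integral>\<^sup>+t\<in>{a..b}. ennreal ((?N t)\<^sup>2) \<partial>lebesgue)"
  proof -
    have m2: "(\<lambda>t. ennreal ((?N t)\<^sup>2)) \<in> borel_measurable lebesgue" using m by measurable
    have "(\<lambda>t. indicator {a..b} t :: ennreal) \<in> borel_measurable lebesgue" by (rule borel_measurable_indicator) simp
    with m2 show ?thesis
      by (subst nn_integral_add[symmetric]) (auto simp: distrib_right intro!: borel_measurable_times_ennreal)
  qed
  also have "(\<integral>\<^sup>+t\<in>{a..b}. ennreal ((?N t)\<^sup>2) \<partial>lebesgue) = (\<integral>\<^sup>+t\<in>{a..b}. ennreal (lp_norm 2 (\<psi> t) powr 2) \<partial>lebesgue)"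
  proof (rule nn_integral_cong_AE)
    show "AE t in lebesgue. ennreal ((?N t)\<^sup>2) * indicator {a..b} t = ennreal (lp_norm 2 (\<psi> t) powr 2) * indicator {a..b} t"
      using mem
    proof eventually_elim
      case (elim t)
      have "0 \<le> lp_norm 2 (\<psi> t)" by (simp add: norm_to_ell2[OF elim, symmetric])
      thus ?case by (simp add: norm_to_ell2[OF elim])
    qed
  qed
  also have "(\<integral>\<^sup>+t\<in>{a..b}. 1 \<partial>lebesgue) + (\<integral>\<^sup>+t\<in>{a..b}. ennreal (lp_norm 2 (\<psi> t) powr 2) \<partial>lebesgue) < \<infinity>"
    using fin emeasure_lborel_Icc_eq[of a b] by (simp add: ennreal_add_less_top)
  finally have f: "(\<integral>\<^sup>+t\<in>{a..b}. ennreal (?N t) \<partial>lebesgue) < \<infinity>" .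
  show ?thesis
    unfolding set_integrable_def
  proof (rule integrableI_bounded)
    show "(\<lambda>t. indicator {a..b} t *\<^sub>R ?N t) \<in> borel_measurable lebesgue"
      using m by (intro borel_measurable_scaleR borel_measurable_indicator) auto
    have "(\<integral>\<^sup>+ t. ennreal (norm (indicator {a..b} t *\<^sub>R ?N t)) \<partial>lebesgue) = (\<integral>\<^sup>+t\<in>{a..b}. ennreal (?N t) \<partial>lebesgue)"
      by (intro nn_integral_cong) (auto simp: indicator_def)
    thus "(\<integral>\<^sup>+ t. ennreal (norm (indicator {a..b} t *\<^sub>R ?N t)) \<partial>lebesgue) < \<infinity>" using f by simp
  qed
qed

lemma linf_norm_upper: "x \<in> linf_seq \<Longrightarrow> \<bar>x i\<bar> \<le> linf_norm x"
proof -
  assume "x \<in> linf_seq"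
  then obtain B where "\<And>i. \<bar>x i\<bar> \<le> B" by (auto simp: linf_seq_def bounded_iff)
  hence "bdd_above (range (\<lambda>i. \<bar>x i\<bar>))" by (auto intro!: bdd_aboveI)
  thus ?thesis unfolding linf_norm_def by (intro cSUP_upper) auto
qed

lemma Linf_loc_bound:
  assumes "Linf_loc linf_seq linf_norm \<psi>"
  obtains M where "M \<ge> 0" "AE t in lebesgue. t \<in> {a..b} \<longrightarrow> (\<forall>i. \<bar>\<psi> t i\<bar> \<le> M)"
proof -
  have L: "Linf_on {a..b} linf_seq linf_norm \<psi>" using assms by (simp add: Linf_loc_def)
  hence mem: "AE t in lebesgue. t \<in> {a..b} \<longrightarrow> \<psi> t \<in> linf_seq"
    by (auto simp: Linf_on_def strongly_measurable_on_def elim: AE_mp)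
  obtain M where "AE t in lebesgue. t \<in> {a..b} \<longrightarrow> linf_norm (\<psi> t) \<le> M"
    using L by (auto simp: Linf_on_def)
  with mem have "AE t in lebesgue. t \<in> {a..b} \<longrightarrow> (\<forall>i. \<bar>\<psi> t i\<bar> \<le> max M 0)"
    by eventually_elim (meson linf_norm_upper order_trans max.coboundedI1)
  thus thesis using that[of "max M 0"] by simp
qed

lemma ell2_norm_comparison:
  fixes u a b :: ell2
  assumes "\<And>i. \<bar>seq u i\<bar> \<le> \<bar>seq a i\<bar> + \<bar>seq b i\<bar>"
  shows "norm u \<le> 2 * (norm a + norm b)"
proof (rule ell2_norm_le)
  fix F :: "int set" assume F: "finite F"
  have "(\<Sum>i\<in>F. (seq u i)\<^sup>2) \<le> (\<Sum>i\<in>F. 2 * (seq a i)\<^sup>2 + 2 * (seq b i)\<^sup>2)"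
  proof (rule sum_mono)
    fix i
    have "(seq u i)\<^sup>2 \<le> (\<bar>seq a i\<bar> + \<bar>seq b i\<bar>)\<^sup>2" using assms[of i] by (intro power2_le_iff_abs_le[THEN iffD2]) auto
    also have "\<dots> \<le> 2 * (seq a i)\<^sup>2 + 2 * (seq b i)\<^sup>2"
      using sum_squares_bound[of "\<bar>seq a i\<bar>" "\<bar>seq b i\<bar>"] by (simp add: power2_sum)
    finally show "(seq u i)\<^sup>2 \<le> 2 * (seq a i)\<^sup>2 + 2 * (seq b i)\<^sup>2" .
  qed
  also have "\<dots> \<le> 2 * (norm a)\<^sup>2 + 2 * (norm b)\<^sup>2"
    unfolding sum.distrib sum_distrib_left[symmetric]
    by (intro add_mono mult_left_mono sum_seq_le_norm F) auto
  also have "\<dots> \<le> (2 * (norm a + norm b))\<^sup>2"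
    by (simp add: power_mult_distrib power2_sum)
  finally show "(\<Sum>i\<in>F. (seq u i)\<^sup>2) \<le> (2 * (norm a + norm b))\<^sup>2" .
qed simp

text \<open>All coordinates of an element of the ball of radius \<open>R\<close> are bounded by
  \<open>R\<close>, so the scalar constant \<open>\<gamma> R\<close> serves every index and is
  uniform on the whole ball.\<close>

lemma nemytskii_f_lipschitz:
  assumes F: "cond_F q \<epsilon> \<alpha>1 \<alpha>2 \<gamma> f" and p: "norm p \<le> R" and r: "norm r \<le> R"
  shows "norm (nemytskii f p - nemytskii f r) \<le> \<gamma> R * norm (p - r)"
proof (rule ell2_norm_le)
  have R: "0 \<le> R" using norm_ge_zero p by (rule order_trans)
  hence \<gamma>: "0 \<le> \<gamma> R" using F by (simp add: cond_F_def)
  thus "0 \<le> \<gamma> R * norm (p - r)" by simp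
  fix I :: "int set" assume I: "finite I"
  have s: "seq (nemytskii f u) = (\<lambda>i. f i (seq u i))" for u
    using F by (simp add: nemytskii_def seq_to_ell2 cond_F_def)
  have lip: "\<bar>f i (seq p i) - f i (seq r i)\<bar> \<le> \<gamma> R * \<bar>seq p i - seq r i\<bar>" for i
    using F abs_seq_le_norm[of p i] abs_seq_le_norm[of r i] p r unfolding cond_F_def
    by (meson order_trans)
  have "(\<Sum>i\<in>I. (seq (nemytskii f p - nemytskii f r) i)\<^sup>2) \<le> (\<Sum>i\<in>I. (\<gamma> R)\<^sup>2 * (seq (p - r) i)\<^sup>2)"
  proof (rule sum_mono)
    fix i
    have "(f i (seq p i) - f i (seq r i))\<^sup>2 \<le> (\<gamma> R * \<bar>seq p i - seq r i\<bar>)\<^sup>2"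
      using lip[of i] \<gamma> by (intro power2_le_iff_abs_le[THEN iffD2]) auto
    thus "(seq (nemytskii f p - nemytskii f r) i)\<^sup>2 \<le> (\<gamma> R)\<^sup>2 * (seq (p - r) i)\<^sup>2"
      by (simp add: minus_ell2.rep_eq s power_mult_distrib)
  qed
  also have "\<dots> \<le> (\<gamma> R)\<^sup>2 * (norm (p - r))\<^sup>2"
    unfolding sum_distrib_left[symmetric] by (intro mult_left_mono sum_seq_le_norm I) auto
  finally show "(\<Sum>i\<in>I. (seq (nemytskii f p - nemytskii f r) i)\<^sup>2) \<le> (\<gamma> R * norm (p - r))\<^sup>2"
    by (simp add: power_mult_distrib)
qed

text \<open>Since \<open>q > 2\<close>, the growth \<open>\<bar>a\<bar>\<^sup>q\<^sup>-\<^sup>1\<close> is linear on bounded sets, so \<open>g\<close> acts on square summable sequences.\<close>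
lemma nemytskii_g_growth:
  assumes G: "cond_G1 q \<beta> \<psi>1 \<psi>2 \<psi>3 \<psi>4 g" and q: "q > 2"
    and \<psi>3: "\<And>i. \<bar>\<psi>3 t i\<bar> \<le> M" and M: "0 \<le> M" and \<psi>4: "\<psi>4 t \<in> lp_seq 2" and p: "norm p \<le> R"
  shows "(\<lambda>i. g i t (seq p i)) \<in> lp_seq 2"
    and "norm (nemytskii (\<lambda>i. g i t) p) \<le> 2 * (M * R powr (q - 2) * norm p + norm (to_ell2 (\<psi>4 t)))"
proof -
  define c where "c = M * R powr (q - 2)"
  have R: "0 \<le> R" using norm_ge_zero p by (rule order_trans)
  have c0: "0 \<le> c" using M by (simp add: c_def)
  have le: "\<bar>g i t (seq p i)\<bar> \<le> c * \<bar>seq p i\<bar> + \<bar>\<psi>4 t i\<bar>" for i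
  proof -
    have "\<bar>g i t (seq p i)\<bar> \<le> \<psi>3 t i * \<bar>seq p i\<bar> powr (q - 1) + \<psi>4 t i"
      using G by (simp add: cond_G1_def)
    also have "\<psi>3 t i * \<bar>seq p i\<bar> powr (q - 1) \<le> M * \<bar>seq p i\<bar> powr (q - 1)"
      using \<psi>3[of i] by (intro mult_right_mono) auto
    also have "\<bar>seq p i\<bar> powr (q - 1) = \<bar>seq p i\<bar> * \<bar>seq p i\<bar> powr (q - 2)"
      by (simp add: powr_mult_base)
    also have "M * (\<bar>seq p i\<bar> * \<bar>seq p i\<bar> powr (q - 2)) \<le> M * (\<bar>seq p i\<bar> * R powr (q - 2))"
      using abs_seq_le_norm[of p i] p q M by (intro mult_left_mono powr_mono2) auto
    finally show ?thesis by (simp add: c_def algebra_simps)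
  qed
  have sq: "(g i t (seq p i))\<^sup>2 \<le> 2 * (c\<^sup>2 * (seq p i)\<^sup>2) + 2 * (\<psi>4 t i)\<^sup>2" for i
  proof -
    have "(g i t (seq p i))\<^sup>2 \<le> (c * \<bar>seq p i\<bar> + \<bar>\<psi>4 t i\<bar>)\<^sup>2"
      using le[of i] by (intro power2_le_iff_abs_le[THEN iffD2]) auto
    also have "\<dots> \<le> 2 * (c * \<bar>seq p i\<bar>)\<^sup>2 + 2 * \<bar>\<psi>4 t i\<bar>\<^sup>2"
      using sum_squares_bound[of "c * \<bar>seq p i\<bar>" "\<bar>\<psi>4 t i\<bar>"] by (simp only: power2_sum)
    finally show ?thesis by (simp add: power_mult_distrib)
  qed
  have "(\<lambda>i. 2 * (c\<^sup>2 * (seq p i)\<^sup>2) + 2 * (\<psi>4 t i)\<^sup>2) summable_on UNIV"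
    using \<psi>4 seq_mem[of p] by (intro summable_on_add summable_on_cmult_right) (auto simp: mem_lp_seq_2)
  hence "(\<lambda>i. (g i t (seq p i))\<^sup>2) summable_on UNIV"
    by (rule summable_on_comparison_test) (auto simp: sq)
  thus mem: "(\<lambda>i. g i t (seq p i)) \<in> lp_seq 2" by (simp add: mem_lp_seq_2)
  have "norm (nemytskii (\<lambda>i. g i t) p) \<le> 2 * (norm (c *\<^sub>R p) + norm (to_ell2 (\<psi>4 t)))"
    by (rule ell2_norm_comparison)
       (use le c0 in \<open>simp add: nemytskii_def seq_to_ell2[OF mem] seq_to_ell2[OF \<psi>4] scaleR_ell2.rep_eq abs_mult\<close>)
  thus "norm (nemytskii (\<lambda>i. g i t) p) \<le> 2 * (M * R powr (q - 2) * norm p + norm (to_ell2 (\<psi>4 t)))"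
    using c0 by (simp add: c_def)
qed

lemma deriv_bound_one_sided:
  fixes k :: "real \<Rightarrow> real"
  assumes d: "\<And>a. k differentiable (at a)" and le: "\<And>a. deriv k a \<le> M"
  shows "(k a - k b) * (a - b) \<le> M * (a - b)\<^sup>2"
proof -
  have lt: "(k y - k x) * (y - x) \<le> M * (y - x)\<^sup>2" if "x < y" for x y
  proof -
    have "continuous_on {x..y} k"
      using d by (intro differentiable_imp_continuous_on) (auto simp: differentiable_on_def intro: differentiable_at_withinI)
    then obtain l z where l: "DERIV k z :> l" "k y - k x = (y - x) * l"
      using MVT[OF \<open>x < y\<close>, of k] d by blast
    have "l \<le> M" using le[of z] DERIV_imp_deriv[OF l(1)] by simp
    hence "(y - x)\<^sup>2 * l \<le> (y - x)\<^sup>2 * M" by (intro mult_left_mono) auto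
    thus ?thesis by (simp add: l(2) power2_eq_square algebra_simps)
  qed
  show ?thesis
    using lt[of b a] lt[of a b] by (cases a b rule: linorder_cases) (auto simp: power2_commute algebra_simps)
qed

text \<open>An upper bound on the derivative controls only the inner product with the difference,
  not the norm of the increment. Membership of both image sequences is demanded because
  \<open>nemytskii\<close> would otherwise return 0.\<close>

lemma nemytskii_g_one_sided:
  assumes G: "cond_G1 q \<beta> \<psi>1 \<psi>2 \<psi>3 \<psi>4 g"
    and \<psi>2: "\<And>i. \<bar>\<psi>2 t i\<bar> \<le> M"
    and p: "(\<lambda>i. g i t (seq p i)) \<in> lp_seq 2" and r: "(\<lambda>i. g i t (seq r i)) \<in> lp_seq 2"
  shows "(p - r) \<bullet> (nemytskii (\<lambda>i. g i t) p - nemytskii (\<lambda>i. g i t) r) \<le> M * (norm (p - r))\<^sup>2"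
proof -
  have s: "seq (nemytskii (\<lambda>i. g i t) p - nemytskii (\<lambda>i. g i t) r) i = g i t (seq p i) - g i t (seq r i)" for i
    using p r by (simp add: nemytskii_def seq_to_ell2 minus_ell2.rep_eq)
  have "(p - r) \<bullet> (nemytskii (\<lambda>i. g i t) p - nemytskii (\<lambda>i. g i t) r) \<le> (\<Sum>\<^sub>\<infinity>i. M * (seq (p - r) i)\<^sup>2)"
    unfolding inner_ell2_def
  proof (rule infsum_mono)
    show "(\<lambda>i. seq (p - r) i * seq (nemytskii (\<lambda>i. g i t) p - nemytskii (\<lambda>i. g i t) r) i) summable_on UNIV"
      by (rule lp_seq_2_mult_summable[OF seq_mem seq_mem])
    show "(\<lambda>i. M * (seq (p - r) i)\<^sup>2) summable_on UNIV"
      using seq_mem[of "p - r"] by (intro summable_on_cmult_right) (simp add: mem_lp_seq_2)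
    fix i
    have "(g i t (seq p i) - g i t (seq r i)) * (seq p i - seq r i) \<le> M * (seq p i - seq r i)\<^sup>2"
    proof (rule deriv_bound_one_sided)
      show "(\<lambda>b. g i t b) differentiable (at a)" for a using G by (simp add: cond_G1_def)
      show "deriv (\<lambda>b. g i t b) a \<le> M" for a
      proof -
        have "deriv (\<lambda>b. g i t b) a \<le> \<psi>2 t i" using G unfolding cond_G1_def by blast
        thus ?thesis using \<psi>2[of i] by simp
      qed
    qed
    thus "seq (p - r) i * seq (nemytskii (\<lambda>i. g i t) p - nemytskii (\<lambda>i. g i t) r) i \<le> M * (seq (p - r) i)\<^sup>2"
      unfolding s by (simp add: minus_ell2.rep_eq mult.commute)
  qed
  also have "\<dots> = M * (norm (p - r))\<^sup>2"
    unfolding norm_ell2_sq using seq_mem[of "p - r"] by (intro infsum_cmult_right) (simp add: mem_lp_seq_2)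
  finally show ?thesis .
qed

lemma continuous_bounded_Icc:
  fixes k :: "real \<Rightarrow> 'a::real_normed_vector"
  assumes "continuous_on UNIV k"
  shows "\<exists>M\<ge>0. \<forall>t\<in>{a..b}. norm (k t) \<le> M"
proof -
  have "compact (k ` {a..b})"
    using assms compact_Icc compact_continuous_image continuous_on_subset by blast
  then obtain M where "\<forall>x\<in>k ` {a..b}. norm x \<le> M" using compact_imp_bounded bounded_iff by metis
  thus ?thesis by (intro exI[of _ "max M 0"]) (auto simp: le_max_iff_disj)
qed

lemma cond_H1_continuous: "cond_H1 q h h' \<Longrightarrow> continuous_on UNIV h"
  unfolding cond_H1_def by (meson continuous_at_imp_continuous_on has_vector_derivative_continuous)

text \<open>The exceptional null set of times comes from the bounds on the \<open>\<psi>\<close>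
  functions alone and does not depend on \<open>x\<close> and \<open>y\<close>; hence the estimate
  may be used along solutions.\<close>

lemma rhs_one_sided_lipschitz:
  assumes F: "cond_F q \<epsilon> \<alpha>1 \<alpha>2 \<gamma> f" and G: "cond_G1 q \<beta> \<psi>1 \<psi>2 \<psi>3 \<psi>4 g" and H: "cond_H1 q h h'"
    and Z: "continuous_on UNIV (\<lambda>t. ou_z (\<theta> t \<omega>))"
  shows "\<exists>C\<ge>0. AE t in lebesgue. t \<in> {a..b} \<longrightarrow> (\<forall>x y. norm x \<le> R \<longrightarrow> norm y \<le> R \<longrightarrow>
           (x - y) \<bullet> (rhs lam f g h h' t \<omega> x - rhs lam f g h h' t \<omega> y) \<le> C * (norm (x - y))\<^sup>2)"
proof -
  have q: "q > 2" using F by (simp add: cond_F_def)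
  have "continuous_on UNIV (\<lambda>t. ou_z (\<theta> t \<omega>) *\<^sub>R h t)"
    by (intro continuous_intros Z cond_H1_continuous[OF H])
  from continuous_bounded_Icc[OF this, of a b]
  obtain B where B: "B \<ge> 0" "\<And>t. t \<in> {a..b} \<Longrightarrow> norm (ou_z (\<theta> t \<omega>) *\<^sub>R h t) \<le> B"
    by blast
  have L2: "Linf_loc linf_seq linf_norm \<psi>2" and L3: "Linf_loc linf_seq linf_norm \<psi>3"
    and L4: "Lp_loc 2 (lp_seq 2) (lp_norm 2) \<psi>4" using G by (auto simp: cond_G1_def)
  obtain M2 where M2: "M2 \<ge> 0" "AE t in lebesgue. t \<in> {a..b} \<longrightarrow> (\<forall>i. \<bar>\<psi>2 t i\<bar> \<le> M2)"
    by (rule Linf_loc_bound[OF L2])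
  obtain M3 where M3: "M3 \<ge> 0" "AE t in lebesgue. t \<in> {a..b} \<longrightarrow> (\<forall>i. \<bar>\<psi>3 t i\<bar> \<le> M3)"
    by (rule Linf_loc_bound[OF L3])
  have M4: "AE t in lebesgue. \<psi>4 t \<in> lp_seq 2"
    using L4 by (auto simp: Lp_loc_def strongly_measurable_on_def elim: AE_mp)
  \<comment> \<open>Radius containing the shifted arguments \<open>x + z h\<close> of the
    nonlinearities. The maximum with 0 covers negative \<open>R\<close>, as \<gamma> is nonnegative
    only on nonnegative arguments.\<close>
  define S where "S = max (R + B) 0"
  have \<gamma>: "0 \<le> \<gamma> S" using F by (simp add: cond_F_def S_def)
  \<comment> \<open>The summands bound the operator applied twice (\<open>5 * 5\<close>), the linear
    damping, the operator after \<open>f\<close>, and the one-sided bound for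
    \<open>g\<close>.\<close>
  define C where "C = 25 + \<bar>lam\<bar> + 5 * \<gamma> S + M2"
  have "AE t in lebesgue. t \<in> {a..b} \<longrightarrow> (\<forall>x y. norm x \<le> R \<longrightarrow> norm y \<le> R \<longrightarrow>
           (x - y) \<bullet> (rhs lam f g h h' t \<omega> x - rhs lam f g h h' t \<omega> y) \<le> C * (norm (x - y))\<^sup>2)"
    using M2(2) M3(2) M4
  proof eventually_elim
    case (elim t)
    show ?case
    proof (intro impI allI)
      fix x y :: ell2 assume t: "t \<in> {a..b}" and x: "norm x \<le> R" and y: "norm y \<le> R"
      define Y where "Y = ou_z (\<theta> t \<omega>) *\<^sub>R h t"
      have nY: "norm Y \<le> B" using B(2)[OF t] by (simp add: Y_def)
      have nx: "norm (x + Y) \<le> S" and ny: "norm (y + Y) \<le> S"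
        using norm_triangle_ineq[of x Y] norm_triangle_ineq[of y Y] nY x y by (auto simp: S_def)
      define w where "w = x - y"
      have w: "(x + Y) - (y + Y) = w" by (simp add: w_def)
      have split: "rhs lam f g h h' t \<omega> x - rhs lam f g h h' t \<omega> y =
        - opA (opA w) - lam *\<^sub>R w - opA (nemytskii f (x + Y) - nemytskii f (y + Y))
        + (nemytskii (\<lambda>i. g i t) (x + Y) - nemytskii (\<lambda>i. g i t) (y + Y))"
        unfolding rhs_def Y_def[symmetric] w_def opA_diff by (simp add: algebra_simps)
      have cs: "w \<bullet> u \<le> c * (norm w)\<^sup>2" if "norm u \<le> c * norm w" for u c
      proof -
        have "w \<bullet> u \<le> norm w * norm u" by (rule norm_cauchy_schwarz)
        also have "\<dots> \<le> norm w * (c * norm w)" using that by (intro mult_left_mono) auto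
        finally show ?thesis by (simp add: power2_eq_square algebra_simps)
      qed
      have 1: "w \<bullet> (- opA (opA w)) \<le> 25 * (norm w)\<^sup>2"
        using norm_opA_le[of w] norm_opA_le[of "opA w"] by (intro cs) simp
      have 2: "w \<bullet> (- (lam *\<^sub>R w)) \<le> \<bar>lam\<bar> * (norm w)\<^sup>2" by (rule cs) simp
      have 3: "w \<bullet> (- opA (nemytskii f (x + Y) - nemytskii f (y + Y))) \<le> 5 * \<gamma> S * (norm w)\<^sup>2"
        using norm_opA_le[of "nemytskii f (x + Y) - nemytskii f (y + Y)"] nemytskii_f_lipschitz[OF F nx ny]
        unfolding w by (intro cs) simp
      have 4: "w \<bullet> (nemytskii (\<lambda>i. g i t) (x + Y) - nemytskii (\<lambda>i. g i t) (y + Y)) \<le> M2 * (norm w)\<^sup>2"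
        using nemytskii_g_one_sided[OF G, of t M2 "x + Y" "y + Y"] elim t M3(1)
          nemytskii_g_growth(1)[OF G q, of t M3 _ S] nx ny unfolding w by blast
      have "w \<bullet> (rhs lam f g h h' t \<omega> x - rhs lam f g h h' t \<omega> y) =
        w \<bullet> (- opA (opA w)) + w \<bullet> (- (lam *\<^sub>R w)) + w \<bullet> (- opA (nemytskii f (x + Y) - nemytskii f (y + Y)))
        + w \<bullet> (nemytskii (\<lambda>i. g i t) (x + Y) - nemytskii (\<lambda>i. g i t) (y + Y))"
        unfolding split by (simp add: inner_add_right inner_diff_right)
      also have "\<dots> \<le> C * (norm w)\<^sup>2"
        using 1 2 3 4 unfolding C_def by (simp add: algebra_simps)
      finally show "(x - y) \<bullet> (rhs lam f g h h' t \<omega> x - rhs lam f g h h' t \<omega> y) \<le> C * (norm (x - y))\<^sup>2"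
        by (simp add: w_def)
    qed
  qed
  moreover have "C \<ge> 0" using M2 \<gamma> by (simp add: C_def)
  ultimately show ?thesis by blast
qed

text \<open>Here the state is frozen; the result serves to compare solutions with a constant. The
  majorant is only integrable, not bounded, because \<open>\<psi>4\<close> and \<open>h'\<close> are
  controlled only in a local square integrable sense.\<close>

lemma rhs_bound:
  assumes F: "cond_F q \<epsilon> \<alpha>1 \<alpha>2 \<gamma> f" and G: "cond_G1 q \<beta> \<psi>1 \<psi>2 \<psi>3 \<psi>4 g" and H: "cond_H1 q h h'"
    and Z: "continuous_on UNIV (\<lambda>t. ou_z (\<theta> t \<omega>))"
  shows "\<exists>B. set_integrable lebesgue {a..b} B \<and>
           (AE t in lebesgue. t \<in> {a..b} \<longrightarrow> norm (rhs lam f g h h' t \<omega> x) \<le> B t)"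
proof -
  have q: "q > 2" using F by (simp add: cond_F_def)
  have hc: "continuous_on UNIV h" by (rule cond_H1_continuous[OF H])
  obtain Zb where Zb: "Zb \<ge> 0" "\<And>t. t \<in> {a..b} \<Longrightarrow> norm (ou_z (\<theta> t \<omega>)) \<le> Zb"
    using continuous_bounded_Icc[OF Z, of a b] by blast
  obtain Hb where Hb: "Hb \<ge> 0" "\<And>t. t \<in> {a..b} \<Longrightarrow> norm (h t) \<le> Hb"
    using continuous_bounded_Icc[OF hc, of a b] by blast
  have L3: "Linf_loc linf_seq linf_norm \<psi>3"
    and L4: "Lp_loc 2 (lp_seq 2) (lp_norm 2) \<psi>4" using G by (auto simp: cond_G1_def)
  obtain M3 where M3: "M3 \<ge> 0" "AE t in lebesgue. t \<in> {a..b} \<longrightarrow> (\<forall>i. \<bar>\<psi>3 t i\<bar> \<le> M3)"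
    by (rule Linf_loc_bound[OF L3])
  have M4: "AE t in lebesgue. \<psi>4 t \<in> lp_seq 2"
    using L4 by (auto simp: Lp_loc_def strongly_measurable_on_def elim: AE_mp)
  define S where "S = norm x + Zb * Hb"
  have S0: "0 \<le> S" using Zb Hb by (simp add: S_def)
  have \<gamma>: "0 \<le> \<gamma> S" using F S0 by (simp add: cond_F_def)
  define c where "c = 25 * norm x + \<bar>lam\<bar> * norm x + 5 * (norm (nemytskii f 0) + \<gamma> S * S) +
    2 * (M3 * S powr (q - 2) * S) + Zb * (25 * Hb + \<bar>1 - lam\<bar> * Hb)"
  define B where "B t = c + (2 * norm (to_ell2 (\<psi>4 t)) + Zb * norm (to_ell2 (seq (h' t))))" for t
  have "set_integrable lebesgue {a..b} B"
  proof -
    have i1: "set_integrable lebesgue {a..b} (\<lambda>t. norm (to_ell2 (\<psi>4 t)))"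
      by (rule Lp_loc_2_norm_integrable[OF L4])
    have i2: "set_integrable lebesgue {a..b} (\<lambda>t. norm (to_ell2 (seq (h' t))))"
      using H by (intro Lp_loc_2_norm_integrable) (simp add: cond_H1_def)
    have i3: "set_integrable lebesgue {a..b} (\<lambda>t. c)"
      by (rule absolutely_integrable_continuous_real) simp
    show ?thesis unfolding B_def
      by (intro set_integral_add(1) i3 set_integrable_mult_right i1 i2)
  qed
  moreover have "AE t in lebesgue. t \<in> {a..b} \<longrightarrow> norm (rhs lam f g h h' t \<omega> x) \<le> B t"
    using M3(2) M4
  proof eventually_elim
    case (elim t)
    show ?case
    proof
      assume t: "t \<in> {a..b}"
      define z where "z = ou_z (\<theta> t \<omega>)"
      have z: "\<bar>z\<bar> \<le> Zb" using Zb(2)[OF t] by (simp add: z_def)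
      have ht: "norm (h t) \<le> Hb" by (rule Hb(2)[OF t])
      define p where "p = x + z *\<^sub>R h t"
      have "norm (z *\<^sub>R h t) \<le> Zb * Hb" using z ht Zb(1) by (simp add: mult_mono)
      hence p: "norm p \<le> S" using norm_triangle_ineq[of x "z *\<^sub>R h t"] by (simp add: p_def S_def)
      have 1: "norm (opA (opA u)) \<le> 25 * norm u" for u
        using norm_opA_le[of u] norm_opA_le[of "opA u"] by simp
      have "norm (nemytskii f p) \<le> norm (nemytskii f 0) + \<gamma> S * S"
      proof -
        have "norm (nemytskii f p - nemytskii f 0) \<le> \<gamma> S * norm (p - 0)"
          using p S0 by (intro nemytskii_f_lipschitz[OF F]) auto
        also have "\<dots> \<le> \<gamma> S * S" using p \<gamma> by (intro mult_left_mono) auto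
        finally show ?thesis using norm_triangle_ineq2[of "nemytskii f p" "nemytskii f 0"] by simp
      qed
      hence 2: "norm (opA (nemytskii f p)) \<le> 5 * (norm (nemytskii f 0) + \<gamma> S * S)"
        using norm_opA_le[of "nemytskii f p"] by simp
      have 3: "norm (nemytskii (\<lambda>i. g i t) p) \<le> 2 * (M3 * S powr (q - 2) * S) + 2 * norm (to_ell2 (\<psi>4 t))"
      proof -
        have "norm (nemytskii (\<lambda>i. g i t) p) \<le> 2 * (M3 * S powr (q - 2) * norm p + norm (to_ell2 (\<psi>4 t)))"
          using elim t M3(1) p by (intro nemytskii_g_growth(2)[OF G q]) auto
        also have "M3 * S powr (q - 2) * norm p \<le> M3 * S powr (q - 2) * S"
          using p M3(1) by (intro mult_left_mono) auto
        finally show ?thesis by simp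
      qed
      have 4: "norm (z *\<^sub>R (- opA (opA (h t)) + (1 - lam) *\<^sub>R h t - h' t)) \<le>
          Zb * (25 * Hb + \<bar>1 - lam\<bar> * Hb) + Zb * norm (h' t)"
      proof -
        have "norm (- opA (opA (h t)) + (1 - lam) *\<^sub>R h t - h' t) \<le>
          norm (- opA (opA (h t)) + (1 - lam) *\<^sub>R h t) + norm (h' t)" by (rule norm_triangle_ineq4)
        also have "norm (- opA (opA (h t)) + (1 - lam) *\<^sub>R h t) \<le> norm (- opA (opA (h t))) + norm ((1 - lam) *\<^sub>R h t)"
          by (rule norm_triangle_ineq)
        also have "norm (- opA (opA (h t))) \<le> 25 * Hb" using 1[of "h t"] ht by simp
        also have "norm ((1 - lam) *\<^sub>R h t) \<le> \<bar>1 - lam\<bar> * Hb" using ht by (simp add: mult_left_mono)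
        finally have "norm (- opA (opA (h t)) + (1 - lam) *\<^sub>R h t - h' t) \<le> 25 * Hb + \<bar>1 - lam\<bar> * Hb + norm (h' t)"
          by simp
        hence "\<bar>z\<bar> * norm (- opA (opA (h t)) + (1 - lam) *\<^sub>R h t - h' t) \<le> Zb * (25 * Hb + \<bar>1 - lam\<bar> * Hb + norm (h' t))"
          using z Zb(1) by (intro mult_mono) auto
        thus ?thesis by (simp only: norm_scaleR distrib_left)
      qed
      have "rhs lam f g h h' t \<omega> x = - opA (opA x) - lam *\<^sub>R x - opA (nemytskii f p) + nemytskii (\<lambda>i. g i t) p +
        z *\<^sub>R (- opA (opA (h t)) + (1 - lam) *\<^sub>R h t - h' t)"
        by (simp add: rhs_def z_def p_def)
      also have "norm \<dots> \<le> norm (- opA (opA x)) + norm (lam *\<^sub>R x) + norm (opA (nemytskii f p)) +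
        norm (nemytskii (\<lambda>i. g i t) p) + norm (z *\<^sub>R (- opA (opA (h t)) + (1 - lam) *\<^sub>R h t - h' t))"
        by (intro norm_triangle_mono norm_triangle_le_diff add_mono order_refl)
      also have "\<dots> \<le> B t"
        using 1[of x] 2 3 4 by (simp add: B_def c_def to_ell2_seq)
      finally show "norm (rhs lam f g h h' t \<omega> x) \<le> B t" .
    qed
  qed
  ultimately show ?thesis by blast
qed

section \<open>The flow of a one-sided Lipschitz equation along a fixed path\<close>

locale one_sided_lipschitz_flow =
  fixes F :: "real \<Rightarrow> ell2 \<Rightarrow> ell2" and V :: "real \<Rightarrow> real \<Rightarrow> ell2 \<Rightarrow> ell2"
  assumes solution: "\<And>s x. global_solution F s x (\<lambda>t. V t s x)"
    and one_sided: "\<And>R a b. \<exists>C\<ge>0. AE t in lebesgue. t \<in> {a..b} \<longrightarrow> (\<forall>x y. norm x \<le> R \<longrightarrow> norm y \<le> R \<longrightarrow>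
           (x - y) \<bullet> (F t x - F t y) \<le> C * (norm (x - y))\<^sup>2)"
    and locally_bounded: "\<And>a b x. \<exists>B. set_integrable lebesgue {a..b} B \<and>
           (AE t in lebesgue. t \<in> {a..b} \<longrightarrow> norm (F t x) \<le> B t)"
begin

lemma initial: "V s s x = x"
  using global_solution_init[OF solution] .

lemma primitive: "s0 \<le> s \<Longrightarrow> primitive_on s t (\<lambda>r. V r s0 x) (\<lambda>r. F r (V r s0 x))"
  using global_solution_primitive_on[OF solution] .

lemma continuous_time: "continuous_on {s..} (\<lambda>t. V t s x)"
  using solution[of s x] by (simp add: global_solution_def)

text \<open>The perturbation may enter at any time \<open>s\<close> between \<open>s0\<close> and
  \<open>t\<close>, with the same \<open>K\<close> and \<delta>. A zero perturbation gives the flow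
  property, \<open>s = s0\<close> continuity in the state, and varying \<open>s\<close> continuity
  in the initial time from the right.\<close>

lemma stability:
  assumes st: "s0 \<le> t"
  shows "\<exists>K\<ge>0. \<exists>\<delta>>0. \<forall>s x. s0 \<le> s \<longrightarrow> s \<le> t \<longrightarrow> norm (x - V s s0 c) < \<delta> \<longrightarrow>
       norm (V t s x - V t s0 c) \<le> K * norm (x - V s s0 c)"
proof -
  have "compact ((\<lambda>r. V r s0 c) ` {s0..t})"
    using continuous_on_subset[OF continuous_time[of s0 c], of "{s0..t}"] compact_Icc
    by (intro compact_continuous_image) auto
  then obtain R where R: "\<And>r. r \<in> {s0..t} \<Longrightarrow> norm (V r s0 c) \<le> R"
    using compact_imp_bounded bounded_iff by (metis image_eqI)
  obtain C where C: "C \<ge> 0" "AE r in lebesgue. r \<in> {s0..t} \<longrightarrow> (\<forall>x y. norm x \<le> R + 1 \<longrightarrow> norm y \<le> R + 1 \<longrightarrow>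
           (x - y) \<bullet> (F r x - F r y) \<le> C * (norm (x - y))\<^sup>2)"
    using one_sided[of s0 t "R + 1"] by blast
  \<comment> \<open>The square root of the Gronwall factor over the longest interval. The radius
    \<open>1 / K\<close> chosen below keeps the propagated distance under 1, as the continuation
    argument demands.\<close>
  define K where "K = exp (C * (t - s0))"
  have K: "K > 0" by (simp add: K_def)
  show ?thesis
  proof (rule exI[of _ K], rule conjI, goal_cases)
    case 2
    show ?case
    proof (intro exI[of _ "1 / K"] conjI allI impI)
      show "0 < 1 / K" using K by auto
      fix s x assume s: "s0 \<le> s" "s \<le> t" and x: "norm (x - V s s0 c) < 1 / K"
      have le: "(norm (x - V s s0 c))\<^sup>2 * exp (2 * C * (t - s)) \<le> (K * norm (x - V s s0 c))\<^sup>2"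
      proof -
        have "exp (2 * C * (t - s)) \<le> exp (2 * C * (t - s0))" using C(1) s by (simp add: mult_left_mono)
        also have "\<dots> = K\<^sup>2" by (simp add: K_def power2_eq_square exp_add[symmetric] algebra_simps)
        finally show ?thesis by (simp add: power_mult_distrib mult.commute mult_right_mono)
      qed
      have "K * norm (x - V s s0 c) < 1" using x K by (simp add: field_simps)
      hence lt: "(K * norm (x - V s s0 c))\<^sup>2 < 1" using K by (simp add: abs_square_less_1)
      have "(norm (V t s x - V t s0 c))\<^sup>2 \<le>
        ((norm (V s s x - V s s0 c))\<^sup>2 + 2 * (LINT r:{s..t}|lebesgue. (\<lambda>_. 0) r)) * exp (2 * C * (t - s))"
      proof (rule primitive_on_stability[where B = "\<lambda>_. 0"])
        show "primitive_on s t (\<lambda>r. V r s x) (\<lambda>r. F r (V r s x))" by (intro primitive) simp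
        show "primitive_on s t (\<lambda>r. V r s0 c) (\<lambda>r. F r (V r s0 c))" using s by (intro primitive)
        show "((norm (V s s x - V s s0 c))\<^sup>2 + 2 * (LINT r:{s..t}|lebesgue. 0)) * exp (2 * C * (t - s)) < 1"
          using le lt by (simp add: initial set_lebesgue_integral_def)
        show "set_integrable lebesgue {s..t} (\<lambda>_. 0 :: real)" by (simp add: set_integrable_def)
        show "AE r in lebesgue. r \<in> {s..t} \<longrightarrow> norm (V r s x - V r s0 c) \<le> 1 \<longrightarrow>
          (V r s x - V r s0 c) \<bullet> (F r (V r s x) - F r (V r s0 c)) \<le> C * (norm (V r s x - V r s0 c))\<^sup>2 + 0"
          using C(2)
        proof eventually_elim
          case (elim r)
          show ?case
          proof (intro impI)
            assume r: "r \<in> {s..t}" and d: "norm (V r s x - V r s0 c) \<le> 1"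
            have "norm (V r s0 c) \<le> R" using r s by (intro R) auto
            moreover from this have "norm (V r s x) \<le> R + 1"
              using d norm_triangle_ineq2[of "V r s x" "V r s0 c"] by simp
            ultimately show "(V r s x - V r s0 c) \<bullet> (F r (V r s x) - F r (V r s0 c)) \<le>
              C * (norm (V r s x - V r s0 c))\<^sup>2 + 0"
              using elim r s by simp
          qed
        qed
      qed (use s C in auto)
      also have "\<dots> = (norm (x - V s s0 c))\<^sup>2 * exp (2 * C * (t - s))"
        by (simp add: initial set_lebesgue_integral_def)
      also note le
      finally show "norm (V t s x - V t s0 c) \<le> K * norm (x - V s s0 c)"
        by (rule power2_le_imp_le) (use K in simp)
    qed
  qed (use K in simp)
qed

text \<open>Uniqueness is stability with zero perturbation: the solution restarted at
  \<open>r\<close> from \<open>V r s x\<close> stays at distance 0 from the original one.\<close>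

lemma flow:
  assumes "s \<le> r" "r \<le> t"
  shows "V t r (V r s x) = V t s x"
proof -
  have "s \<le> t" using assms by simp
  from stability[OF this, of x] obtain K \<delta> where "0 < \<delta>" "\<forall>s' y. s \<le> s' \<longrightarrow> s' \<le> t \<longrightarrow>
      norm (y - V s' s x) < \<delta> \<longrightarrow> norm (V t s' y - V t s x) \<le> K * norm (y - V s' s x)" by blast
  from this(2)[rule_format, of r "V r s x"] this(1) assms show ?thesis by simp
qed

text \<open>A constant is an approximate solution on short intervals, so solutions stay near their initial value.\<close>
lemma near_initial:
  assumes \<epsilon>: "0 < \<epsilon>"
  shows "\<exists>\<delta>>0. \<forall>s x. s0 - \<delta> < s \<longrightarrow> s \<le> s0 \<longrightarrow> norm (x - x0) < \<delta> \<longrightarrow> norm (V s0 s x - x0) < \<epsilon>"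
proof -
  obtain C where C: "0 \<le> C" "AE r in lebesgue. r \<in> {s0 - 1..s0} \<longrightarrow> (\<forall>x y. norm x \<le> norm x0 + 1 \<longrightarrow> norm y \<le> norm x0 + 1 \<longrightarrow>
           (x - y) \<bullet> (F r x - F r y) \<le> C * (norm (x - y))\<^sup>2)"
    using one_sided[of "s0 - 1" s0 "norm x0 + 1"] by blast
  obtain B where B: "set_integrable lebesgue {s0 - 1..s0} B"
    "AE t in lebesgue. t \<in> {s0 - 1..s0} \<longrightarrow> norm (F t x0) \<le> B t"
    using locally_bounded[of "s0 - 1" s0 x0] by blast
  \<comment> \<open>The majorant may be negative on a null set or outside the interval, while the
    defect in \<open>primitive_on_stability\<close> must be nonnegative everywhere.\<close>
  define B' where "B' t = \<bar>B t\<bar>" for t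
  have B': "set_integrable lebesgue {s0 - 1..s0} B'"
    unfolding B'_def using set_integrable_abs[OF B(1)] .
  define m where "m = min 1 \<epsilon>"
  have m: "0 < m" "m \<le> 1" "m \<le> \<epsilon>" using \<epsilon> by (auto simp: m_def)
  \<comment> \<open>Gronwall factor for time intervals of length at most 1; \<delta> below is at
    most 1 accordingly.\<close>
  define E where "E = exp (2 * C)"
  have E: "E \<ge> 1" using C(1) by (simp add: E_def)
  have "continuous_on {s0 - 1..s0} (\<lambda>s. integral {s..s0} B')"
    using B' set_lebesgue_integral_eq_integral(1) by (intro indefinite_integral_continuous_1') auto
  hence "\<exists>d>0. \<forall>s\<in>{s0 - 1..s0}. dist s s0 < d \<longrightarrow> dist (integral {s..s0} B') (integral {s0..s0} B') < m\<^sup>2 / (4 * E)"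
    using m(1) E by (intro continuous_on_iff[THEN iffD1, rule_format]) auto
  then obtain d where d: "d > 0" "\<And>s. s \<in> {s0 - 1..s0} \<Longrightarrow> dist s s0 < d \<Longrightarrow> \<bar>integral {s..s0} B'\<bar> < m\<^sup>2 / (4 * E)"
    by (auto simp: dist_real_def)
  \<comment> \<open>As \<open>E \<ge> 1\<close>, the initial error contributes at most
    \<open>m^2 / (4 * E)\<close> to the squared bound and the defect twice that amount; after
    multiplication by \<open>E\<close> the sum is \<open>3 / 4 * m^2\<close>, which leaves room
    below \<open>m^2\<close>.\<close>
  define \<delta> where "\<delta> = min (min d 1) (m / (2 * E))"
  show ?thesis
  proof (intro exI[of _ \<delta>] conjI allI impI)
    show "0 < \<delta>" using d(1) m(1) E by (simp add: \<delta>_def)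
    fix s x assume s: "s0 - \<delta> < s" "s \<le> s0" and x: "norm (x - x0) < \<delta>"
    have s1: "s \<in> {s0 - 1..s0}" using s by (auto simp: \<delta>_def)
    have Bs: "set_integrable lebesgue {s..s0} B'"
      using set_integrable_subset[OF B', of "{s..s0}"] s1 by auto
    have IB: "(LINT r:{s..s0}|lebesgue. B' r) < m\<^sup>2 / (4 * E)"
    proof -
      have "(LINT r:{s..s0}|lebesgue. B' r) = integral {s..s0} B'"
        using Bs by (rule set_lebesgue_integral_eq_integral(2))
      also have "\<dots> < m\<^sup>2 / (4 * E)" using d(2)[OF s1] s by (simp add: dist_real_def \<delta>_def abs_less_iff)
      finally show ?thesis .
    qed
    have IB0: "0 \<le> (LINT r:{s..s0}|lebesgue. B' r)" by (simp add: set_lebesgue_integral_def B'_def)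
    have small: "((norm (x - x0))\<^sup>2 + 2 * (LINT r:{s..s0}|lebesgue. B' r)) * exp (2 * C * (s0 - s)) < m\<^sup>2"
    proof -
      have "(norm (x - x0))\<^sup>2 < (m / (2 * E))\<^sup>2"
        using x m(1) E by (intro power_strict_mono) (auto simp: \<delta>_def)
      also have "\<dots> \<le> m\<^sup>2 / (4 * E)"
      proof -
        have "m\<^sup>2 * E \<le> m\<^sup>2 * (E * E)" using E by (intro mult_left_mono) auto
        thus ?thesis using E by (simp add: power2_eq_square field_simps)
      qed
      finally have "(norm (x - x0))\<^sup>2 + 2 * (LINT r:{s..s0}|lebesgue. B' r) < m\<^sup>2 / (4 * E) + 2 * (m\<^sup>2 / (4 * E))"
        using IB by linarith
      hence "((norm (x - x0))\<^sup>2 + 2 * (LINT r:{s..s0}|lebesgue. B' r)) * E \<le> (m\<^sup>2 / (4 * E) + 2 * (m\<^sup>2 / (4 * E))) * E"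
        using E by (intro mult_right_mono) auto
      also have "\<dots> = 3 / 4 * m\<^sup>2" using E by (simp add: field_simps)
      also have "\<dots> < m\<^sup>2" using m(1) by simp
      finally have "((norm (x - x0))\<^sup>2 + 2 * (LINT r:{s..s0}|lebesgue. B' r)) * E < m\<^sup>2" .
      moreover have "exp (2 * C * (s0 - s)) \<le> E"
      proof -
        have "2 * C * (s0 - s) \<le> 2 * C * 1" using C(1) s1 by (intro mult_left_mono) auto
        thus ?thesis by (simp add: E_def)
      qed
      hence "((norm (x - x0))\<^sup>2 + 2 * (LINT r:{s..s0}|lebesgue. B' r)) * exp (2 * C * (s0 - s)) \<le>
        ((norm (x - x0))\<^sup>2 + 2 * (LINT r:{s..s0}|lebesgue. B' r)) * E"
        using IB0 by (intro mult_left_mono) auto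
      ultimately show ?thesis by simp
    qed
    have m1: "m\<^sup>2 \<le> 1" using m by (simp add: power_le_one)
    have "(norm (V s0 s x - x0))\<^sup>2 \<le>
      ((norm (V s s x - x0))\<^sup>2 + 2 * (LINT r:{s..s0}|lebesgue. B' r)) * exp (2 * C * (s0 - s))"
    proof (rule primitive_on_stability[where y = "\<lambda>_. x0"])
      show "primitive_on s s0 (\<lambda>r. V r s x) (\<lambda>r. F r (V r s x))" by (intro primitive) simp
      show "primitive_on s s0 (\<lambda>_. x0) (\<lambda>_. 0)" by (rule primitive_on_const)
      show "((norm (V s s x - x0))\<^sup>2 + 2 * (LINT r:{s..s0}|lebesgue. B' r)) * exp (2 * C * (s0 - s)) < 1"
        using small m1 by (simp add: initial)
      show "AE r in lebesgue. r \<in> {s..s0} \<longrightarrow> norm (V r s x - x0) \<le> 1 \<longrightarrow>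
        (V r s x - x0) \<bullet> (F r (V r s x) - 0) \<le> C * (norm (V r s x - x0))\<^sup>2 + B' r"
        using C(2) B(2)
      proof eventually_elim
        case (elim r)
        show ?case
        proof (intro impI)
          assume r: "r \<in> {s..s0}" and n: "norm (V r s x - x0) \<le> 1"
          have r1: "r \<in> {s0 - 1..s0}" using r s1 by auto
          have "norm (V r s x) \<le> norm x0 + 1"
            using n norm_triangle_ineq2[of "V r s x" x0] by simp
          hence "(V r s x - x0) \<bullet> (F r (V r s x) - F r x0) \<le> C * (norm (V r s x - x0))\<^sup>2"
            using elim(1) r1 by simp
          moreover have "(V r s x - x0) \<bullet> F r x0 \<le> B' r"
          proof -
            have "(V r s x - x0) \<bullet> F r x0 \<le> norm (V r s x - x0) * norm (F r x0)" by (rule norm_cauchy_schwarz)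
            also have "\<dots> \<le> 1 * norm (F r x0)" using n by (intro mult_right_mono) auto
            also have "\<dots> \<le> B' r" using elim(2) r1 by (simp add: B'_def)
            finally show ?thesis .
          qed
          ultimately show "(V r s x - x0) \<bullet> (F r (V r s x) - 0) \<le> C * (norm (V r s x - x0))\<^sup>2 + B' r"
            by (simp add: inner_diff_right)
        qed
      qed
      show "s \<le> s0" "0 \<le> C" "set_integrable lebesgue {s..s0} B'" by fact+
      show "0 \<le> B' r" for r by (simp add: B'_def)
    qed
    also have "\<dots> < m\<^sup>2" using small by (simp add: initial)
    finally have "norm (V s0 s x - x0) < m" using m(1) by (simp add: power2_less_imp_less)
    thus "norm (V s0 s x - x0) < \<epsilon>" using m(3) by simp
  qed
qed

text \<open>The two sides of \<open>s0\<close> are different. For a later \<open>s\<close>, the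
  state \<open>x s\<close> is compared with the solution started at \<open>s0\<close>. For an
  earlier \<open>s\<close>, the solution is first carried forward to \<open>s0\<close>, where
  \<open>near_initial\<close> keeps it close to \<open>x s0\<close>, and the flow property continues
  it to \<open>t\<close>.\<close>

lemma continuous_initial_time:
  assumes x: "continuous_on {..t} x"
  shows "continuous_on {..t} (\<lambda>s. V t s (x s))"
  unfolding continuous_on_iff
proof (intro ballI allI impI)
  fix s0 \<epsilon> :: real assume s0: "s0 \<in> {..t}" and \<epsilon>: "0 < \<epsilon>"
  have "s0 \<le> t" using s0 by simp
  from stability[OF this, of "x s0"] obtain K \<delta> where K: "0 \<le> K" "0 < \<delta>"
    "\<forall>s y. s0 \<le> s \<longrightarrow> s \<le> t \<longrightarrow> norm (y - V s s0 (x s0)) < \<delta> \<longrightarrow>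
       norm (V t s y - V t s0 (x s0)) \<le> K * norm (y - V s s0 (x s0))" by blast
  define \<eta> where "\<eta> = min \<delta> (\<epsilon> / (K + 1))"
  have \<eta>: "0 < \<eta>" using K \<epsilon> by (simp add: \<eta>_def)
  have close: "norm (V t s y - V t s0 (x s0)) < \<epsilon>"
    if "s0 \<le> s" "s \<le> t" "norm (y - V s s0 (x s0)) < \<eta>" for s y
  proof -
    have "norm (V t s y - V t s0 (x s0)) \<le> K * norm (y - V s s0 (x s0))"
      using that by (intro K(3)[rule_format]) (auto simp: \<eta>_def)
    also have "\<dots> \<le> (K + 1) * norm (y - V s s0 (x s0))" by (intro mult_right_mono) auto
    also have "\<dots> < (K + 1) * (\<epsilon> / (K + 1))"
      using that K(1) by (intro mult_strict_left_mono) (auto simp: \<eta>_def)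
    finally show ?thesis using K(1) by simp
  qed
  have "continuous_on {s0..t} (\<lambda>s. x s - V s s0 (x s0))"
    using continuous_on_subset[OF x, of "{s0..t}"] continuous_on_subset[OF continuous_time, of "{s0..t}" s0]
    by (intro continuous_on_diff) auto
  then obtain d1 where d1: "d1 > 0" "\<And>s. s \<in> {s0..t} \<Longrightarrow> dist s s0 < d1 \<Longrightarrow>
      dist (x s - V s s0 (x s0)) (x s0 - V s0 s0 (x s0)) < \<eta>"
    using \<eta> \<open>s0 \<le> t\<close> unfolding continuous_on_iff by (metis atLeastAtMost_iff order_refl)
  from near_initial[OF \<eta>, of s0 "x s0"] obtain d2 where d2: "0 < d2"
    "\<forall>s y. s0 - d2 < s \<longrightarrow> s \<le> s0 \<longrightarrow> norm (y - x s0) < d2 \<longrightarrow> norm (V s0 s y - x s0) < \<eta>"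
    by blast
  obtain d3 where d3: "d3 > 0" "\<And>s. s \<in> {..t} \<Longrightarrow> dist s s0 < d3 \<Longrightarrow> dist (x s) (x s0) < d2"
    using x s0 d2(1) unfolding continuous_on_iff by blast
  show "\<exists>d>0. \<forall>s\<in>{..t}. dist s s0 < d \<longrightarrow> dist (V t s (x s)) (V t s0 (x s0)) < \<epsilon>"
  proof (intro exI conjI ballI impI)
    show "0 < min d1 (min d2 d3)" using d1 d2 d3 by simp
    fix s assume s: "s \<in> {..t}" and d: "dist s s0 < min d1 (min d2 d3)"
    show "dist (V t s (x s)) (V t s0 (x s0)) < \<epsilon>"
    proof (cases "s0 \<le> s")
      case True
      have "norm (x s - V s s0 (x s0)) < \<eta>"
        using d1(2)[of s] True s d by (simp add: dist_norm initial)
      thus ?thesis using close True s by (simp add: dist_norm)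
    next
      case False
      have "norm (V s0 s (x s) - x s0) < \<eta>"
        using d2(2)[rule_format, of s "x s"] d3(2)[of s] False s d by (auto simp: dist_norm)
      hence "norm (V t s0 (V s0 s (x s)) - V t s0 (x s0)) < \<epsilon>"
        using \<open>s0 \<le> t\<close> by (intro close) (auto simp: initial)
      thus ?thesis using flow[of s s0 t] False \<open>s0 \<le> t\<close> by (simp add: dist_norm)
    qed
  qed
qed

lemma continuous_initial_value:
  assumes "s \<le> t"
  shows "continuous_on UNIV (V t s)"
  unfolding continuous_on_iff
proof (intro ballI allI impI)
  fix x0 :: ell2 and \<epsilon> :: real assume \<epsilon>: "0 < \<epsilon>"
  from stability[OF assms, of x0] obtain K \<delta> where K: "0 \<le> K" "0 < \<delta>"
    "\<forall>s' y. s \<le> s' \<longrightarrow> s' \<le> t \<longrightarrow> norm (y - V s' s x0) < \<delta> \<longrightarrow>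
       norm (V t s' y - V t s x0) \<le> K * norm (y - V s' s x0)" by blast
  show "\<exists>d>0. \<forall>x\<in>UNIV. dist x x0 < d \<longrightarrow> dist (V t s x) (V t s x0) < \<epsilon>"
  proof (intro exI conjI ballI impI)
    show "0 < min \<delta> (\<epsilon> / (K + 1))" using K \<epsilon> by simp
    fix x assume d: "dist x x0 < min \<delta> (\<epsilon> / (K + 1))"
    hence "norm (V t s x - V t s x0) \<le> K * norm (x - x0)"
      using K(3)[rule_format, of s x] assms by (simp add: initial dist_norm)
    also have "\<dots> \<le> (K + 1) * norm (x - x0)" by (intro mult_right_mono) auto
    also have "\<dots> < (K + 1) * (\<epsilon> / (K + 1))"
      using d K(1) by (intro mult_strict_left_mono) (auto simp: dist_norm)
    finally show "dist (V t s x) (V t s x0) < \<epsilon>" using K(1) by (simp add: dist_norm)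
  qed
qed

end

section \<open>Statistical solutions\<close>

lemma bounded_at_bot_add:
  assumes "bounded_at_bot \<zeta>" "bounded_at_bot \<eta>"
  shows "bounded_at_bot (\<lambda>\<tau>. \<zeta> \<tau> + \<eta> \<tau>)"
proof -
  obtain a b where "bounded (\<zeta> ` {..a})" "bounded (\<eta> ` {..b})" using assms by (auto simp: bounded_at_bot_def)
  hence "bounded (\<zeta> ` {..min a b})" "bounded (\<eta> ` {..min a b})"
    by (auto intro: bounded_subset[OF _ image_mono])
  hence "bounded ((\<lambda>\<tau>. \<zeta> \<tau> + \<eta> \<tau>) ` {..min a b})" by (rule bounded_plus_comp)
  thus ?thesis unfolding bounded_at_bot_def by blast
qed

lemma bounded_at_bot_cmult:
  assumes "bounded_at_bot \<zeta>"
  shows "bounded_at_bot (\<lambda>\<tau>. c * \<zeta> \<tau>)"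
proof -
  obtain a where "bounded (\<zeta> ` {..a})" using assms by (auto simp: bounded_at_bot_def)
  hence "bounded ((\<lambda>x. c *\<^sub>R x) ` \<zeta> ` {..a})" by (rule bounded_scaling)
  thus ?thesis unfolding bounded_at_bot_def image_image by auto
qed

lemma generalized_Banach_limit_eq:
  assumes L: "generalized_Banach_limit L" and b: "bounded_at_bot \<zeta>" "bounded_at_bot \<eta>"
    and d: "((\<lambda>\<tau>. \<zeta> \<tau> - \<eta> \<tau>) \<longlongrightarrow> 0) at_bot"
  shows "L \<zeta> = L \<eta>"
proof -
  have "bounded_at_bot (\<lambda>\<tau>. \<zeta> \<tau> - \<eta> \<tau>)"
    using bounded_at_bot_add[OF b(1) bounded_at_bot_cmult[OF b(2), of "- 1"]] by simp
  hence "L (\<lambda>\<tau>. (\<zeta> \<tau> - \<eta> \<tau>) + \<eta> \<tau>) = L (\<lambda>\<tau>. \<zeta> \<tau> - \<eta> \<tau>) + L \<eta>"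
    using L b(2) unfolding generalized_Banach_limit_def by blast
  moreover have "L (\<lambda>\<tau>. \<zeta> \<tau> - \<eta> \<tau>) = 0" using L d unfolding generalized_Banach_limit_def by blast
  ultimately show ?thesis by simp
qed

lemma generalized_Banach_limit_ge:
  assumes L: "generalized_Banach_limit L" and b: "bounded_at_bot \<zeta>"
    and ge: "\<And>\<tau>. \<tau> \<le> a \<Longrightarrow> c \<le> \<zeta> \<tau>"
  shows "c \<le> L \<zeta>"
proof -
  have const: "bounded_at_bot (\<lambda>\<tau>. - c)" by (auto simp: bounded_at_bot_def bounded_iff)
  have "bounded_at_bot (\<lambda>\<tau>. \<zeta> \<tau> + - c)" by (rule bounded_at_bot_add[OF b const])
  then obtain a' where "bounded ((\<lambda>\<tau>. \<zeta> \<tau> + - c) ` {..a'})" by (auto simp: bounded_at_bot_def)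
  hence "bounded ((\<lambda>\<tau>. \<zeta> \<tau> + - c) ` {..min a a'})" by (auto intro: bounded_subset[OF _ image_mono])
  moreover have "\<forall>\<tau>\<le>min a a'. 0 \<le> \<zeta> \<tau> + - c" using ge by auto
  ultimately have "0 \<le> L (\<lambda>\<tau>. \<zeta> \<tau> + - c)" using L unfolding generalized_Banach_limit_def by blast
  also have "\<dots> = L \<zeta> + L (\<lambda>\<tau>. - c)" using L b const unfolding generalized_Banach_limit_def by blast
  also have "L (\<lambda>\<tau>. - c) = - c" using L unfolding generalized_Banach_limit_def by (metis tendsto_const)
  finally show ?thesis by simp
qed

lemma time_average_eq_integral:
  assumes "continuous_on {..t} F"
  shows "time_average t F \<tau> = integral {\<tau>..t} F / (t - \<tau>)"
    and "set_integrable lebesgue {\<tau>..t} F"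
proof -
  show i: "set_integrable lebesgue {\<tau>..t} F"
    using assms by (intro absolutely_integrable_continuous_real continuous_on_subset[OF assms]) auto
  show "time_average t F \<tau> = integral {\<tau>..t} F / (t - \<tau>)"
    unfolding time_average_def set_lebesgue_integral_eq_integral(2)[OF i] by simp
qed

lemma integral_bound_const:
  fixes F :: "real \<Rightarrow> real"
  assumes c: "continuous_on {..t} F" and M: "\<And>s. s \<le> t \<Longrightarrow> \<bar>F s\<bar> \<le> M" and \<tau>: "\<tau> \<le> t"
  shows "\<bar>integral {\<tau>..t} F\<bar> \<le> M * (t - \<tau>)"
proof -
  have "norm (integral {\<tau>..t} F) \<le> M * (t - \<tau>)"
    using \<tau> M by (intro integral_bound continuous_on_subset[OF c]) auto
  thus ?thesis by simp
qed

lemma time_average_bounded: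
  assumes c: "continuous_on {..t} F" and M: "\<And>s. s \<le> t \<Longrightarrow> \<bar>F s\<bar> \<le> M"
  shows "bounded_at_bot (time_average t F)"
proof -
  have "\<bar>time_average t F \<tau>\<bar> \<le> M" if "\<tau> \<le> t - 1" for \<tau>
    using integral_bound_const[OF c M, of \<tau>] that
    by (simp add: time_average_eq_integral(1)[OF c] abs_divide pos_divide_le_eq)
  thus ?thesis unfolding bounded_at_bot_def bounded_iff by (intro exI[of _ "t - 1"] exI[of _ M]) auto
qed

lemma averageable_continuous:
  assumes "continuous_on {..t} F" "\<And>s. s \<le> t \<Longrightarrow> \<bar>F s\<bar> \<le> M"
  shows "averageable t F"
  unfolding averageable_def using time_average_eq_integral(2)[OF assms(1)] time_average_bounded[OF assms] by blast

text \<open>Moving the endpoint changes the integral by the fixed amount \<open>J\<close> and the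
  length by \<open>t - s\<close>. As \<open>F\<close> is bounded, the integral grows at most
  linearly, so both effects are of order \<open>1 / (t - \<tau>)\<close>.\<close>

lemma time_average_change_endpoint:
  assumes c: "continuous_on {..t} F" and M: "\<And>s. s \<le> t \<Longrightarrow> \<bar>F s\<bar> \<le> M" and st: "s \<le> t"
  shows "((\<lambda>\<tau>. time_average t F \<tau> - time_average s F \<tau>) \<longlongrightarrow> 0) at_bot"
proof (rule Lim_null_comparison)
  have cs: "continuous_on {..s} F" using st by (intro continuous_on_subset[OF c]) auto
  define J where "J = integral {s..t} F"
  show "((\<lambda>\<tau>. (\<bar>J\<bar> + M * (t - s)) / (t - \<tau>)) \<longlongrightarrow> 0) at_bot"
  proof (rule real_tendsto_divide_at_top[OF tendsto_const])
    have "filterlim (\<lambda>\<tau>. t + - \<tau>) at_top at_bot"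
      by (rule filterlim_tendsto_add_at_top[OF tendsto_const filterlim_uminus_at_top_at_bot])
    thus "filterlim (\<lambda>\<tau>. t - \<tau>) at_top at_bot" by simp
  qed
  show "\<forall>\<^sub>F \<tau> in at_bot. norm (time_average t F \<tau> - time_average s F \<tau>) \<le> (\<bar>J\<bar> + M * (t - s)) / (t - \<tau>)"
    using eventually_gt_at_bot[of s]
  proof eventually_elim
    case (elim \<tau>)
    define I where "I = integral {\<tau>..s} F"
    have "integral {\<tau>..t} F = I + J"
      unfolding I_def J_def using elim st
      by (intro Henstock_Kurzweil_Integration.integral_combine[symmetric] integrable_continuous_real continuous_on_subset[OF c]) auto
    hence eq: "time_average t F \<tau> - time_average s F \<tau> = J / (t - \<tau>) - I * (t - s) / ((t - \<tau>) * (s - \<tau>))"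
    proof -
      have "(I + J) / p - I / r = J / p - I * (p - r) / (p * r)" if "p \<noteq> 0" "r \<noteq> 0" for p r
        using that by (simp add: field_simps)
      from this[of "t - \<tau>" "s - \<tau>"] show ?thesis
        using elim st \<open>integral {\<tau>..t} F = I + J\<close>
        by (simp add: time_average_eq_integral(1)[OF c] time_average_eq_integral(1)[OF cs] I_def[symmetric])
    qed
    have "\<bar>I\<bar> \<le> M * (s - \<tau>)"
      unfolding I_def using M st elim by (intro integral_bound_const[OF cs]) auto
    hence "\<bar>I\<bar> * (t - s) \<le> M * (s - \<tau>) * (t - s)" using st by (intro mult_right_mono) auto
    hence "\<bar>I * (t - s) / ((t - \<tau>) * (s - \<tau>))\<bar> \<le> M * (t - s) / (t - \<tau>)"
      using elim st by (simp add: abs_mult abs_divide divide_simps mult.commute mult.left_commute)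
    hence "\<bar>J / (t - \<tau>) - I * (t - s) / ((t - \<tau>) * (s - \<tau>))\<bar> \<le> \<bar>J / (t - \<tau>)\<bar> + M * (t - s) / (t - \<tau>)"
      by linarith
    also have "\<dots> = (\<bar>J\<bar> + M * (t - s)) / (t - \<tau>)" using elim st by (simp add: abs_divide add_divide_distrib)
    finally show ?case by (simp add: eq)
  qed
qed

text \<open>Compactness makes the distance from \<open>K\<close> to the complement of
  \<open>W\<close> positive. The case \<open>W = UNIV\<close> is separate because the distance to
  the empty set is 0 by convention.\<close>

lemma compact_infdist_neighbourhood:
  fixes K :: "'a::metric_space set"
  assumes K: "compact K" "K \<noteq> {}" and W: "open W" "K \<subseteq> W"
  shows "\<exists>d>0. \<forall>x. infdist x K < d \<longrightarrow> x \<in> W"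
proof (cases "W = UNIV")
  case True
  thus ?thesis by (intro exI[of _ 1]) auto
next
  case False
  hence ne: "- W \<noteq> {}" by auto
  have "continuous_on K (\<lambda>x. infdist x (- W))" by (intro continuous_intros)
  then obtain k where k: "k \<in> K" "\<And>y. y \<in> K \<Longrightarrow> infdist k (- W) \<le> infdist y (- W)"
    using continuous_attains_inf[OF K] by blast
  have "closed (- W)" using W(1) by (simp add: closed_Compl)
  hence "infdist k (- W) \<noteq> 0" using in_closed_iff_infdist_zero[OF _ ne, of k] k(1) W(2) by auto
  hence pos: "infdist k (- W) > 0" using infdist_nonneg[of k "- W"] by simp
  have "x \<in> W" if x: "infdist x K < infdist k (- W)" for x
  proof (rule ccontr)
    assume "x \<notin> W"
    have "infdist x K = (INF a\<in>K. dist x a)" using K(2) by (simp add: infdist_notempty)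
    then obtain y where y: "y \<in> K" "dist x y < infdist k (- W)"
      using x K(2) cInf_lessD[of "dist x ` K" "infdist k (- W)"] by auto
    have "infdist y (- W) \<le> dist y x" using \<open>x \<notin> W\<close> by (intro infdist_le) auto
    thus False using y k(2)[OF y(1)] by (simp add: dist_commute)
  qed
  thus ?thesis using pos by blast
qed

text \<open>One path \<omega> is fixed, so the cocycle has become a two-parameter process and the
  attractor a family of fibres indexed by time. Attraction is recorded only for the one orbit that
  is averaged.\<close>

locale pullback_evolution =
  fixes U :: "real \<Rightarrow> real \<Rightarrow> 'a::metric_space \<Rightarrow> 'a" and K :: "real \<Rightarrow> 'a set" and \<xi> :: "real \<Rightarrow> 'a"
    and L :: "(real \<Rightarrow> real) \<Rightarrow> real"
  assumes evolution: "\<And>s r t x. s \<le> r \<Longrightarrow> r \<le> t \<Longrightarrow> U t r (U r s x) = U t s x"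
    and continuous: "\<And>s t. s \<le> t \<Longrightarrow> continuous_on UNIV (U t s)"
    and orbit_continuous: "\<And>t. continuous_on {..t} (\<lambda>s. U t s (\<xi> s))"
    and compact: "\<And>t. compact (K t)" and nonempty: "\<And>t. K t \<noteq> {}"
    and attracted: "\<And>t. ((\<lambda>s. infdist (U t s (\<xi> s)) (K t)) \<longlongrightarrow> 0) at_bot"
    and Banach_limit: "generalized_Banach_limit L"
begin

lemma eventually_near:
  assumes "open W" "K t \<subseteq> W"
  shows "\<forall>\<^sub>F s in at_bot. U t s (\<xi> s) \<in> W"
proof -
  obtain d where d: "d > 0" "\<And>x. infdist x (K t) < d \<Longrightarrow> x \<in> W"
    using compact_infdist_neighbourhood[OF compact nonempty assms] by blast
  show ?thesis
    using order_tendstoD(2)[OF attracted d(1)] by eventually_elim (rule d(2))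
qed

lemma observable_continuous:
  assumes "continuous_on UNIV \<Upsilon>"
  shows "continuous_on {..t} (\<lambda>s. \<Upsilon> (U t s (\<xi> s)))"
  by (rule continuous_on_compose2[OF assms orbit_continuous]) auto

text \<open>\<open>\<Upsilon>\<close> itself may be unbounded. Early starting times put the orbit
  near the compact fibre, where \<open>\<Upsilon>\<close> is bounded, and the remaining starting
  times form a compact interval.\<close>

lemma observable_bounded:
  fixes \<Upsilon> :: "'a \<Rightarrow> real"
  assumes c: "continuous_on UNIV \<Upsilon>"
  shows "\<exists>M. \<forall>s\<le>t. \<bar>\<Upsilon> (U t s (\<xi> s))\<bar> \<le> M"
proof -
  have "compact (\<Upsilon> ` K t)" using c compact compact_continuous_image continuous_on_subset by blast
  then obtain B where B: "\<And>x. x \<in> K t \<Longrightarrow> \<bar>\<Upsilon> x\<bar> \<le> B"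
    using compact_imp_bounded bounded_iff by (metis image_eqI real_norm_def)
  have "open {x. \<bar>\<Upsilon> x\<bar> < B + 1}" by (intro open_Collect_less continuous_intros c)
  moreover have "K t \<subseteq> {x. \<bar>\<Upsilon> x\<bar> < B + 1}" using B by fastforce
  ultimately obtain s0 where s0: "\<And>s. s \<le> s0 \<Longrightarrow> \<bar>\<Upsilon> (U t s (\<xi> s))\<bar> < B + 1"
    using eventually_near[of _ t] by (force simp: eventually_at_bot_linorder)
  have "compact ((\<lambda>s. \<Upsilon> (U t s (\<xi> s))) ` {s0..t})"
    by (intro compact_continuous_image continuous_on_subset[OF observable_continuous[OF c]]) auto
  then obtain C where "\<forall>x\<in>(\<lambda>s. \<Upsilon> (U t s (\<xi> s))) ` {s0..t}. norm x \<le> C"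
    using compact_imp_bounded bounded_iff by blast
  hence C: "\<And>s. s \<in> {s0..t} \<Longrightarrow> \<bar>\<Upsilon> (U t s (\<xi> s))\<bar> \<le> C" by simp
  show ?thesis
  proof (intro exI allI impI)
    fix s assume "s \<le> t"
    thus "\<bar>\<Upsilon> (U t s (\<xi> s))\<bar> \<le> max (B + 1) C"
      using s0[of s] C[of s] by (cases "s \<le> s0") auto
  qed
qed

definition mean :: "real \<Rightarrow> ('a \<Rightarrow> real) \<Rightarrow> real" where
  "mean t \<Upsilon> = L (time_average t (\<lambda>s. \<Upsilon> (U t s (\<xi> s))))"

lemma averageable_observable:
  "continuous_on UNIV \<Upsilon> \<Longrightarrow> averageable t (\<lambda>s. \<Upsilon> (U t s (\<xi> s)))"
  using observable_bounded[of \<Upsilon> t] averageable_continuous[OF observable_continuous, of \<Upsilon> t] by blast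

lemma time_average_observable_bounded:
  "continuous_on UNIV \<Upsilon> \<Longrightarrow> bounded_at_bot (time_average t (\<lambda>s. \<Upsilon> (U t s (\<xi> s))))"
  using averageable_observable by (simp add: averageable_def)

lemma Banach_limit_change_endpoint:
  assumes c: "continuous_on UNIV \<Upsilon>" and st: "s \<le> t"
  shows "L (time_average t (\<lambda>r. \<Upsilon> (U t r (\<xi> r)))) = L (time_average s (\<lambda>r. \<Upsilon> (U t r (\<xi> r))))"
    and "bounded_at_bot (time_average s (\<lambda>r. \<Upsilon> (U t r (\<xi> r))))"
proof -
  obtain M where M: "\<And>r. r \<le> t \<Longrightarrow> \<bar>\<Upsilon> (U t r (\<xi> r))\<bar> \<le> M" using observable_bounded[OF c] by blast
  have cs: "continuous_on {..s} (\<lambda>r. \<Upsilon> (U t r (\<xi> r)))"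
    using st by (intro continuous_on_subset[OF observable_continuous[OF c]]) auto
  show b: "bounded_at_bot (time_average s (\<lambda>r. \<Upsilon> (U t r (\<xi> r))))"
    using time_average_bounded[OF cs] M st by (meson order_trans)
  show "L (time_average t (\<lambda>r. \<Upsilon> (U t r (\<xi> r)))) = L (time_average s (\<lambda>r. \<Upsilon> (U t r (\<xi> r))))"
    by (rule generalized_Banach_limit_eq[OF Banach_limit time_average_observable_bounded[OF c] b
          time_average_change_endpoint[OF observable_continuous[OF c] M st]])
qed

text \<open>By the evolution property both sides average the same function of the starting time,
  once up to \<open>s\<close> and once up to \<open>t\<close>; the Banach limit ignores the
  difference of endpoints.\<close>

lemma mean_pushforward:
  assumes c: "continuous_on UNIV \<Upsilon>" and st: "s \<le> t"
  shows "mean s (\<lambda>x. \<Upsilon> (U t s x)) = mean t \<Upsilon>"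
proof -
  have cu: "continuous_on UNIV (\<lambda>x. \<Upsilon> (U t s x))"
    by (rule continuous_on_compose2[OF c continuous[OF st]]) auto
  have "((\<lambda>\<tau>. time_average s (\<lambda>r. \<Upsilon> (U t s (U s r (\<xi> r)))) \<tau> - time_average s (\<lambda>r. \<Upsilon> (U t r (\<xi> r))) \<tau>) \<longlongrightarrow> 0) at_bot"
  proof (rule tendsto_eventually)
    show "\<forall>\<^sub>F \<tau> in at_bot. time_average s (\<lambda>r. \<Upsilon> (U t s (U s r (\<xi> r)))) \<tau> - time_average s (\<lambda>r. \<Upsilon> (U t r (\<xi> r))) \<tau> = 0"
    proof (intro always_eventually allI)
      fix \<tau>
      have "(LINT r:{\<tau>..s}|lebesgue. \<Upsilon> (U t s (U s r (\<xi> r)))) = (LINT r:{\<tau>..s}|lebesgue. \<Upsilon> (U t r (\<xi> r)))"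
        using st by (intro set_lebesgue_integral_cong) (auto simp: evolution)
      thus "time_average s (\<lambda>r. \<Upsilon> (U t s (U s r (\<xi> r)))) \<tau> - time_average s (\<lambda>r. \<Upsilon> (U t r (\<xi> r))) \<tau> = 0"
        by (simp add: time_average_def)
    qed
  qed
  from generalized_Banach_limit_eq[OF Banach_limit time_average_observable_bounded[OF cu]
      Banach_limit_change_endpoint(2)[OF c st] this]
  show ?thesis unfolding mean_def Banach_limit_change_endpoint(1)[OF c st] .
qed

text \<open>Positivity on the fibre is enough because the endpoint can be moved back to a time
  before which the orbit lies in the open set \<open>- e < \<Upsilon>\<close>; then every average is
  at least \<open>- e\<close>.\<close>

lemma mean_nonneg:
  assumes c: "continuous_on UNIV \<Upsilon>" and pos: "\<And>x. x \<in> K t \<Longrightarrow> 0 \<le> \<Upsilon> x"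
  shows "0 \<le> mean t \<Upsilon>"
proof (rule field_le_epsilon)
  fix e :: real assume e: "0 < e"
  have "open {x. - e < \<Upsilon> x}" by (intro open_Collect_less continuous_intros c)
  moreover have "K t \<subseteq> {x. - e < \<Upsilon> x}" using pos e by force
  ultimately obtain s0 where s0: "\<And>s. s \<le> s0 \<Longrightarrow> - e < \<Upsilon> (U t s (\<xi> s))"
    using eventually_near[of _ t] by (force simp: eventually_at_bot_linorder)
  define s where "s = min s0 t"
  have st: "s \<le> t" by (simp add: s_def)
  have cs: "continuous_on {..s} (\<lambda>r. \<Upsilon> (U t r (\<xi> r)))"
    using st by (intro continuous_on_subset[OF observable_continuous[OF c]]) auto
  have "- e \<le> L (time_average s (\<lambda>r. \<Upsilon> (U t r (\<xi> r))))"
  proof (rule generalized_Banach_limit_ge[OF Banach_limit Banach_limit_change_endpoint(2)[OF c st]])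
    fix \<tau> assume \<tau>: "\<tau> \<le> s - 1"
    have "integral {\<tau>..s} (\<lambda>r. - e) \<le> integral {\<tau>..s} (\<lambda>r. \<Upsilon> (U t r (\<xi> r)))"
      using s0 by (intro integral_le integrable_continuous_real continuous_on_subset[OF cs]) (auto simp: s_def less_imp_le)
    hence "- e * (s - \<tau>) \<le> integral {\<tau>..s} (\<lambda>r. \<Upsilon> (U t r (\<xi> r)))" using \<tau> by (simp add: mult.commute)
    thus "- e \<le> time_average s (\<lambda>r. \<Upsilon> (U t r (\<xi> r))) \<tau>"
      using \<tau> unfolding time_average_eq_integral(1)[OF cs] by (subst pos_le_divide_eq) auto
  qed
  thus "0 \<le> mean t \<Upsilon> + e" unfolding mean_def Banach_limit_change_endpoint(1)[OF c st] by simp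
qed

lemma time_average_add:
  assumes "continuous_on {..t} F" "continuous_on {..t} G"
  shows "time_average t (\<lambda>s. F s + G s) = (\<lambda>\<tau>. time_average t F \<tau> + time_average t G \<tau>)"
  using time_average_eq_integral(2)[OF assms(1)] time_average_eq_integral(2)[OF assms(2)]
  by (simp add: time_average_def fun_eq_iff set_integral_add distrib_left)

lemma mean_functional: "normalized_positive_functional (mean t) (K t)"
proof
  show "compact (K t)" by (rule compact)
  fix f g :: "'a \<Rightarrow> real" and c :: real
  assume f: "continuous_on UNIV f"
  note bf = time_average_observable_bounded[OF f, of t]
  show "mean t (\<lambda>x. c * f x) = c * mean t f"
  proof -
    have "time_average t (\<lambda>s. c * f (U t s (\<xi> s))) = (\<lambda>\<tau>. c * time_average t (\<lambda>s. f (U t s (\<xi> s))) \<tau>)"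
      by (simp add: time_average_def fun_eq_iff)
    thus ?thesis using Banach_limit bf unfolding mean_def generalized_Banach_limit_def by metis
  qed
  show "mean t (\<lambda>x. f x + g x) = mean t f + mean t g" if g: "continuous_on UNIV g"
  proof -
    have "time_average t (\<lambda>s. f (U t s (\<xi> s)) + g (U t s (\<xi> s))) =
       (\<lambda>\<tau>. time_average t (\<lambda>s. f (U t s (\<xi> s))) \<tau> + time_average t (\<lambda>s. g (U t s (\<xi> s))) \<tau>)"
      by (intro time_average_add observable_continuous f g)
    thus ?thesis
      using Banach_limit bf time_average_observable_bounded[OF g, of t]
      unfolding mean_def generalized_Banach_limit_def by metis
  qed
  show "0 \<le> mean t f" if "\<And>x. x \<in> K t \<Longrightarrow> 0 \<le> f x" using mean_nonneg[OF f that] .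
next
  \<comment> \<open>Equality is only eventual: at \<open>\<tau> = t\<close> the average is 0 by the
    division convention, and beyond \<open>t\<close> the interval is empty.\<close>
  have "(time_average t (\<lambda>_. 1) \<longlongrightarrow> 1) at_bot"
  proof (rule tendsto_eventually)
    show "\<forall>\<^sub>F \<tau> in at_bot. time_average t (\<lambda>_. 1) \<tau> = 1"
      using eventually_gt_at_bot[of t]
      by eventually_elim (simp add: time_average_eq_integral(1))
  qed
  thus "mean t (\<lambda>_. 1) = 1"
    using Banach_limit unfolding mean_def generalized_Banach_limit_def by blast
qed

text \<open>The measures are chosen for all times at once, each representing the mean at its own
  time; compatibility between times is then \<open>mean_pushforward\<close> read through
  integrals.\<close>

theorem statistical_solution:
  "\<exists>\<nu>. \<forall>t. sets (\<nu> t) = sets borel \<and> prob_space (\<nu> t) \<and> emeasure (\<nu> t) (- K t) = 0 \<and>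
     (\<forall>\<Upsilon> :: 'a \<Rightarrow> real. continuous_on UNIV \<Upsilon> \<longrightarrow>
        averageable t (\<lambda>s. \<Upsilon> (U t s (\<xi> s))) \<and> integrable (\<nu> t) \<Upsilon> \<and>
        L (time_average t (\<lambda>s. \<Upsilon> (U t s (\<xi> s)))) = (LINT u|\<nu> t. \<Upsilon> u) \<and>
        (\<forall>s\<le>t. integrable (\<nu> s) (\<lambda>u. \<Upsilon> (U t s u)) \<and> (LINT u|\<nu> s. \<Upsilon> (U t s u)) = (LINT u|\<nu> t. \<Upsilon> u)))"
proof -
  define R where "R t M \<longleftrightarrow> sets M = sets borel \<and> prob_space M \<and> emeasure M (- K t) = 0 \<and>
     (\<forall>\<Upsilon> :: 'a \<Rightarrow> real. continuous_on UNIV \<Upsilon> \<longrightarrow> integrable M \<Upsilon> \<and> (LINT u|M. \<Upsilon> u) = mean t \<Upsilon>)" for t M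
  have "\<exists>M. R t M" for t
  proof -
    interpret normalized_positive_functional "mean t" "K t" by (rule mean_functional)
    show ?thesis unfolding R_def by (rule Riesz_representation) blast
  qed
  then obtain \<nu> where "\<And>t. R t (\<nu> t)" by metis
  hence \<nu>: "\<And>t. sets (\<nu> t) = sets borel" "\<And>t. prob_space (\<nu> t)" "\<And>t. emeasure (\<nu> t) (- K t) = 0"
    "\<And>t (\<Upsilon> :: 'a \<Rightarrow> real). continuous_on UNIV \<Upsilon> \<Longrightarrow> integrable (\<nu> t) \<Upsilon>" "\<And>t \<Upsilon>. continuous_on UNIV \<Upsilon> \<Longrightarrow> (LINT u|\<nu> t. \<Upsilon> u) = mean t \<Upsilon>"
    by (simp_all add: R_def)
  have cu: "continuous_on UNIV (\<lambda>u. \<Upsilon> (U t s u))" if "continuous_on UNIV \<Upsilon>" "s \<le> t" for \<Upsilon> :: "'a \<Rightarrow> real" and s t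
    by (rule continuous_on_compose2[OF that(1) continuous[OF that(2)]]) auto
  show ?thesis
    using \<nu>(1-3) averageable_observable \<nu>(4) \<nu>(5) cu mean_pushforward
    by (intro exI[of _ \<nu>] allI conjI impI) (simp_all add: mean_def[symmetric])
qed

end

section \<open>Measures carried by fibres and averages of constants\<close>

lemma set_integral_full:
  fixes f :: "'a \<Rightarrow> real"
  assumes "emeasure M (space M - S) = 0" "S \<in> sets M" "integrable M f"
  shows "set_integrable M S f" "(LINT x:S|M. f x) = (LINT x|M. f x)"
proof -
  show i: "set_integrable M S f"
    unfolding set_integrable_def using assms by (intro integrable_mult_indicator)
  have "AE x in M. x \<in> S" using assms by (intro AE_I[of _ _ "space M - S"]) auto
  thus "(LINT x:S|M. f x) = (LINT x|M. f x)"
    unfolding set_lebesgue_integral_def using i assms(3)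
    by (intro integral_cong_AE) (auto simp: set_integrable_def)
qed

lemma measure_support_subset:
  assumes "sets M = sets borel" "closed S" "emeasure M (- S) = 0"
  shows "measure_support M \<subseteq> S"
proof
  fix x assume x: "x \<in> measure_support M"
  show "x \<in> S"
  proof (rule ccontr)
    assume "x \<notin> S"
    hence "emeasure M (- S) > 0" using x assms(2) by (auto simp: measure_support_def open_Compl)
    thus False using assms(3) by simp
  qed
qed

lemma measure_support_return: "measure_support (return borel x) \<subseteq> {x :: 'a::t1_space}"
  by (rule measure_support_subset) auto

text \<open>Meant for the average of the space integrals: by invariance they do not depend on
  \<open>s\<close>. Constancy also settles measurability in \<open>s\<close>, which the choice of
  the measures by itself would not provide.\<close>

lemma averageable_const:
  assumes "\<And>s. s \<le> t \<Longrightarrow> F s = c"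
  shows "averageable t F" "generalized_Banach_limit L \<Longrightarrow> L (time_average t F) = c"
proof -
  have c: "continuous_on {..t} F"
    using continuous_on_cong[of "{..t}" "{..t}" F "\<lambda>_. c"] assms by simp
  show "averageable t F"
    by (rule averageable_continuous[OF c, of "\<bar>c\<bar>"]) (simp add: assms)
  assume L: "generalized_Banach_limit L"
  have "(time_average t F \<longlongrightarrow> c) at_bot"
  proof (rule tendsto_eventually)
    show "\<forall>\<^sub>F \<tau> in at_bot. time_average t F \<tau> = c"
      using eventually_gt_at_bot[of t]
    proof eventually_elim
      case (elim \<tau>)
      have "integral {\<tau>..t} F = integral {\<tau>..t} (\<lambda>_. c)" using assms by (intro integral_cong) auto
      thus ?case using elim by (simp add: time_average_eq_integral(1)[OF c])
    qed
  qed
  thus "L (time_average t F) = c" using L unfolding generalized_Banach_limit_def by blast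
qed

text \<open>The shift inside \<open>cocycle\<close> cancels the one in its argument, so along an
  orbit of the base the cocycle is the solution operator of a single path.\<close>

lemma cocycle_\<theta>:
  assumes "\<omega> \<in> path_space"
  shows "cocycle v h t s (\<theta> s \<omega>) x = u_sol v h (t + s) s \<omega> x"
  using assms by (simp add: cocycle_def \<theta>_add \<theta>_zero)

text \<open>The noise term added at time \<open>r\<close> is subtracted again when the equation
  restarts there, so the three claims reduce to those for the flow of the random equation.\<close>

lemma u_sol_evolution:
  assumes "one_sided_lipschitz_flow F (\<lambda>t s x. v t s \<omega> x)"
    and Z: "continuous_on UNIV (\<lambda>t. ou_z (\<theta> t \<omega>))" and h: "continuous_on UNIV h"
  shows "s \<le> r \<Longrightarrow> r \<le> t \<Longrightarrow> u_sol v h t r \<omega> (u_sol v h r s \<omega> x) = u_sol v h t s \<omega> x"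
    and "s \<le> t \<Longrightarrow> continuous_on UNIV (u_sol v h t s \<omega>)"
    and "continuous_on UNIV y \<Longrightarrow> continuous_on {..t} (\<lambda>s. u_sol v h t s \<omega> (y s))"
proof -
  interpret one_sided_lipschitz_flow F "\<lambda>t s x. v t s \<omega> x" by fact
  show "u_sol v h t r \<omega> (u_sol v h r s \<omega> x) = u_sol v h t s \<omega> x" if "s \<le> r" "r \<le> t"
    using flow[OF that] by (simp add: u_sol_def)
  show "continuous_on UNIV (u_sol v h t s \<omega>)" if "s \<le> t"
    unfolding u_sol_def[abs_def]
    by (intro continuous_intros continuous_on_compose2[OF continuous_initial_value[OF that]]) auto
  show "continuous_on {..t} (\<lambda>s. u_sol v h t s \<omega> (y s))" if "continuous_on UNIV y"
    unfolding u_sol_def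
    by (intro continuous_intros continuous_initial_time continuous_on_subset[OF that]
        continuous_on_subset[OF Z] continuous_on_subset[OF h]) auto
qed

theorem theorem4p9:
  fixes lam lam0 lam1 q \<epsilon> \<beta> :: real
    and \<alpha>1 \<alpha>2 :: "int \<Rightarrow> real"
    and \<gamma> :: "real \<Rightarrow> real"
    and f :: "int \<Rightarrow> real \<Rightarrow> real"
    and g :: "int \<Rightarrow> real \<Rightarrow> real \<Rightarrow> real"
    and \<psi>1 \<psi>2 \<psi>3 \<psi>4 :: "real \<Rightarrow> int \<Rightarrow> real"
    and h h' :: "real \<Rightarrow> ell2"
    and P :: "(real \<Rightarrow> real) measure"
    and \<Omega> :: "(real \<Rightarrow> real) set"
    and v \<phi> :: "real \<Rightarrow> real \<Rightarrow> (real \<Rightarrow> real) \<Rightarrow> ell2 \<Rightarrow> ell2"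
    and A :: "real \<Rightarrow> (real \<Rightarrow> real) \<Rightarrow> ell2 set"
    and L :: "(real \<Rightarrow> real) \<Rightarrow> real"
    and \<xi> :: "real \<Rightarrow> (real \<Rightarrow> real) \<Rightarrow> ell2"
  assumes "0 < lam1" "lam1 < lam0" "lam0 < lam"
    and "cond_F q \<epsilon> \<alpha>1 \<alpha>2 \<gamma> f"
    and "cond_G1 q \<beta> \<psi>1 \<psi>2 \<psi>3 \<psi>4 g"
    and "cond_G2 lam1 \<psi>1 \<psi>3 \<psi>4"
    and "cond_H1 q h h'"
    and "cond_H2 lam1 q h h'"
    and "wiener_measure P"
    and "admissible_paths P \<Omega>"
    and "\<forall>\<tau>. \<forall>\<omega>\<in>\<Omega>. \<forall>x. global_solution (\<lambda>t. rhs lam f g h h' t \<omega>) \<tau> x (\<lambda>t. v t \<tau> \<omega> x)"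
    and "\<phi> = cocycle v h"
    and "pullback_attractor P \<Omega> lam0 \<phi> A"
    and "generalized_Banach_limit L"
    and "(\<lambda>\<tau> \<omega>. {\<xi> \<tau> \<omega>}) \<in> tempered_sets P \<Omega> lam0"
    and "\<forall>\<omega>\<in>\<Omega>. continuous_on UNIV (\<lambda>\<tau>. \<xi> \<tau> (\<theta> \<tau> \<omega>))"
  shows "\<exists>\<mu> :: real \<Rightarrow> (real \<Rightarrow> real) \<Rightarrow> ell2 measure.
    (\<forall>\<tau>. \<forall>\<omega>\<in>\<Omega>. sets (\<mu> \<tau> \<omega>) = sets borel \<and> prob_space (\<mu> \<tau> \<omega>) \<and>
       measure_support (\<mu> \<tau> \<omega>) \<subseteq> A \<tau> \<omega>) \<and>
    (\<forall>\<Upsilon> :: ell2 \<Rightarrow> real. continuous_on UNIV \<Upsilon> \<longrightarrow>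
      (\<forall>t. AE \<omega> in restrict_space P \<Omega>.
         averageable t (\<lambda>s. \<Upsilon> (\<phi> (t - s) s (\<theta> s \<omega>) (\<xi> s (\<theta> s \<omega>)))) \<and>
         integrable (\<mu> t (\<theta> t \<omega>)) \<Upsilon> \<and>
         (\<forall>s\<le>t. integrable (\<mu> s (\<theta> s \<omega>)) (\<lambda>u. \<Upsilon> (\<phi> (t - s) s (\<theta> s \<omega>) u))) \<and>
         averageable t (\<lambda>s. LINT u|\<mu> s (\<theta> s \<omega>). \<Upsilon> (\<phi> (t - s) s (\<theta> s \<omega>) u)) \<and>
         L (time_average t (\<lambda>s. \<Upsilon> (\<phi> (t - s) s (\<theta> s \<omega>) (\<xi> s (\<theta> s \<omega>)))))
           = (LINT u:A t (\<theta> t \<omega>)|\<mu> t (\<theta> t \<omega>). \<Upsilon> u) \<and>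
         (LINT u:A t (\<theta> t \<omega>)|\<mu> t (\<theta> t \<omega>). \<Upsilon> u) = (LINT u|\<mu> t (\<theta> t \<omega>). \<Upsilon> u) \<and>
         (LINT u|\<mu> t (\<theta> t \<omega>). \<Upsilon> u)
           = L (time_average t (\<lambda>s. LINT u|\<mu> s (\<theta> s \<omega>). \<Upsilon> (\<phi> (t - s) s (\<theta> s \<omega>) u)))) \<and>
      (\<forall>\<tau>. AE \<omega> in restrict_space P \<Omega>. \<forall>t\<ge>0.
         set_integrable (\<mu> (\<tau> + t) (\<theta> t \<omega>)) (A (\<tau> + t) (\<theta> t \<omega>)) \<Upsilon> \<and>
         set_integrable (\<mu> \<tau> \<omega>) (A \<tau> \<omega>) (\<lambda>u. \<Upsilon> (\<phi> t \<tau> \<omega> u)) \<and>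
         (LINT u:A (\<tau> + t) (\<theta> t \<omega>)|\<mu> (\<tau> + t) (\<theta> t \<omega>). \<Upsilon> u)
           = (LINT u:A \<tau> \<omega>|\<mu> \<tau> \<omega>. \<Upsilon> (\<phi> t \<tau> \<omega> u))))"
proof -
  define U where "U = (\<lambda>\<omega> t s. u_sol v h t s \<omega>)"
  have ps: "\<omega> \<in> path_space" if "\<omega> \<in> \<Omega>" for \<omega>
    using assms(9,10) sets.sets_into_space[of \<Omega> P] that by (auto simp: admissible_paths_def wiener_measure_def)
  have \<theta>\<Omega>: "\<theta> t \<omega> \<in> \<Omega>" if "\<omega> \<in> \<Omega>" for t \<omega>
    using assms(10) that by (auto simp: admissible_paths_def)
  have Z: "continuous_on UNIV (\<lambda>t. ou_z (\<theta> t \<omega>))" if "\<omega> \<in> \<Omega>" for \<omega>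
    using assms(10) that by (simp add: admissible_paths_def)
  have hc: "continuous_on UNIV h" by (rule cond_H1_continuous[OF assms(7)])
  have flow: "one_sided_lipschitz_flow (\<lambda>t. rhs lam f g h h' t \<omega>) (\<lambda>t s x. v t s \<omega> x)" if w: "\<omega> \<in> \<Omega>" for \<omega>
  proof
    show "global_solution (\<lambda>t. rhs lam f g h h' t \<omega>) s x (\<lambda>t. v t s \<omega> x)" for s x
      using assms(11) w by blast
  qed (rule rhs_one_sided_lipschitz[OF assms(4,5,7) Z[OF w]] rhs_bound[OF assms(4,5,7) Z[OF w]])+
  have evol: "s \<le> r \<Longrightarrow> r \<le> t \<Longrightarrow> U \<omega> t r (U \<omega> r s x) = U \<omega> t s x"
    "s \<le> t \<Longrightarrow> continuous_on UNIV (U \<omega> t s)"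
    "continuous_on UNIV y \<Longrightarrow> continuous_on {..t} (\<lambda>s. U \<omega> t s (y s))" if w: "\<omega> \<in> \<Omega>" for \<omega> s r t x y
    using u_sol_evolution[where v = v and \<omega> = \<omega> and h = h, OF flow[OF w] Z[OF w] hc] by (simp_all add: U_def)
  have \<phi>U: "\<phi> t s (\<theta> s \<omega>) x = U \<omega> (t + s) s x" if "\<omega> \<in> \<Omega>" for \<omega> t s x
    unfolding assms(12) U_def by (rule cocycle_\<theta>[OF ps[OF that]])
  have base: "\<theta> t (\<theta> (- t) \<omega>) = \<omega>" "\<theta> (- t) (\<theta> t \<omega>) = \<omega>" if "\<omega> \<in> \<Omega>" for t \<omega>
    using \<theta>_zero[OF ps[OF that]] by (simp_all add: \<theta>_add)
  have A_ne: "A \<tau> \<omega> \<noteq> {}" if "\<omega> \<in> \<Omega>" for \<tau> \<omega>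
    using assms(13) that by (simp add: pullback_attractor_def nonaut_random_set_def)
  have A_inv: "\<phi> t \<tau> \<omega> ` A \<tau> \<omega> = A (\<tau> + t) (\<theta> t \<omega>)" if "\<omega> \<in> \<Omega>" "0 \<le> t" for t \<tau> \<omega>
    using assms(13) that by (simp add: pullback_attractor_def)
  have A_attracts: "((\<lambda>r. hausdorff_semidist (\<phi> r (\<tau> - r) (\<theta> (- r) \<omega>) ` D (\<tau> - r) (\<theta> (- r) \<omega>)) (A \<tau> \<omega>)) \<longlongrightarrow> 0) at_top"
    if "D \<in> tempered_sets P \<Omega> lam0" "\<omega> \<in> \<Omega>" for D \<tau> \<omega>
    using assms(13) that by (simp add: pullback_attractor_def)
  have A_compact: "AE \<omega> in restrict_space P \<Omega>. compact (A \<tau> \<omega>)" for \<tau>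
    using assms(13) by (simp add: pullback_attractor_def)
  \<comment> \<open>Compactness is required at all real times of the orbit at once, since averages
    ending at every \<open>t\<close> must be represented with the same exceptional set.\<close>
  define good where "good \<omega> \<longleftrightarrow> \<omega> \<in> \<Omega> \<and> (\<forall>s. compact (A s (\<theta> s \<omega>)))" for \<omega>
  have attr: "((\<lambda>s. infdist (U \<omega> t s (\<xi> s (\<theta> s \<omega>))) (A t (\<theta> t \<omega>))) \<longlongrightarrow> 0) at_bot" if w: "\<omega> \<in> \<Omega>" for \<omega> t
  proof (rule order_tendstoI)
    fix e :: real assume "e < 0"
    thus "\<forall>\<^sub>F s in at_bot. e < infdist (U \<omega> t s (\<xi> s (\<theta> s \<omega>))) (A t (\<theta> t \<omega>))"
      by (intro always_eventually allI) (rule less_le_trans[OF _ infdist_nonneg])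
  next
    fix e :: real assume e: "0 < e"
    \<comment> \<open>The tempered family of singletons is attracted at the point (t,
      \<open>\<theta> t \<omega>\<close>); with \<open>r = t - s\<close> its pullback starts at
      \<open>\<xi> s (\<theta> s \<omega>)\<close>.\<close>
    have "((\<lambda>r. hausdorff_semidist (\<phi> r (t - r) (\<theta> (- r) (\<theta> t \<omega>)) ` {\<xi> (t - r) (\<theta> (- r) (\<theta> t \<omega>))}) (A t (\<theta> t \<omega>)))
        \<longlongrightarrow> 0) at_top"
      by (rule A_attracts[OF assms(15) \<theta>\<Omega>[OF w]])
    hence "\<forall>\<^sub>F r in at_top. hausdorff_semidist (\<phi> r (t - r) (\<theta> (- r) (\<theta> t \<omega>)) ` {\<xi> (t - r) (\<theta> (- r) (\<theta> t \<omega>))}) (A t (\<theta> t \<omega>)) < ennreal e"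
      using e by (intro order_tendstoD) auto
    then obtain T where T: "\<And>r. T \<le> r \<Longrightarrow> hausdorff_semidist (\<phi> r (t - r) (\<theta> (- r) (\<theta> t \<omega>)) ` {\<xi> (t - r) (\<theta> (- r) (\<theta> t \<omega>))}) (A t (\<theta> t \<omega>)) < ennreal e"
      by (auto simp: eventually_at_top_linorder)
    have "infdist (U \<omega> t s (\<xi> s (\<theta> s \<omega>))) (A t (\<theta> t \<omega>)) < e" if "s \<le> t - T" for s
    proof -
      have "(INF c\<in>A t (\<theta> t \<omega>). ennreal (dist (U \<omega> t s (\<xi> s (\<theta> s \<omega>))) c)) < ennreal e"
        using T[of "t - s"] that by (simp add: hausdorff_semidist_def \<theta>_add \<phi>U[OF w])
      then obtain c where c: "c \<in> A t (\<theta> t \<omega>)" "dist (U \<omega> t s (\<xi> s (\<theta> s \<omega>))) c < e"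
        by (auto simp: INF_less_iff ennreal_less_iff)
      show ?thesis by (rule le_less_trans[OF infdist_le[OF c(1)] c(2)])
    qed
    thus "\<forall>\<^sub>F s in at_bot. infdist (U \<omega> t s (\<xi> s (\<theta> s \<omega>))) (A t (\<theta> t \<omega>)) < e"
      by (auto simp: eventually_at_bot_linorder)
  qed
  have evo: "pullback_evolution (U \<omega>) (\<lambda>t. A t (\<theta> t \<omega>)) (\<lambda>s. \<xi> s (\<theta> s \<omega>)) L" if "good \<omega>" for \<omega>
  proof -
    have w: "\<omega> \<in> \<Omega>" using that by (simp add: good_def)
    show ?thesis
    proof
      show "continuous_on {..t} (\<lambda>s. U \<omega> t s (\<xi> s (\<theta> s \<omega>)))" for t
        using assms(16) w by (intro evol(3)[OF w]) blast
      show "compact (A t (\<theta> t \<omega>))" for t using that by (simp add: good_def)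
    qed (use evol(1,2)[OF w] A_ne[OF \<theta>\<Omega>[OF w]] attr[OF w] assms(14) in auto)
  qed
  define stat where "stat \<omega> \<nu> \<longleftrightarrow> (\<forall>t. sets (\<nu> t) = sets borel \<and> prob_space (\<nu> t) \<and> emeasure (\<nu> t) (- A t (\<theta> t \<omega>)) = 0 \<and>
     (\<forall>\<Upsilon> :: ell2 \<Rightarrow> real. continuous_on UNIV \<Upsilon> \<longrightarrow>
        averageable t (\<lambda>s. \<Upsilon> (U \<omega> t s (\<xi> s (\<theta> s \<omega>)))) \<and> integrable (\<nu> t) \<Upsilon> \<and>
        L (time_average t (\<lambda>s. \<Upsilon> (U \<omega> t s (\<xi> s (\<theta> s \<omega>))))) = (LINT u|\<nu> t. \<Upsilon> u) \<and>
        (\<forall>s\<le>t. integrable (\<nu> s) (\<lambda>u. \<Upsilon> (U \<omega> t s u)) \<and> (LINT u|\<nu> s. \<Upsilon> (U \<omega> t s u)) = (LINT u|\<nu> t. \<Upsilon> u))))"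
    for \<omega> and \<nu> :: "real \<Rightarrow> ell2 measure"
  \<comment> \<open>One choice per path yields the measures for all times together, so the relations
    between different times survive the choice.\<close>
  define N where "N \<omega> = (SOME \<nu>. stat \<omega> \<nu>)" for \<omega>
  have N: "stat \<omega> (N \<omega>)" if "good \<omega>" for \<omega>
    unfolding N_def
  proof (rule someI_ex[of "stat \<omega>"])
    show "\<exists>\<nu>. stat \<omega> \<nu>"
      unfolding stat_def by (rule pullback_evolution.statistical_solution[OF evo[OF that]])
  qed
  \<comment> \<open>The pair is traced back to its base path at time 0. On exceptional paths a point
    mass in the fibre is used, because the support condition is claimed for every \<omega> in
    \<Omega>.\<close>
  define \<mu> where "\<mu> \<tau> \<omega> = (if good (\<theta> (- \<tau>) \<omega>) then N (\<theta> (- \<tau>) \<omega>) \<tau>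
      else return borel (SOME x. x \<in> A \<tau> \<omega>))" for \<tau> \<omega>
  have \<mu>N: "\<mu> t (\<theta> t \<omega>) = N \<omega> t" if "good \<omega>" for t \<omega>
    using that base(2)[of \<omega> t] by (simp add: \<mu>_def good_def)
  have "\<mu> \<tau> \<omega> \<in> {M. sets M = sets borel \<and> prob_space M \<and> measure_support M \<subseteq> A \<tau> \<omega>}" if w: "\<omega> \<in> \<Omega>" for \<tau> \<omega>
  proof (cases "good (\<theta> (- \<tau>) \<omega>)")
    case True
    have \<mu>: "\<mu> \<tau> \<omega> = N (\<theta> (- \<tau>) \<omega>) \<tau>" using True by (simp add: \<mu>_def)
    have "sets (N (\<theta> (- \<tau>) \<omega>) \<tau>) = sets borel \<and> prob_space (N (\<theta> (- \<tau>) \<omega>) \<tau>) \<and>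
        emeasure (N (\<theta> (- \<tau>) \<omega>) \<tau>) (- A \<tau> (\<theta> \<tau> (\<theta> (- \<tau>) \<omega>))) = 0"
      using N[OF True] unfolding stat_def by simp
    hence s: "sets (\<mu> \<tau> \<omega>) = sets borel" "prob_space (\<mu> \<tau> \<omega>)" "emeasure (\<mu> \<tau> \<omega>) (- A \<tau> \<omega>) = 0"
      by (simp_all add: \<mu> base(1)[OF w])
    have "compact (A \<tau> (\<theta> \<tau> (\<theta> (- \<tau>) \<omega>)))" using True by (simp add: good_def)
    hence "compact (A \<tau> \<omega>)" by (simp add: base(1)[OF w])
    thus ?thesis using s measure_support_subset[OF s(1) compact_imp_closed s(3)] by simp
  next
    case False
    have "(SOME x. x \<in> A \<tau> \<omega>) \<in> A \<tau> \<omega>" using A_ne[OF w] by (simp add: some_in_eq)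
    moreover have "measure_support (return borel (SOME x. x \<in> A \<tau> \<omega>)) \<subseteq> {SOME x. x \<in> A \<tau> \<omega>}"
      by (rule measure_support_return)
    ultimately have "measure_support (return borel (SOME x. x \<in> A \<tau> \<omega>)) \<subseteq> A \<tau> \<omega>" by blast
    thus ?thesis using False by (simp add: \<mu>_def prob_space_return)
  qed
  hence part1: "\<forall>\<tau>. \<forall>\<omega>\<in>\<Omega>. sets (\<mu> \<tau> \<omega>) = sets borel \<and> prob_space (\<mu> \<tau> \<omega>) \<and> measure_support (\<mu> \<tau> \<omega>) \<subseteq> A \<tau> \<omega>"
    by simp
  have \<Omega>sets: "\<Omega> \<inter> space P \<in> sets P" using assms(10) by (auto simp: admissible_paths_def)
  have good_AE: "AE \<omega> in P. \<omega> \<in> \<Omega> \<longrightarrow> good \<omega>"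
  proof -
    \<comment> \<open>The statement on the restricted space is written as an implication under
      \<open>P\<close>, because the shift invariance is that of \<open>P\<close>. Countably many
      \<open>n\<close> allow one common null set.\<close>
    have "AE \<omega> in P. \<theta> (- real n) \<omega> \<in> \<Omega> \<longrightarrow> compact (A (- real n) (\<theta> (- real n) \<omega>))" for n
    proof (rule wiener_AE_shift[OF assms(9)])
      show "AE \<omega> in P. \<omega> \<in> \<Omega> \<longrightarrow> compact (A (- real n) \<omega>)"
        using A_compact[of "- real n"] by (simp add: AE_restrict_space_iff[OF \<Omega>sets])
    qed
    hence "AE \<omega> in P. \<forall>n. \<theta> (- real n) \<omega> \<in> \<Omega> \<longrightarrow> compact (A (- real n) (\<theta> (- real n) \<omega>))"
      by (simp add: AE_all_countable)
    thus ?thesis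
    proof eventually_elim
      case (elim \<omega>)
      show ?case
      proof
        assume w: "\<omega> \<in> \<Omega>"
        have "compact (A s (\<theta> s \<omega>))" for s
        proof -
          obtain n :: nat where n: "- s \<le> real n" using real_arch_simple by blast
          let ?r = "- real n"
          have "\<phi> (s - ?r) ?r (\<theta> ?r \<omega>) ` A ?r (\<theta> ?r \<omega>) = A (?r + (s - ?r)) (\<theta> (s - ?r) (\<theta> ?r \<omega>))"
            using n by (intro A_inv \<theta>\<Omega>[OF w]) simp
          hence "A s (\<theta> s \<omega>) = U \<omega> s ?r ` A ?r (\<theta> ?r \<omega>)"
            by (simp add: \<theta>_add \<phi>U[OF w])
          moreover have "continuous_on (A ?r (\<theta> ?r \<omega>)) (U \<omega> s ?r)"
            by (rule continuous_on_subset[OF evol(2)[OF w] subset_UNIV]) (use n in linarith)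
          ultimately show ?thesis
            using elim[rule_format, OF \<theta>\<Omega>[OF w], of n] compact_continuous_image by metis
        qed
        thus "good \<omega>" using w by (simp add: good_def)
      qed
    qed
  qed
  have full: "set_integrable (\<mu> t (\<theta> t \<omega>)) (A t (\<theta> t \<omega>)) \<Upsilon>"
    "(LINT u:A t (\<theta> t \<omega>)|\<mu> t (\<theta> t \<omega>). \<Upsilon> u) = (LINT u|\<mu> t (\<theta> t \<omega>). \<Upsilon> u)"
    if g: "good \<omega>" and i: "integrable (N \<omega> t) \<Upsilon>" for \<omega> t and \<Upsilon> :: "ell2 \<Rightarrow> real"
  proof -
    have s: "sets (N \<omega> t) = sets borel" "emeasure (N \<omega> t) (- A t (\<theta> t \<omega>)) = 0"
      using N[OF g] by (auto simp: stat_def)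
    have sp: "space (N \<omega> t) = UNIV" using sets_eq_imp_space_eq[OF s(1)] by simp
    have "A t (\<theta> t \<omega>) \<in> sets (N \<omega> t)"
      unfolding s(1) using g by (intro borel_closed compact_imp_closed) (simp add: good_def)
    from set_integral_full[OF _ this i] s(2) sp
    show "set_integrable (\<mu> t (\<theta> t \<omega>)) (A t (\<theta> t \<omega>)) \<Upsilon>"
      "(LINT u:A t (\<theta> t \<omega>)|\<mu> t (\<theta> t \<omega>). \<Upsilon> u) = (LINT u|\<mu> t (\<theta> t \<omega>). \<Upsilon> u)"
      by (simp_all add: \<mu>N[OF g] Compl_eq_Diff_UNIV)
  qed
  have part2: "averageable t (\<lambda>s. \<Upsilon> (\<phi> (t - s) s (\<theta> s \<omega>) (\<xi> s (\<theta> s \<omega>)))) \<and>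
         integrable (\<mu> t (\<theta> t \<omega>)) \<Upsilon> \<and>
         (\<forall>s\<le>t. integrable (\<mu> s (\<theta> s \<omega>)) (\<lambda>u. \<Upsilon> (\<phi> (t - s) s (\<theta> s \<omega>) u))) \<and>
         averageable t (\<lambda>s. LINT u|\<mu> s (\<theta> s \<omega>). \<Upsilon> (\<phi> (t - s) s (\<theta> s \<omega>) u)) \<and>
         L (time_average t (\<lambda>s. \<Upsilon> (\<phi> (t - s) s (\<theta> s \<omega>) (\<xi> s (\<theta> s \<omega>)))))
           = (LINT u:A t (\<theta> t \<omega>)|\<mu> t (\<theta> t \<omega>). \<Upsilon> u) \<and>
         (LINT u:A t (\<theta> t \<omega>)|\<mu> t (\<theta> t \<omega>). \<Upsilon> u) = (LINT u|\<mu> t (\<theta> t \<omega>). \<Upsilon> u) \<and>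
         (LINT u|\<mu> t (\<theta> t \<omega>). \<Upsilon> u)
           = L (time_average t (\<lambda>s. LINT u|\<mu> s (\<theta> s \<omega>). \<Upsilon> (\<phi> (t - s) s (\<theta> s \<omega>) u)))"
    if c: "continuous_on UNIV \<Upsilon>" and g: "good \<omega>" for \<Upsilon> :: "ell2 \<Rightarrow> real" and t \<omega>
  proof -
    have w: "\<omega> \<in> \<Omega>" using g by (simp add: good_def)
    have \<phi>: "\<phi> (t - s) s (\<theta> s \<omega>) x = U \<omega> t s x" for s x using \<phi>U[OF w, of "t - s" s x] by simp
    have st: "averageable t (\<lambda>s. \<Upsilon> (U \<omega> t s (\<xi> s (\<theta> s \<omega>))))" "integrable (N \<omega> t) \<Upsilon>"
      "L (time_average t (\<lambda>s. \<Upsilon> (U \<omega> t s (\<xi> s (\<theta> s \<omega>))))) = (LINT u|N \<omega> t. \<Upsilon> u)"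
      "\<And>s. s \<le> t \<Longrightarrow> integrable (N \<omega> s) (\<lambda>u. \<Upsilon> (U \<omega> t s u))"
      "\<And>s. s \<le> t \<Longrightarrow> (LINT u|N \<omega> s. \<Upsilon> (U \<omega> t s u)) = (LINT u|N \<omega> t. \<Upsilon> u)"
      using N[OF g] c unfolding stat_def by blast+
    have avg: "averageable t (\<lambda>s. LINT u|N \<omega> s. \<Upsilon> (U \<omega> t s u))"
      by (rule averageable_const(1)) (rule st(5))
    have lim: "L (time_average t (\<lambda>s. LINT u|N \<omega> s. \<Upsilon> (U \<omega> t s u))) = (LINT u|N \<omega> t. \<Upsilon> u)"
      by (rule averageable_const(2)[OF _ assms(14)]) (rule st(5))
    show ?thesis
      unfolding full(2)[OF g st(2)] unfolding \<phi> \<mu>N[OF g]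
      using st avg lim by simp
  qed
  have part3: "set_integrable (\<mu> (\<tau> + t) (\<theta> t \<omega>)) (A (\<tau> + t) (\<theta> t \<omega>)) \<Upsilon> \<and>
         set_integrable (\<mu> \<tau> \<omega>) (A \<tau> \<omega>) (\<lambda>u. \<Upsilon> (\<phi> t \<tau> \<omega> u)) \<and>
         (LINT u:A (\<tau> + t) (\<theta> t \<omega>)|\<mu> (\<tau> + t) (\<theta> t \<omega>). \<Upsilon> u)
           = (LINT u:A \<tau> \<omega>|\<mu> \<tau> \<omega>. \<Upsilon> (\<phi> t \<tau> \<omega> u))"
    if c: "continuous_on UNIV \<Upsilon>" and w: "\<omega> \<in> \<Omega>" and g: "good (\<theta> (- \<tau>) \<omega>)" and t: "0 \<le> t"
    for \<Upsilon> :: "ell2 \<Rightarrow> real" and t \<tau> \<omega>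
  proof -
    define \<eta> where "\<eta> = \<theta> (- \<tau>) \<omega>"
    have g: "good \<eta>" using g by (simp add: \<eta>_def)
    have eta: "\<omega> = \<theta> \<tau> \<eta>" "\<theta> t \<omega> = \<theta> (\<tau> + t) \<eta>"
      using base(1)[OF w, of \<tau>] by (simp_all add: \<eta>_def \<theta>_add)
    have \<eta>: "\<eta> \<in> \<Omega>" using g by (simp add: good_def)
    have \<phi>: "\<phi> t \<tau> (\<theta> \<tau> \<eta>) x = U \<eta> (\<tau> + t) \<tau> x" for x using \<phi>U[OF \<eta>, of t \<tau> x] by (simp add: add.commute)
    have st: "integrable (N \<eta> (\<tau> + t)) \<Upsilon>" "integrable (N \<eta> \<tau>) (\<lambda>u. \<Upsilon> (U \<eta> (\<tau> + t) \<tau> u))"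
      "(LINT u|N \<eta> \<tau>. \<Upsilon> (U \<eta> (\<tau> + t) \<tau> u)) = (LINT u|N \<eta> (\<tau> + t). \<Upsilon> u)"
      using N[OF g] c t unfolding stat_def by simp_all
    show ?thesis
      unfolding eta(2) unfolding eta(1) \<phi>
      using full[OF g st(1)] full[OF g st(2)] st(3) by (simp add: \<mu>N[OF g])
  qed
  \<comment> \<open>In the invariance statement \<omega> is the path seen at time \<tau>, so its
    base path is \<open>\<theta> (- \<tau>) \<omega>\<close>. For each \<tau> this shifts one null
    set, which then serves all \<open>t \<ge> 0\<close>.\<close>
  have good_shift: "AE \<omega> in P. \<theta> (- \<tau>) \<omega> \<in> \<Omega> \<longrightarrow> good (\<theta> (- \<tau>) \<omega>)" for \<tau>
    by (rule wiener_AE_shift[OF assms(9) good_AE])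
  show ?thesis
  proof (intro exI[of _ \<mu>] conjI[OF part1] allI impI conjI, goal_cases)
    case (1 \<Upsilon> t)
    show ?case
      unfolding AE_restrict_space_iff[OF \<Omega>sets]
      using good_AE by eventually_elim (use part2[OF 1] in blast)
  next
    case (2 \<Upsilon> \<tau>)
    show ?case
      unfolding AE_restrict_space_iff[OF \<Omega>sets]
      using good_shift[of \<tau>]
    proof eventually_elim
      case (elim \<omega>)
      show ?case
      proof (intro impI allI)
        fix t :: real assume w: "\<omega> \<in> \<Omega>" and t: "0 \<le> t"
        show "set_integrable (\<mu> (\<tau> + t) (\<theta> t \<omega>)) (A (\<tau> + t) (\<theta> t \<omega>)) \<Upsilon> \<and>
         set_integrable (\<mu> \<tau> \<omega>) (A \<tau> \<omega>) (\<lambda>u. \<Upsilon> (\<phi> t \<tau> \<omega> u)) \<and>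
         (LINT u:A (\<tau> + t) (\<theta> t \<omega>)|\<mu> (\<tau> + t) (\<theta> t \<omega>). \<Upsilon> u)
           = (LINT u:A \<tau> \<omega>|\<mu> \<tau> \<omega>. \<Upsilon> (\<phi> t \<tau> \<omega> u))"
          using part3[OF 2 w _ t] elim \<theta>\<Omega>[OF w] by blast
      qed
    qed
  qed
qed

end
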